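(* Assume the Riemann hypothesis. Fix $\beta\in(0,1)$, let $A>0$, and for large $T$ put $\sigma_A := 1 - A/\log\log T$. Let $x>0$ be given and define $$\mathcal{M}(T,x) = \left\{ t \in [T^{\beta}, T] : -\operatorname{Re}\frac{\zeta'}{\zeta}(\sigma_A+it) \geqslant \frac{\log\log T}{\log\log\log T}\left(\frac{e^{A}-1}{A}\log\log\log T - x\right)\right\}.$$ Then, as $T\to\infty$, $$\operatorname{meas}\big(\mathcal{M}(T,x)\big) \geqslant T^{1-(1-\beta)e^{-x}+o(1)},$$ where $\operatorname{meas}$ denotes Lebesgue measure.
   Context: $\zeta(s)$ is the Riemann zeta function. $A$ is an arbitrary fixed positive real number (the standing parameter defining $\sigma_A$). *)

theory Defs
  imports "HOL-Complex_Analysis.Complex_Analysis"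
begin

text \<open>
  The Riemann zeta function is the analytic continuation of its Dirichlet series to the
  punctured plane. The value at the pole \<open>1\<close> is a convention that makes the continuation
  unique as a total function; existence and uniqueness are proved below.
\<close>

definition is_zeta :: "(complex \<Rightarrow> complex) \<Rightarrow> bool" where
  "is_zeta f \<longleftrightarrow> f holomorphic_on (- {1}) \<and> f 1 = 0 \<and>
     (\<forall>s. Re s > 1 \<longrightarrow> f s = (\<Sum>n. 1 / of_nat (Suc n) powr s))"

definition riemann_zeta :: "complex \<Rightarrow> complex" where
  "riemann_zeta = (THE f. is_zeta f)"

lemma is_zeta_unique:
  assumes "is_zeta f" "is_zeta g"
  shows "f = g"
proof
  fix z :: complex
  show "f z = g z"
  proof (cases "z = 1")
    case True
    then show ?thesis using assms by (simp add: is_zeta_def)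
  next
    case False
    have conn: "connected (- {1 :: complex})"
      by (rule connected_punctured_universe) simp
    have "f z - g z = 0"
    proof (rule analytic_continuation_open[of "{s. Re s > 1}" "- {1}" "\<lambda>z. f z - g z" "\<lambda>_. 0"])
      show "{s. Re s > 1} \<noteq> {}"
        by (auto intro!: exI[of _ 2])
      show "(\<lambda>z. f z - g z) holomorphic_on - {1}"
        using assms by (auto simp: is_zeta_def intro!: holomorphic_intros)
    qed (use assms False conn in \<open>auto simp: is_zeta_def open_halfspace_Re_gt\<close>)
    then show ?thesis by simp
  qed
qed

lemma holomorphic_suminf:
  fixes f :: "nat \<Rightarrow> complex \<Rightarrow> complex"
  assumes S: "open S"
    and hol: "\<And>n. f n holomorphic_on S"
    and bnd: "\<And>x. x \<in> S \<Longrightarrow> \<exists>d>0. cball x d \<subseteq> S \<and>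
               (\<exists>M. summable M \<and> (\<forall>n. \<forall>y\<in>cball x d. norm (f n y) \<le> M n))"
  shows "(\<lambda>x. \<Sum>n. f n x) holomorphic_on S"
proof (rule holomorphic_uniform_sequence[OF S, where f = "\<lambda>N x. \<Sum>n<N. f n x"])
  show "(\<lambda>x. \<Sum>n<N. f n x) holomorphic_on S" for N
    by (intro holomorphic_intros hol)
next
  fix x assume "x \<in> S"
  from bnd[OF this] obtain d M where d: "d > 0" "cball x d \<subseteq> S" "summable M"
    "\<And>n y. y \<in> cball x d \<Longrightarrow> norm (f n y) \<le> M n" by blast
  have "uniform_limit (cball x d) (\<lambda>N x. \<Sum>n<N. f n x) (\<lambda>x. \<Sum>n. f n x) sequentially"
    by (rule Weierstrass_m_test[OF _ d(3)]) (use d in auto)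
  with d show "\<exists>d>0. cball x d \<subseteq> S \<and>
      uniform_limit (cball x d) (\<lambda>N x. \<Sum>n<N. f n x) (\<lambda>x. \<Sum>n. f n x) sequentially"
    by blast
qed

lemma norm_nat_powr: "norm (of_nat (Suc n) powr s :: complex) = real (Suc n) powr Re s"
  by (metis norm_powr_real_powr of_nat_0_le_iff of_real_of_nat_eq Re_complex_of_real Reals_of_nat)

lemma summable_Suc_powr: "e < -1 \<Longrightarrow> summable (\<lambda>n. real (Suc n) powr e)"
  using summable_real_powr_iff[of e] by (subst summable_Suc_iff) simp

lemma summable_complex_Suc_powr:
  "Re s < -1 \<Longrightarrow> summable (\<lambda>n. of_nat (Suc n) powr s :: complex)"
  by (rule summable_norm_cancel) (simp add: norm_nat_powr summable_Suc_powr del: of_nat_Suc)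

text \<open>
  Existence: expanding the telescoping sum of \<open>(n + 1) powr (1 - s) - n powr (1 - s)\<close> by the binomial series gives
  a recursion that expresses \<open>(s - 1) \<zeta>(s)\<close> by values further to the right, plus the series of
  Taylor remainders \<open>dterm\<close>. Each application extends the continuation by one unit to the left.
\<close>

definition dterm :: "nat \<Rightarrow> nat \<Rightarrow> complex \<Rightarrow> complex" where
  "dterm K n s = of_nat (Suc (Suc n)) powr (1 - s)
     - (\<Sum>k\<le>K. ((1 - s) gchoose k) * of_nat (Suc n) powr (1 - s - of_nat k))"

lemma dterm_bound:
  assumes "Re s > 1 - real K"
  shows "norm (dterm K n s) \<le>
           norm (\<Prod>j<Suc K. (1 - s - of_nat j)) * real (Suc n) powr (- Re s - real K)"
proof -
  define a where "a = 1 - s"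
  define f :: "nat \<Rightarrow> complex \<Rightarrow> complex"
    where "f = (\<lambda>i z. (\<Prod>j<i. (a - of_nat j)) * z powr (a - of_nat i))"
  define S where "S = closed_segment (of_nat (Suc n) :: complex) (of_nat (Suc (Suc n)))"
  define B where "B = norm (\<Prod>j<Suc K. (a - of_nat j)) * real (Suc n) powr (- Re s - real K)"
  have S: "\<exists>u. z = of_real u \<and> u \<ge> real (Suc n)" if "z \<in> S" for z
  proof -
    have "z \<in> closed_segment (of_real (real (Suc n))) (of_real (real (Suc (Suc n))))"
      using that by (simp add: S_def)
    then have "z \<in> of_real ` closed_segment (real (Suc n)) (real (Suc (Suc n)))"
      by (simp only: closed_segment_of_real)
    then show ?thesis
      by (auto simp: closed_segment_eq_real_ivl)
  qed
  have "norm (f 0 (of_nat (Suc (Suc n))) -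
          (\<Sum>i\<le>K. f i (of_nat (Suc n)) * (of_nat (Suc (Suc n)) - of_nat (Suc n)) ^ i / fact i))
      \<le> B * norm (of_nat (Suc (Suc n)) - of_nat (Suc n) :: complex) ^ Suc K / fact K"
  proof (rule complex_Taylor[where S = S])
    fix i z assume z: "z \<in> S" "i \<le> K"
    from S[OF z(1)] obtain u where u: "z = of_real u" "u \<ge> real (Suc n)" by blast
    then have nz: "z \<notin> \<real>\<^sub>\<le>\<^sub>0" by (auto simp: complex_nonpos_Reals_iff)
    show "(f i has_field_derivative f (Suc i) z) (at z within S)"
      unfolding f_def
      by (rule DERIV_subset[OF DERIV_cong[OF DERIV_cmult[OF has_field_derivative_powr[OF nz]]]])
         (auto simp: algebra_simps)
  next
    fix z assume z: "z \<in> S"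
    from S[OF z] obtain u where u: "z = of_real u" "u \<ge> real (Suc n)" by blast
    have "norm (z powr (a - of_nat (Suc K))) = u powr (- Re s - real K)"
      using u by (subst norm_powr_real_powr) (auto simp: a_def)
    also have "\<dots> \<le> real (Suc n) powr (- Re s - real K)"
      using u assms by (intro powr_mono2') auto
    finally show "norm (f (Suc K) z) \<le> B"
      unfolding f_def B_def norm_mult by (intro mult_left_mono) auto
  qed (auto simp: S_def)
  also have "\<dots> \<le> B"
  proof -
    have "B \<ge> 0" by (simp add: B_def del: prod.lessThan_Suc)
    then have "B * 1 \<le> B * fact K" by (intro mult_left_mono fact_ge_1)
    then show ?thesis by (simp add: divide_le_eq)
  qed
  also have "f 0 (of_nat (Suc (Suc n))) -
          (\<Sum>i\<le>K. f i (of_nat (Suc n)) * (of_nat (Suc (Suc n)) - of_nat (Suc n)) ^ i / fact i)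
          = dterm K n s"
    by (simp add: f_def dterm_def a_def gbinomial_prod_rev lessThan_atLeast0)
  finally show ?thesis by (simp add: B_def a_def)
qed

lemma dterm_holomorphic: "dterm K n holomorphic_on S"
  unfolding dterm_def gbinomial_prod_rev by (intro holomorphic_intros) auto

lemma dterm_suminf_holomorphic:
  "(\<lambda>s. \<Sum>n. dterm K n s) holomorphic_on {s. Re s > 1 - real K}"
proof (rule holomorphic_suminf)
  show "open {s. Re s > 1 - real K}" by (rule open_halfspace_Re_gt)
next
  fix x assume x: "x \<in> {s. Re s > 1 - real K}"
  define d where "d = (Re x - (1 - real K)) / 2"
  have d: "d > 0" "Re x - d > 1 - real K" using x by (auto simp: d_def field_simps)
  have Re: "Re y \<ge> Re x - d" if "y \<in> cball x d" for y
    using that abs_Re_le_cmod[of "x - y"] by (auto simp: dist_norm)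
  have "compact ((\<lambda>s. \<Prod>j<Suc K. (1 - s - of_nat j)) ` cball x d)"
    by (intro compact_continuous_image continuous_intros) auto
  then obtain C where C: "\<And>y. y \<in> cball x d \<Longrightarrow> norm (\<Prod>j<Suc K. (1 - y - of_nat j)) \<le> C"
    by (meson bounded_iff compact_imp_bounded imageI)
  have "C \<ge> 0" using C[of x] d norm_ge_zero order_trans by (metis centre_in_cball less_imp_le)
  show "\<exists>d>0. cball x d \<subseteq> {s. Re s > 1 - real K} \<and>
      (\<exists>M. summable M \<and> (\<forall>n. \<forall>y\<in>cball x d. norm (dterm K n y) \<le> M n))"
  proof (intro exI[of _ d] conjI exI[of _ "\<lambda>n. C * real (Suc n) powr (- (Re x - d) - real K)"] allI ballI)
    show "cball x d \<subseteq> {s. Re s > 1 - real K}" using Re d by force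
    show "summable (\<lambda>n. C * real (Suc n) powr (- (Re x - d) - real K))"
      by (intro summable_mult summable_Suc_powr) (use d in auto)
    fix n y assume y: "y \<in> cball x d"
    have "norm (dterm K n y) \<le>
        norm (\<Prod>j<Suc K. (1 - y - of_nat j)) * real (Suc n) powr (- Re y - real K)"
      by (rule dterm_bound) (use Re[OF y] d in auto)
    also have "\<dots> \<le> C * real (Suc n) powr (- (Re x - d) - real K)"
      by (intro mult_mono C y powr_mono) (use Re[OF y] \<open>C \<ge> 0\<close> in auto)
    finally show "norm (dterm K n y) \<le> C * real (Suc n) powr (- (Re x - d) - real K)" .
  qed (use d in auto)
qed (rule dterm_holomorphic)

definition dirichlet_zeta :: "complex \<Rightarrow> complex" where
  "dirichlet_zeta s = (\<Sum>n. 1 / of_nat (Suc n) powr s)"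

lemma dirichlet_zeta_sums:
  assumes "Re s > 1"
  shows "(\<lambda>n. of_nat (Suc n) powr (- s)) sums dirichlet_zeta s"
  using summable_sums[OF summable_complex_Suc_powr[of "- s"]] assms
  by (simp add: dirichlet_zeta_def powr_minus_divide del: of_nat_Suc)

lemma Suc_powr_tendsto_0:
  assumes "Re s < 0"
  shows "(\<lambda>n. of_nat (Suc n) powr s :: complex) \<longlonglongrightarrow> 0"
proof (rule tendsto_norm_zero_cancel)
  have "(\<lambda>n. real (Suc n) powr Re s) \<longlonglongrightarrow> 0"
    by (rule tendsto_neg_powr[OF assms])
       (rule filterlim_compose[OF filterlim_real_sequentially filterlim_Suc])
  then show "(\<lambda>n. norm (of_nat (Suc n) powr s :: complex)) \<longlonglongrightarrow> 0"
    by (simp add: norm_nat_powr del: of_nat_Suc)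
qed

lemma gchoose_rec:
  fixes a :: complex
  shows "a gchoose Suc k = (a gchoose k) * (a - of_nat k) / of_nat (Suc k)"
  by (simp add: gbinomial_prod_rev field_simps)

lemma dirichlet_zeta_recursion:
  assumes s: "Re s > 1"
  shows "(s - 1) * dirichlet_zeta s =
     1 - (\<Sum>k\<in>{1..<Suc K}. ((1 - s) gchoose k) / of_nat (Suc k) *
             ((s + of_nat k - 1) * dirichlet_zeta (s + of_nat k)))
       + (\<Sum>n. dterm (Suc K) n s)"
proof -
  let ?b = "\<lambda>k. (1 - s) gchoose k" and ?Z = dirichlet_zeta
  have tel: "(\<lambda>n. of_nat (Suc (Suc n)) powr (1 - s) - of_nat (Suc n) powr (1 - s)) sums (0 - 1)"
    using telescope_sums[OF Suc_powr_tendsto_0[of "1 - s"]] s by simp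
  have sms: "(\<lambda>n. ?b (Suc k) * of_nat (Suc n) powr (- (s + of_nat k)))
                sums (?b (Suc k) * ?Z (s + of_nat k))" for k
    by (intro sums_mult dirichlet_zeta_sums) (use s in auto)
  have "(\<lambda>n. (of_nat (Suc (Suc n)) powr (1 - s) - of_nat (Suc n) powr (1 - s)) -
               (\<Sum>k\<le>K. ?b (Suc k) * of_nat (Suc n) powr (- (s + of_nat k))))
          sums ((0 - 1) - (\<Sum>k\<le>K. ?b (Suc k) * ?Z (s + of_nat k)))"
    by (intro sums_diff tel sums_sum sms)
  moreover have "(of_nat (Suc (Suc n)) powr (1 - s) - of_nat (Suc n) powr (1 - s)) -
               (\<Sum>k\<le>K. ?b (Suc k) * of_nat (Suc n) powr (- (s + of_nat k))) = dterm (Suc K) n s" for n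
    unfolding dterm_def by (subst sum.atMost_Suc_shift) (simp add: algebra_simps)
  ultimately have "(\<Sum>n. dterm (Suc K) n s) = -1 - (\<Sum>k\<le>K. ?b (Suc k) * ?Z (s + of_nat k))"
    by (simp add: sums_iff)
  also have "(\<Sum>k\<le>K. ?b (Suc k) * ?Z (s + of_nat k)) =
      (1 - s) * ?Z s + (\<Sum>k\<in>{1..<Suc K}. ?b (Suc k) * ?Z (s + of_nat k))"
  proof -
    have "{..K} = insert 0 {1..<Suc K}" by auto
    then show ?thesis by simp
  qed
  also have "(\<Sum>k\<in>{1..<Suc K}. ?b (Suc k) * ?Z (s + of_nat k)) =
      - (\<Sum>k\<in>{1..<Suc K}. ?b k / of_nat (Suc k) * ((s + of_nat k - 1) * ?Z (s + of_nat k)))"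
    unfolding sum_negf [symmetric]
    by (intro sum.cong refl) (simp add: gchoose_rec divide_simps, simp add: algebra_simps)
  finally show ?thesis by (simp add: algebra_simps)
qed

lemma zeta_halfplane:
  "\<exists>F. F holomorphic_on {s. Re s > 1 - real m} \<and> (\<forall>s. Re s > 1 \<longrightarrow> F s = (s - 1) * dirichlet_zeta s)"
proof (induction m)
  case 0
  have eq: "(s - 1) * dirichlet_zeta s = 1 + (\<Sum>n. dterm (Suc 0) n s)" if "Re s > 1" for s
    using dirichlet_zeta_recursion[OF that, of 0] by simp
  have "(\<lambda>s. 1 + (\<Sum>n. dterm (Suc 0) n s)) holomorphic_on {s. Re s > 1 - real 0}"
    by (intro holomorphic_intros holomorphic_on_subset[OF dterm_suminf_holomorphic]) auto
  then show ?case using eq by metis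
next
  case (Suc m)
  then obtain F where F: "F holomorphic_on {s. Re s > 1 - real m}"
    "\<And>s. Re s > 1 \<Longrightarrow> F s = (s - 1) * dirichlet_zeta s" by blast
  define G where "G = (\<lambda>s. 1 - (\<Sum>k\<in>{1..<Suc m}. ((1 - s) gchoose k) / of_nat (Suc k) * F (s + of_nat k))
       + (\<Sum>n. dterm (Suc m) n s))"
  have "(F \<circ> (\<lambda>s. s + of_nat k)) holomorphic_on {s. Re s > 1 - real (Suc m)}" if "k \<ge> 1" for k
    by (rule holomorphic_on_compose_gen[OF _ F(1)]) (use that in \<open>auto intro!: holomorphic_intros\<close>)
  then have "G holomorphic_on {s. Re s > 1 - real (Suc m)}"
    unfolding G_def gbinomial_prod_rev
    by (intro holomorphic_intros dterm_suminf_holomorphic) (auto simp: o_def)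
  moreover have "G s = (s - 1) * dirichlet_zeta s" if "Re s > 1" for s
    using that by (simp add: G_def dirichlet_zeta_recursion[OF that, of m] F(2))
  ultimately show ?case by blast
qed

lemma is_zeta_exists: "\<exists>f. is_zeta f"
proof -
  define H where "H = (\<lambda>m. {s. Re s > 1 - real m})"
  obtain G where G: "\<And>m. G m holomorphic_on H m"
    "\<And>m s. Re s > 1 \<Longrightarrow> G m s = (s - 1) * dirichlet_zeta s"
    using zeta_halfplane unfolding H_def by metis
  have agree: "G m s = G m' s" if "s \<in> H m" "m \<le> m'" for m m' s
  proof (rule analytic_continuation_open[of "{s. Re s > 1}" "H m" "G m" "G m'"])
    show "{s. Re s > 1} \<noteq> {}" by (auto intro!: exI[of _ 2])
    show "connected (H m)"
      unfolding H_def by (intro convex_connected convex_halfspace_Re_gt)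
    show "G m' holomorphic_on H m"
      by (rule holomorphic_on_subset[OF G(1)]) (use that in \<open>auto simp: H_def\<close>)
  qed (use that G in \<open>auto simp: H_def open_halfspace_Re_gt\<close>)
  define m where "m = (\<lambda>s. nat \<lceil>2 - Re s\<rceil>)"
  have m: "s \<in> H (m s)" for s
    unfolding H_def m_def by (simp, linarith)
  define F where "F = (\<lambda>s. G (m s) s)"
  have F: "F s = G k s" if "s \<in> H k" for k s
    unfolding F_def using agree[of s k "m s"] agree[of s "m s" k] that m
    by (metis nle_le)
  have "F holomorphic_on (\<Union>k. H k)"
  proof (rule holomorphic_on_UN_open)
    show "F holomorphic_on H k" for k
      using G(1) by (rule holomorphic_transform) (simp add: F)
  qed (simp add: H_def open_halfspace_Re_gt)
  then have hol: "F holomorphic_on S" for S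
    by (rule holomorphic_on_subset) (use m in blast)
  have "is_zeta (\<lambda>s. if s = 1 then 0 else F s / (s - 1))"
    unfolding is_zeta_def
  proof (intro conjI allI impI)
    have "(\<lambda>s. F s / (s - 1)) holomorphic_on - {1}"
      by (intro holomorphic_intros hol) auto
    then show "(\<lambda>s. if s = 1 then 0 else F s / (s - 1)) holomorphic_on - {1}"
      by (rule holomorphic_transform) auto
  next
    fix s :: complex assume s: "Re s > 1"
    then have "s \<noteq> 1" by auto
    then show "(if s = 1 then 0 else F s / (s - 1)) = (\<Sum>n. 1 / of_nat (Suc n) powr s)"
      using s G(2)[of s "m s"] by (simp add: F_def dirichlet_zeta_def)
  qed simp
  then show ?thesis by blast
qed

theorem is_zeta_riemann_zeta: "is_zeta riemann_zeta"
  unfolding riemann_zeta_def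
  using is_zeta_exists is_zeta_unique by (metis theI)

definition riemann_hypothesis :: bool where
  "riemann_hypothesis \<longleftrightarrow>
     (\<forall>s. riemann_zeta s = 0 \<and> 0 < Re s \<and> Re s < 1 \<longrightarrow> Re s = 1 / 2)"

definition sigma_A :: "real \<Rightarrow> real \<Rightarrow> real" where
  "sigma_A A T = 1 - A / ln (ln T)"

text \<open>
  Under the Riemann hypothesis the zeta function has no zero on the range of \<open>t\<close> below once \<open>T\<close>
  is large, because then \<open>sigma_A A T > 1 / 2\<close>; the convention \<open>y / 0 = 0\<close> plays no role.
\<close>

definition large_set :: "real \<Rightarrow> real \<Rightarrow> real \<Rightarrow> real \<Rightarrow> real set" where
  "large_set \<beta> A T x = {t \<in> {T powr \<beta> .. T}.
     - Re (deriv riemann_zeta (Complex (sigma_A A T) t) / riemann_zeta (Complex (sigma_A A T) t))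
       \<ge> ln (ln T) / ln (ln (ln T)) * ((exp A - 1) / A * ln (ln (ln T)) - x)}"

end

theory Submission
  imports Defs "HOL-Number_Theory.Prime_Powers" "HOL-Probability.Characteristic_Functions"
    "HOL-Real_Asymp.Real_Asymp"
begin

text \<open>
  The proof uses the resonance method. Let \<open>D\<close> be the set of divisors of
  \<open>Q = (\<Prod>p\<le>Y. p ^ E)\<close> with \<open>Y\<close> about \<open>log T / (log log T) ^ 3\<close> and \<open>E\<close> about \<open>log log T\<close>, so that
  \<open>Q = T powr o(1)\<close>, and weight the line \<open>Re s = \<sigma>\<close>, where \<open>\<sigma>\<close> is the paper's \<open>\<sigma>_A\<close>, by
  \<open>\<bar>\<Sum>m\<in>D. m powr (\<i> * t)\<bar>\<^sup>2\<close> times a Gaussian of width \<open>T / log T\<close>. To average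
  \<open>- \<zeta>'/\<zeta>(s) - 1 / (s - 1)\<close>, which has no pole to the right of \<open>1 / 2\<close> under the Riemann
  hypothesis, move the line to \<open>Re s = 2\<close> and expand \<open>- \<zeta>'/\<zeta>\<close> there. All resulting terms are
  nonnegative, and the primes \<open>p \<le> Y\<close> alone contribute at least the fraction \<open>E / (E + 1)\<close> of
  \<open>\<Sum>p\<le>Y. log p * p powr (- \<sigma>)\<close>. By Mertens' theorem this sum falls short of
  \<open>(e^A - 1) / A * log log T\<close> by only \<open>O(log log log T)\<close>, much less than the allowed
  \<open>x * log log T / log log log T\<close>. As \<open>\<zeta>'/\<zeta>\<close> is \<open>O(log T)\<close> on the line and the resonator is at
  most \<open>T powr o(1)\<close>, the large values occupy a set of measure \<open>T powr (1 - o(1))\<close>, which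
  exceeds the claimed bound; the theorem then holds even with \<open>\<epsilon> = 0\<close>.
\<close>

section \<open>Two lemmas on logarithmic derivatives\<close>

text \<open>Write \<open>u\<close> for \<open>ln (ln T)\<close>. Two demands fix the size of
  \<open>Y\<close>. As \<open>ln Q\<close> is at most \<open>E * Y * ln Y\<close>, with
  \<open>E\<close> and \<open>ln Y\<close> about \<open>u\<close>, dividing by \<open>u ^ 3\<close>
  leaves \<open>ln Q\<close> of order \<open>ln T / u\<close>. On the other hand
  \<open>Y powr (A / u)\<close> is still \<open>exp A * (1 - O(ln u / u))\<close>, and since the
  prime sum is about \<open>u / A * (Y powr (A / u) - 1)\<close>, this costs only a multiple of
  \<open>ln u\<close>. With \<open>E\<close> about \<open>u\<close> the fraction
  \<open>E / (E + 1)\<close> costs a bounded amount more. The Gaussian must die before height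
  \<open>T\<close>, yet be much wider than \<open>Q\<close>, so that the logarithms of distinct
  divisors, at least \<open>1 / Q\<close> apart, do not interact. Width \<open>T / ln T\<close>
  makes its mass beyond \<open>T\<close> smaller than every power of \<open>T\<close>. The two
  estimates of the moment differ by a surplus proportional to \<open>card D\<close>, while trivial
  bounds cost \<open>card D\<close> squared; as \<open>card D \<le> Q\<close>, the quotient loses
  only a small power of \<open>T\<close>. The weight covers the whole line: negative heights are
  reflected by conjugation, and heights below \<open>T powr \<beta>\<close> form too short an
  interval to matter.\<close>

lemma borel_caratheodory_log_deriv:
  fixes f :: "complex \<Rightarrow> complex"
  assumes hol: "f holomorphic_on ball c R" and nz: "\<And>z. z \<in> ball c R \<Longrightarrow> f z \<noteq> 0"
    and bound: "\<And>z. z \<in> ball c R \<Longrightarrow> ln (norm (f z) / norm (f c)) < M"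
    and r: "0 < r" "r < R" and z: "norm (z - c) \<le> r"
  shows "norm (deriv f z / f z) \<le> 4 * M * (R + r) / (R - r) ^ 2"
proof -
  have c: "c \<in> ball c R" using r by simp
  \<comment> \<open>At the centre the quotient is 1, so the strict bound forces \<open>M\<close> to
    be positive.\<close>
  have M: "M > 0" using bound[OF c] nz[OF c] by simp
  obtain h0 where h0: "h0 holomorphic_on ball c R" "\<And>w. w \<in> ball c R \<Longrightarrow> exp (h0 w) = f w"
    using holomorphic_logarithm_exists[OF convex_ball open_ball hol nz c] by metis
  define h where "h = (\<lambda>w. h0 w - h0 c)"
  have h: "h holomorphic_on ball c R" unfolding h_def by (intro holomorphic_intros h0)
  have eh: "exp (h w) = f w / f c" if "w \<in> ball c R" for w
    using h0(2)[OF that] h0(2)[OF c] by (simp add: h_def exp_diff)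
  have Reh: "Re (h w) < M" if "w \<in> ball c R" for w
  proof -
    have "exp (Re (h w)) = norm (f w) / norm (f c)"
      using eh[OF that] by (metis norm_divide norm_exp_eq_Re)
    then have "Re (h w) = ln (norm (f w) / norm (f c))" by (metis ln_exp)
    then show ?thesis using bound[OF that] by simp
  qed
  have hM: "norm (h w) < norm (2 * of_real M - h w)" if "w \<in> ball c R" for w
  proof -
    have "(Re (h w))\<^sup>2 < (2 * M - Re (h w))\<^sup>2"
      using Reh[OF that] M by (simp add: power2_eq_square algebra_simps)
    then show ?thesis by (auto simp: cmod_def)
  qed
  have small: "norm (h w) \<le> 2 * M * norm (w - c) / (R - norm (w - c))" if w: "w \<in> ball c R" for w
  proof -
    \<comment> \<open>The map \<open>w / (2 * M - w)\<close> takes the half plane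
      \<open>Re w < M\<close> into the unit disc and fixes 0, so the Schwarz lemma turns a bound on
      the real part of the logarithm into one on its modulus.\<close>
    define \<phi> where "\<phi> = (\<lambda>u. h (c + of_real R * u) / (2 * of_real M - h (c + of_real R * u)))"
    have inb: "c + of_real R * u \<in> ball c R" if "norm u < 1" for u
      using that r by (simp add: dist_norm norm_mult)
    have nz2: "2 * of_real M - h (c + of_real R * u) \<noteq> 0" if "norm u < 1" for u
      using hM[OF inb[OF that]] by (metis norm_ge_zero norm_zero not_less)
    have "(h \<circ> (\<lambda>u. c + of_real R * u)) holomorphic_on ball 0 1"
      by (rule holomorphic_on_compose_gen[OF _ h]) (use inb in \<open>auto intro!: holomorphic_intros\<close>)
    then have hol\<phi>: "\<phi> holomorphic_on ball 0 1"
      unfolding \<phi>_def using nz2 by (intro holomorphic_intros) (auto simp: o_def)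
    have \<phi>1: "norm (\<phi> u) < 1" if "norm u < 1" for u
      using hM[OF inb[OF that]] nz2[OF that] by (simp add: \<phi>_def norm_divide)
    have \<phi>0: "\<phi> 0 = 0" by (simp add: \<phi>_def h_def)
    define u where "u = (w - c) / of_real R"
    have u: "norm u < 1" "c + of_real R * u = w" "norm u = norm (w - c) / R"
      using w r by (auto simp: u_def norm_divide dist_norm norm_minus_commute)
    have "norm (\<phi> u) \<le> norm u" by (rule Schwarz_Lemma(1)[OF hol\<phi> \<phi>0 \<phi>1 u(1)])
    then have "norm (h w) \<le> norm u * norm (2 * of_real M - h w)"
      using nz2[OF u(1)] by (simp add: \<phi>_def u(2) norm_divide divide_le_eq)
    also have "\<dots> \<le> norm u * (2 * M + norm (h w))"
      using norm_triangle_ineq4[of "2 * of_real M" "h w"] M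
      by (intro mult_left_mono) (auto simp: norm_mult)
    finally have "norm (h w) * R \<le> norm (w - c) * (2 * M + norm (h w))"
      unfolding u(3) using r by (simp add: field_simps)
    then have "norm (h w) * (R - norm (w - c)) \<le> 2 * M * norm (w - c)"
      by (simp add: algebra_simps)
    then show ?thesis using w by (simp add: pos_le_divide_eq dist_norm norm_minus_commute)
  qed
  \<comment> \<open>A circle of this radius about \<open>z\<close> stays within
    \<open>(R + r) / 2\<close> of \<open>c\<close>, half way between the two radii; Cauchy's
    inequality there bounds \<open>deriv h\<close>, which is the logarithmic derivative of
    \<open>f\<close>.\<close>
  define \<rho> where "\<rho> = (R - r) / 2"
  have \<rho>: "\<rho> > 0" "r + \<rho> < R" using r by (auto simp: \<rho>_def field_simps)
  have sub: "cball z \<rho> \<subseteq> ball c R"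
  proof
    fix w assume "w \<in> cball z \<rho>"
    then have "norm (w - c) \<le> \<rho> + r"
      using z norm_triangle_ineq[of "w - z" "z - c"] by (simp add: dist_norm norm_minus_commute)
    then show "w \<in> ball c R" using \<rho> by (simp add: dist_norm norm_minus_commute)
  qed
  have "norm ((deriv ^^ 1) h z) \<le> fact 1 * (2 * M * (R + r) / (R - r)) / \<rho> ^ 1"
  proof (rule Cauchy_inequality)
    show "h holomorphic_on ball z \<rho>" using h sub by (meson ball_subset_cball holomorphic_on_subset)
    show "continuous_on (cball z \<rho>) h"
      using h sub by (meson holomorphic_on_imp_continuous_on holomorphic_on_subset)
    fix w assume w: "norm (z - w) = \<rho>"
    have wc: "norm (w - c) \<le> (R + r) / 2"
      using z w norm_triangle_ineq[of "w - z" "z - c"]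
      by (simp add: \<rho>_def norm_minus_commute field_simps)
    have "norm (h w) \<le> 2 * M * norm (w - c) / (R - norm (w - c))"
      using w sub by (intro small) (auto simp: dist_norm)
    also have "\<dots> \<le> 2 * M * ((R + r) / 2) / (R - (R + r) / 2)"
      using wc M r by (intro frac_le mult_left_mono mult_nonneg_nonneg) (auto simp: field_simps)
    also have "\<dots> = 2 * M * (R + r) / (R - r)"
    proof -
      have eq: "R - (R + r) / 2 = (R - r) / 2" by (simp add: field_simps)
      show ?thesis unfolding eq by simp
    qed
    finally show "norm (h w) \<le> 2 * M * (R + r) / (R - r)" .
  qed (use \<rho> in auto)
  also have "\<dots> = 4 * M * (R + r) / (R - r) ^ 2"
    by (simp add: \<rho>_def power2_eq_square)
  also have "(deriv ^^ 1) h z = deriv f z / f z"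
  proof -
    have zin: "z \<in> ball c R" by (rule subsetD[OF sub]) (use \<rho> in simp)
    have dh: "(h has_field_derivative deriv h z) (at z)"
      by (rule holomorphic_derivI[OF h open_ball zin])
    have "((\<lambda>w. f c * exp (h w)) has_field_derivative f c * (exp (h z) * deriv h z)) (at z)"
      by (rule derivative_eq_intros dh refl)+ simp
    then have "(f has_field_derivative f c * (exp (h z) * deriv h z)) (at z)"
      by (rule has_field_derivative_transform_within_open[OF _ open_ball zin])
         (use eh nz[OF c] in auto)
    then have "deriv f z = f z * deriv h z"
      using eh[OF zin] nz[OF c] by (simp add: DERIV_imp_deriv)
    then show ?thesis using nz[OF zin] by simp
  qed
  finally show ?thesis .
qed

text \<open>Factoring out \<open>(w - z0) ^ m\<close> leaves a nonvanishing \<open>g\<close> with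
  \<open>\<sigma> * f'/f = m + \<sigma> * g'/g\<close>, whose last term disappears in the limit. The
  order \<open>m\<close> may be 0; the point \<open>w\<close> excludes the zero function, which has
  no finite order. The 3-4-1 argument on the line \<open>Re s = 1\<close> reads off these
  limits.\<close>

lemma log_deriv_order_limit:
  fixes f :: "complex \<Rightarrow> complex"
  assumes hol: "f holomorphic_on S" and S: "open S" "connected S" "z0 \<in> S"
    and nt: "w \<in> S" "f w \<noteq> 0"
  obtains m :: nat where "f z0 = 0 \<Longrightarrow> m \<ge> 1"
    "((\<lambda>\<sigma>. of_real \<sigma> * deriv f (z0 + of_real \<sigma>) / f (z0 + of_real \<sigma>)) \<longlongrightarrow> of_nat m) (at_right (0::real))"
proof -
  obtain g r m where g: "r > 0" "ball z0 r \<subseteq> S" "g holomorphic_on ball z0 r"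
    "\<And>w. w \<in> ball z0 r \<Longrightarrow> f w = (w - z0) ^ m * g w"
    "\<And>w. w \<in> ball z0 r \<Longrightarrow> g w \<noteq> 0" "f z0 = 0 \<Longrightarrow> m \<ge> 1"
  proof (cases "f z0 = 0")
    case True
    have "\<not> f constant_on S" unfolding constant_on_def using True nt S(3) by metis
    then show ?thesis
      using holomorphic_factor_zero_nonconstant[OF hol S True] that
      by (metis One_nat_def Suc_leI)
  next
    case False
    have "continuous (at z0) f"
      using holomorphic_on_imp_continuous_on[OF hol] S continuous_on_eq_continuous_at by blast
    then obtain e where e: "e > 0" "\<And>w. dist z0 w < e \<Longrightarrow> f w \<noteq> 0"
      using continuous_at_avoid[of z0 f 0] False by blast
    obtain e' where e': "e' > 0" "ball z0 e' \<subseteq> S" using S openE by blast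
    show ?thesis
      by (rule that[of "min e e'" f 0])
         (use e e' False in \<open>auto intro!: holomorphic_on_subset[OF hol]\<close>)
  qed
  have dg: "continuous_on (ball z0 r) (deriv g)" "continuous_on (ball z0 r) g"
    using g by (auto intro!: holomorphic_on_imp_continuous_on holomorphic_deriv)
  have lim: "((\<lambda>\<sigma>. of_nat m + of_real \<sigma> * (deriv g (z0 + of_real \<sigma>) / g (z0 + of_real \<sigma>)))
      \<longlongrightarrow> of_nat m + of_real 0 * (deriv g (z0 + of_real 0) / g (z0 + of_real 0))) (at_right (0::real))"
  proof (intro tendsto_intros)
    have "isCont g (z0 + of_real 0)" "isCont (deriv g) (z0 + of_real 0)"
      using dg g(1) unfolding continuous_on_eq_continuous_at[OF open_ball] by auto
    moreover have "((\<lambda>\<sigma>. z0 + of_real \<sigma>) \<longlongrightarrow> z0 + of_real 0) (at_right (0::real))"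
      by (intro tendsto_intros)
    ultimately show "((\<lambda>\<sigma>. g (z0 + of_real \<sigma>)) \<longlongrightarrow> g (z0 + of_real 0)) (at_right (0::real))"
      "((\<lambda>\<sigma>. deriv g (z0 + of_real \<sigma>)) \<longlongrightarrow> deriv g (z0 + of_real 0)) (at_right (0::real))"
      by (auto intro: isCont_tendsto_compose)
    show "g (z0 + of_real 0) \<noteq> 0" using g by simp
  qed
  have "eventually (\<lambda>\<sigma>::real. \<sigma> > 0 \<and> \<sigma> < r) (at_right 0)"
    using g(1) eventually_at_right_real by (auto elim: eventually_mono)
  then have ev: "\<forall>\<^sub>F \<sigma> in at_right (0::real).
      of_nat m + of_real \<sigma> * (deriv g (z0 + of_real \<sigma>) / g (z0 + of_real \<sigma>)) =
      of_real \<sigma> * deriv f (z0 + of_real \<sigma>) / f (z0 + of_real \<sigma>)"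
  proof eventually_elim
    case (elim \<sigma>)
    define w where "w = z0 + of_real \<sigma>"
    have w: "w \<in> ball z0 r" "w - z0 = of_real \<sigma>" "\<sigma> \<noteq> 0" using elim by (auto simp: w_def dist_norm)
    have "(g has_field_derivative deriv g w) (at w)"
      by (rule holomorphic_derivI[OF g(3) open_ball w(1)])
    then have "((\<lambda>w. (w - z0) ^ m * g w) has_field_derivative
         (of_nat m * (w - z0) ^ (m - 1)) * g w + deriv g w * (w - z0) ^ m) (at w)"
      by (auto intro!: derivative_eq_intros)
    then have "(f has_field_derivative
         (of_nat m * (w - z0) ^ (m - 1)) * g w + deriv g w * (w - z0) ^ m) (at w)"
      by (rule has_field_derivative_transform_within_open[OF _ open_ball w(1)]) (use g in auto)
    then have "deriv f w = (of_nat m * (w - z0) ^ (m - 1)) * g w + deriv g w * (w - z0) ^ m"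
      by (rule DERIV_imp_deriv)
    then have "of_real \<sigma> * deriv f w / f w =
        (of_nat m * (of_real \<sigma> * of_real \<sigma> ^ (m - 1)) * g w + of_real \<sigma> * deriv g w * of_real \<sigma> ^ m)
          / (of_real \<sigma> ^ m * g w)"
      using g(4)[OF w(1)] w(2) by (simp add: algebra_simps)
    also have "of_nat m * (of_real \<sigma> * of_real \<sigma> ^ (m - 1)) = of_nat m * (of_real \<sigma> :: complex) ^ m"
      by (cases m) auto
    also have "(of_nat m * (of_real \<sigma> :: complex) ^ m * g w + of_real \<sigma> * deriv g w * of_real \<sigma> ^ m)
          / (of_real \<sigma> ^ m * g w) = of_nat m + of_real \<sigma> * (deriv g w / g w)"
      using w(3) g(5)[OF w(1)] by (simp add: field_simps)
    finally show ?case by (simp add: w_def)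
  qed
  show ?thesis
    by (rule that[OF g(6) Lim_transform_eventually[OF _ ev]]) (use lim in simp_all)
qed

section \<open>Dirichlet series and the von Mangoldt function\<close>

text \<open>The index starts at 0 without harm, since \<open>0 powr z = 0\<close>.\<close>

definition dseries :: "(nat \<Rightarrow> complex) \<Rightarrow> complex \<Rightarrow> complex" where
  "dseries a s = (\<Sum>n. a n * of_nat n powr (- s))"

text \<open>A growth class wide enough for the three coefficient sequences in use: 1,
  \<open>mangoldt\<close> and \<open>ln\<close>.\<close>

definition log_bounded :: "(nat \<Rightarrow> complex) \<Rightarrow> bool" where
  "log_bounded a \<longleftrightarrow> (\<forall>n\<ge>1. norm (a n) \<le> 1 + ln (real n))"

lemma norm_nat_powr': "norm (of_nat n powr s :: complex) = real n powr Re s"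
  by (cases n) (simp_all add: norm_nat_powr del: of_nat_Suc)

lemma summable_log_powr:
  assumes "\<sigma> > 1"
  shows "summable (\<lambda>n. (1 + ln (real n)) * real n powr (- \<sigma>))"
proof (rule summable_comparison_test_ev)
  \<comment> \<open>Half of the excess of \<open>\<sigma>\<close> over 1 absorbs the logarithm; the
    other half keeps the exponent below -1.\<close>
  define e where "e = (\<sigma> - 1) / 2"
  have e: "e > 0" "e - \<sigma> < -1" using assms by (auto simp: e_def field_simps)
  show "summable (\<lambda>n. (1 + 1 / e) * real n powr (e - \<sigma>))"
    using e by (intro summable_mult) (simp add: summable_real_powr_iff)
  have *: "norm ((1 + ln (real n)) * real n powr (- \<sigma>)) \<le> (1 + 1 / e) * real n powr (e - \<sigma>)"
    if "n \<ge> 1" for n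
  proof -
    have "1 + ln (real n) \<le> real n powr e + real n powr e / e"
      using ln_powr_bound[of "real n" e] e that by (intro add_mono) (auto intro: ge_one_powr_ge_zero)
    also have "\<dots> = (1 + 1 / e) * real n powr e" by (simp add: algebra_simps)
    finally have "(1 + ln (real n)) * real n powr (- \<sigma>) \<le> (1 + 1 / e) * real n powr e * real n powr (- \<sigma>)"
      by (rule mult_right_mono) auto
    then show ?thesis using that by (simp add: powr_add[symmetric] mult.assoc)
  qed
  then show "\<forall>\<^sub>F n in sequentially. norm ((1 + ln (real n)) * real n powr (- \<sigma>)) \<le> (1 + 1 / e) * real n powr (e - \<sigma>)"
    by (intro eventually_mono[OF eventually_ge_at_top[of "1::nat"]]) (rule *)
qed

lemma dseries_term_bound:
  assumes "log_bounded a" "\<sigma> \<le> Re s"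
  shows "norm (a n * of_nat n powr (- s)) \<le> (1 + ln (real n)) * real n powr (- \<sigma>)"
proof (cases "n = 0")
  case False
  then show ?thesis using assms
    by (auto simp: norm_mult norm_nat_powr' log_bounded_def intro!: mult_mono powr_mono)
qed auto

lemma dseries_abs_summable:
  assumes "log_bounded a" "Re s > 1"
  shows "summable (\<lambda>n. norm (a n * of_nat n powr (- s)))"
proof (rule summable_comparison_test'[OF summable_log_powr[OF assms(2)], where N = 0])
  show "norm (norm (a n * of_nat n powr (- s))) \<le> (1 + ln (real n)) * real n powr (- Re s)" for n
    using dseries_term_bound[OF assms(1) order_refl, of n s] by simp
qed

lemma dseries_sums:
  assumes "log_bounded a" "Re s > 1"
  shows "(\<lambda>n. a n * of_nat n powr (- s)) sums dseries a s"
  unfolding dseries_def using dseries_abs_summable[OF assms] by (rule summable_sums[OF summable_norm_cancel])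

lemma dseries_has_sum:
  assumes "log_bounded a" "Re s > 1"
  shows "((\<lambda>n. a n * of_nat n powr (- s)) has_sum dseries a s) {0<..}"
proof -
  have "((\<lambda>n. a n * of_nat n powr (- s)) has_sum dseries a s) UNIV"
    by (intro norm_summable_imp_has_sum dseries_abs_summable dseries_sums assms)
  also have "?this \<longleftrightarrow> ?thesis" by (rule has_sum_cong_neutral) auto
  finally show ?thesis .
qed

lemma dseries_has_field_derivative:
  assumes a: "log_bounded a" and s: "Re s > 1"
  shows "(\<lambda>n. - (of_real (ln (real n)) * a n * of_nat n powr (- s))) sums deriv (dseries a) s"
    and "(dseries a has_field_derivative deriv (dseries a) s) (at s)"
proof -
  \<comment> \<open>A line strictly between 1 and \<open>Re s\<close> gives an open half plane
    around \<open>s\<close> with one summable majorant.\<close>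
  define \<sigma> where "\<sigma> = (1 + Re s) / 2"
  have \<sigma>: "\<sigma> > 1" "\<sigma> < Re s" using s by (auto simp: \<sigma>_def field_simps)
  let ?S = "{s. Re s > \<sigma>}"
  have "\<exists>g g'. \<forall>x\<in>?S. (\<lambda>n. a n * of_nat n powr (- x)) sums g x \<and>
      (\<lambda>n. - (of_real (ln (real n)) * a n * of_nat n powr (- x))) sums g' x \<and> (g has_field_derivative g' x) (at x)"
  proof (rule series_and_derivative_comparison[OF _ summable_log_powr[OF \<sigma>(1)]])
    show "open ?S" by (rule open_halfspace_Re_gt)
    show "((\<lambda>s. a n * of_nat n powr (- s)) has_field_derivative
        - (of_real (ln (real n)) * a n * of_nat n powr (- x))) (at x)" for n x
    proof (cases "n = 0")
      case False
      have "((\<lambda>s. a n * exp (- s * of_real (ln (real n)))) has_field_derivative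
          - (of_real (ln (real n)) * a n * exp (- x * of_real (ln (real n))))) (at x)"
        by (auto intro!: derivative_eq_intros)
      then show ?thesis using False by (simp add: powr_def Ln_of_nat)
    qed auto
    show "\<forall>\<^sub>F n in sequentially. \<forall>x\<in>?S. norm (a n * of_nat n powr (- x)) \<le> (1 + ln (real n)) * real n powr (- \<sigma>)"
      using dseries_term_bound[OF a] by (intro always_eventually) auto
  qed blast
  then obtain g g' where g: "\<And>x. x \<in> ?S \<Longrightarrow> (\<lambda>n. a n * of_nat n powr (- x)) sums g x"
      "\<And>x. x \<in> ?S \<Longrightarrow> (\<lambda>n. - (of_real (ln (real n)) * a n * of_nat n powr (- x))) sums g' x"
      "\<And>x. x \<in> ?S \<Longrightarrow> (g has_field_derivative g' x) (at x)" by blast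
  have s': "s \<in> ?S" using \<sigma> by simp
  have "(dseries a has_field_derivative g' s) (at s)"
    by (rule has_field_derivative_transform_within_open[OF g(3)[OF s'] _ s'])
       (use g(1) in \<open>auto simp: dseries_def sums_iff open_halfspace_Re_gt\<close>)
  moreover from this have "deriv (dseries a) s = g' s" by (rule DERIV_imp_deriv)
  ultimately show "(\<lambda>n. - (of_real (ln (real n)) * a n * of_nat n powr (- s))) sums deriv (dseries a) s"
    "(dseries a has_field_derivative deriv (dseries a) s) (at s)"
    using g(2)[OF s'] by simp_all
qed

lemma log_bounded_1: "log_bounded (\<lambda>_. 1)" by (simp add: log_bounded_def)

lemma log_bounded_mangoldt: "log_bounded mangoldt"
  unfolding log_bounded_def
proof (intro allI impI)
  fix n :: nat assume "n \<ge> 1"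
  then show "norm (mangoldt n :: complex) \<le> 1 + ln (real n)"
    using mangoldt_le[of n] by simp
qed

lemma log_bounded_ln: "log_bounded (\<lambda>n. of_real (ln (real n)))"
  unfolding log_bounded_def
proof (intro allI impI)
  fix n :: nat assume "n \<ge> 1"
  then show "norm (of_real (ln (real n)) :: complex) \<le> 1 + ln (real n)"
    by simp
qed

section \<open>The zeta function to the right of 1\<close>

lemma riemann_zeta_dseries:
  assumes "Re s > 1"
  shows "riemann_zeta s = dseries (\<lambda>_. 1) s"
proof -
  have "riemann_zeta s = dirichlet_zeta s"
    using is_zeta_riemann_zeta assms by (simp add: is_zeta_def dirichlet_zeta_def)
  moreover have "(\<lambda>n. of_nat (Suc n) powr (- s)) sums (dseries (\<lambda>_. 1) s - (of_nat 0 powr (- s)))"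
    using dseries_sums[OF log_bounded_1 assms] by (subst sums_Suc_iff) simp
  ultimately show ?thesis
    using dirichlet_zeta_sums[OF assms] by (simp add: sums_iff del: of_nat_Suc)
qed

lemma nat_mult_powr: "of_nat (a * b) powr (s::complex) = of_nat a powr s * of_nat b powr s"
proof -
  have "of_nat (a * b) powr s = (of_real (real a) * of_real (real b)) powr s" by simp
  also have "\<dots> = of_real (real a) powr s * of_real (real b) powr s"
    by (rule powr_times_real) auto
  finally show ?thesis by simp
qed

text \<open>The Dirichlet convolution of \<open>mangoldt\<close> and 1 is \<open>ln\<close>.
  Absolute summability over pairs allows grouping them by their product.\<close>

lemma dseries_mangoldt_times_zeta:
  assumes s: "Re s > 1"
  shows "dseries mangoldt s * dseries (\<lambda>_. 1) s = dseries (\<lambda>n. of_real (ln (real n))) s"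
proof -
  let ?f = "\<lambda>n. mangoldt n * of_nat n powr (- s) :: complex" and ?g = "\<lambda>n. of_nat n powr (- s) :: complex"
  note F = dseries_has_sum[OF log_bounded_mangoldt s]
  have G: "(?g has_sum dseries (\<lambda>_. 1) s) {0<..}" using dseries_has_sum[OF log_bounded_1 s] by simp
  have absF: "(\<lambda>n. norm (?f n)) summable_on {0<..}"
    using dseries_abs_summable[OF log_bounded_mangoldt s]
    by (intro summable_on_subset_banach[OF summable_nonneg_imp_summable_on]) auto
  have absG: "(\<lambda>n. norm (?g n)) summable_on {0<..}"
    using dseries_abs_summable[OF log_bounded_1 s]
    by (intro summable_on_subset_banach[OF summable_nonneg_imp_summable_on]) auto
  have "(\<lambda>x. norm (case x of (a, b) \<Rightarrow> ?f a * ?g b)) summable_on {0<..} \<times> {0<..}"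
    unfolding Infinite_Sum.abs_summable_on_Sigma_iff
  proof (intro conjI ballI)
    show "(\<lambda>b. norm (case (a, b) of (a, b) \<Rightarrow> ?f a * ?g b)) summable_on {0<..}" for a
      using summable_on_cmult_right[OF absG, of "norm (?f a)"] by (simp add: norm_mult)
    have "(\<lambda>a. norm (?f a) * infsum (\<lambda>b. norm (?g b)) {0<..}) summable_on {0<..}"
      by (rule summable_on_cmult_left[OF absF])
    then show "(\<lambda>a. norm (infsum (\<lambda>b. norm (case (a, b) of (a, b) \<Rightarrow> ?f a * ?g b)) {0<..})) summable_on {0<..}"
      by (simp add: norm_mult infsum_cmult_right' infsum_nonneg abs_mult)
  qed
  then have sm: "(\<lambda>(a, b). ?f a * ?g b) summable_on {0<..} \<times> {0<..}"
    by (rule Infinite_Sum.abs_summable_summable)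
  have prod: "((\<lambda>(a, b). ?f a * ?g b) has_sum (dseries mangoldt s * dseries (\<lambda>_. 1) s)) ({0<..} \<times> {0<..})"
  proof (rule has_sum_SigmaI[OF _ _ sm])
    show "((\<lambda>b. case (a, b) of (a, b) \<Rightarrow> ?f a * ?g b) has_sum (?f a * dseries (\<lambda>_. 1) s)) {0<..}" for a
      using has_sum_cmult_right[OF G, of "?f a"] by simp
    show "((\<lambda>a. ?f a * dseries (\<lambda>_. 1) s) has_sum dseries mangoldt s * dseries (\<lambda>_. 1) s) {0<..}"
      by (rule has_sum_cmult_left[OF F])
  qed
  \<comment> \<open>The pair \<open>(a, b)\<close> is recorded as \<open>(n, a)\<close> with
    \<open>n = a * b\<close>, so that the inner sum runs over the divisors of
    \<open>n\<close>.\<close>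
  have "((\<lambda>(n, a). mangoldt a * of_nat n powr (- s)) has_sum (dseries mangoldt s * dseries (\<lambda>_. 1) s))
      (SIGMA n:{0<..}. {a. a dvd n})"
  proof (subst has_sum_reindex_bij_witness[where S = "SIGMA n:{0<..}. {a. a dvd n}" and T = "{0<..} \<times> {0<..}"
        and j = "\<lambda>(n, a). (a, n div a)" and i = "\<lambda>(a, b). (a * b, a)" and h = "\<lambda>(a, b). ?f a * ?g b"])
    show "((\<lambda>(a, b). ?f a * ?g b) has_sum (dseries mangoldt s * dseries (\<lambda>_. 1) s)) ({0<..} \<times> {0<..})"
      by (rule prod)
  next
    fix x assume "x \<in> (SIGMA n:{0<..}. {a::nat. a dvd n})"
    then obtain a b where "x = (a * b, a)" "a > 0" "b > 0" by (auto elim!: dvdE)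
    then show "(case case x of (n, a) \<Rightarrow> (a, n div a) of (a, b) \<Rightarrow> ?f a * ?g b) =
        (case x of (n, a) \<Rightarrow> mangoldt a * of_nat n powr (- s))"
      using nat_mult_powr[of a b "- s"] by simp
  qed (auto simp: dvd_pos_nat elim!: dvdE)
  then have "((\<lambda>n. of_real (ln (real n)) * of_nat n powr (- s)) has_sum (dseries mangoldt s * dseries (\<lambda>_. 1) s)) {0<..}"
  proof (rule has_sum_SigmaD)
    fix n :: nat assume n: "n \<in> {0<..}"
    have "((\<lambda>a. mangoldt a * of_nat n powr (- s)) has_sum (\<Sum>a | a dvd n. mangoldt a * of_nat n powr (- s))) {a. a dvd n}"
      using n by (intro has_sum_finite) auto
    also have "(\<Sum>a | a dvd n. mangoldt a * of_nat n powr (- s)) = of_real (ln (real n)) * (of_nat n powr (- s) :: complex)"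
      using n by (simp add: sum_distrib_right[symmetric] mangoldt_sum)
    finally show "((\<lambda>a. case (n, a) of (n, a) \<Rightarrow> mangoldt a * of_nat n powr (- s)) has_sum
        of_real (ln (real n)) * (of_nat n powr (- s) :: complex)) {a. a dvd n}" by simp
  qed
  then show ?thesis
    using dseries_has_sum[OF log_bounded_ln s] has_sum_unique by blast
qed

text \<open>Kept as a product because zeros are not excluded yet; this linear differential equation
  is what excludes them below.\<close>

lemma deriv_zeta_eq:
  assumes s: "Re s > 1"
  shows "(riemann_zeta has_field_derivative - (dseries mangoldt s * riemann_zeta s)) (at s)"
proof -
  have "(\<lambda>n. - (of_real (ln (real n)) * 1 * of_nat n powr (- s))) sums deriv (dseries (\<lambda>_. 1)) s"
    by (rule dseries_has_field_derivative(1)[OF log_bounded_1 s])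
  moreover have "(\<lambda>n. - (of_real (ln (real n)) * 1 * of_nat n powr (- s))) sums
      - dseries (\<lambda>n. of_real (ln (real n))) s"
    using sums_minus[OF dseries_sums[OF log_bounded_ln s]] by simp
  ultimately have eq: "deriv (dseries (\<lambda>_. 1)) s = - (dseries mangoldt s * dseries (\<lambda>_. 1) s)"
    using dseries_mangoldt_times_zeta[OF s] sums_unique2 by metis
  have "(dseries (\<lambda>_. 1) has_field_derivative - (dseries mangoldt s * dseries (\<lambda>_. 1) s)) (at s)"
    using dseries_has_field_derivative(2)[OF log_bounded_1 s] eq by simp
  then have "(riemann_zeta has_field_derivative - (dseries mangoldt s * dseries (\<lambda>_. 1) s)) (at s)"
    by (rule has_field_derivative_transform_within_open[where S = "{s. Re s > 1}"])
       (use s riemann_zeta_dseries in \<open>auto simp: open_halfspace_Re_gt\<close>)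
  then show ?thesis using riemann_zeta_dseries[OF s] by simp
qed

text \<open>The terms after the first have total modulus at most \<open>pi\<^sup>2 / 6 - 1\<close>,
  which is at most 2/3. The bound starts the nonvanishing argument below and is the lower bound at
  the centre in the Borel-Caratheodory estimate.\<close>

lemma norm_zeta_2_ge:
  assumes s: "Re s = 2"
  shows "norm (riemann_zeta s) \<ge> 1 / 4"
proof -
  have zsum: "(\<lambda>n. of_nat (Suc n) powr (- s)) sums riemann_zeta s"
    using dirichlet_zeta_sums[of s] s is_zeta_riemann_zeta by (simp add: is_zeta_def dirichlet_zeta_def)
  have "(\<lambda>n. of_nat (Suc (Suc n)) powr (- s)) sums (riemann_zeta s - of_nat (Suc 0) powr (- s))"
    by (subst sums_Suc_iff) (use zsum in simp)
  then have tail: "(\<lambda>n. of_nat (Suc (Suc n)) powr (- s)) sums (riemann_zeta s - 1)" by simp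
  have sq: "(\<lambda>n. 1 / (real (Suc n) + 1)\<^sup>2) sums (pi\<^sup>2 / 6 - 1)"
    using inverse_squares_sums by (subst sums_Suc_iff) (simp add: add.commute)
  have nrm: "norm (of_nat (Suc (Suc n)) powr (- s) :: complex) = 1 / (real (Suc n) + 1)\<^sup>2" for n
    using s by (subst norm_nat_powr) (auto simp: powr_minus powr_numeral divide_inverse add.commute)
  have "norm (riemann_zeta s - 1) \<le> pi\<^sup>2 / 6 - 1"
    using norm_suminf_le[of "\<lambda>n. of_nat (Suc (Suc n)) powr (- s) :: complex" "\<lambda>n. 1 / (real (Suc n) + 1)\<^sup>2"]
      nrm sq tail unfolding sums_iff by (simp del: of_nat_Suc)
  moreover have "pi\<^sup>2 \<le> 10"
  proof -
    have "pi \<le> 3.15" using pi_approx by simp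
    then have "pi\<^sup>2 \<le> 3.15\<^sup>2" by (intro power_mono) auto
    then show ?thesis by (simp add: power2_eq_square)
  qed
  moreover have "norm (riemann_zeta s) \<ge> 1 - norm (riemann_zeta s - 1)"
    using norm_triangle_ineq2[of 1 "1 - riemann_zeta s"] by (simp add: norm_minus_commute)
  ultimately show ?thesis by linarith
qed

text \<open>If \<open>P\<close> is a primitive of the von Mangoldt series, \<open>exp P\<close> is
  an integrating factor: \<open>\<zeta> * exp P\<close> is constant on the half plane and nonzero at
  2.\<close>

lemma zeta_nonzero_gt_1:
  assumes s: "Re s > 1"
  shows "riemann_zeta s \<noteq> 0"
proof -
  let ?S = "{s. Re s > 1}"
  have S: "open ?S" "convex ?S" by (auto simp: open_halfspace_Re_gt convex_halfspace_Re_gt)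
  have "dseries mangoldt holomorphic_on ?S"
    using dseries_has_field_derivative(2)[OF log_bounded_mangoldt] S
    by (auto simp: holomorphic_on_open)
  then obtain P where "\<And>x. x \<in> ?S \<Longrightarrow> (P has_field_derivative dseries mangoldt x) (at x within ?S)"
    using holomorphic_convex_primitive'[OF S(2,1)] by blast
  then have P: "(P has_field_derivative dseries mangoldt x) (at x)" if "x \<in> ?S" for x
    using that at_within_open[OF that S(1)] by metis
  have const: "((\<lambda>z. riemann_zeta z * exp (P z)) has_field_derivative 0) (at x within ?S)" if "x \<in> ?S" for x
  proof -
    have "((\<lambda>z. riemann_zeta z * exp (P z)) has_field_derivative
       riemann_zeta x * (exp (P x) * dseries mangoldt x) + - (dseries mangoldt x * riemann_zeta x) * exp (P x)) (at x)"
      using deriv_zeta_eq[of x] P[OF that] that by (auto intro!: derivative_eq_intros)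
    then show ?thesis by (simp add: algebra_simps has_field_derivative_at_within)
  qed
  then obtain c where c: "\<And>x. x \<in> ?S \<Longrightarrow> riemann_zeta x * exp (P x) = c"
    using has_field_derivative_zero_constant[OF S(2) const] by metis
  have "riemann_zeta 2 \<noteq> 0" using norm_zeta_2_ge[of 2] by auto
  then show ?thesis using c[of 2] c[of s] s by auto
qed

lemma dseries_mangoldt_eq:
  assumes "Re s > 1"
  shows "dseries mangoldt s = - (deriv riemann_zeta s / riemann_zeta s)"
  using DERIV_imp_deriv[OF deriv_zeta_eq[OF assms]] zeta_nonzero_gt_1[OF assms] by simp

text \<open>Termwise this is \<open>3 + 4 * cos \<theta> + cos (2 * \<theta>) = 2 * (1 + cos
  \<theta>)\<^sup>2\<close>.\<close>

lemma mangoldt_341: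
  assumes \<sigma>: "\<sigma> > 1"
  shows "Re (3 * dseries mangoldt (of_real \<sigma>) + 4 * dseries mangoldt (Complex \<sigma> t)
     + dseries mangoldt (Complex \<sigma> (2 * t))) \<ge> 0"
proof -
  let ?h = "\<lambda>n. 3 * (mangoldt n * of_nat n powr (- of_real \<sigma>)) + 4 * (mangoldt n * of_nat n powr (- Complex \<sigma> t))
     + mangoldt n * of_nat n powr (- Complex \<sigma> (2 * t)) :: complex"
  have sm: "?h sums (3 * dseries mangoldt (of_real \<sigma>) + 4 * dseries mangoldt (Complex \<sigma> t)
     + dseries mangoldt (Complex \<sigma> (2 * t)))"
    using \<sigma> by (intro sums_add sums_mult dseries_sums log_bounded_mangoldt) auto
  have nonneg: "Re (?h n) \<ge> 0" for n
  proof (cases "n = 0")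
    case False
    define \<theta> where "\<theta> = t * ln (real n)"
    have tm: "Re (mangoldt n * of_nat n powr (- Complex \<sigma> u)) = mangoldt n * real n powr (- \<sigma>) * cos (u * ln (real n))" for u
    proof -
      have "Re (mangoldt n * of_nat n powr (- Complex \<sigma> u)) = mangoldt n * Re (of_nat n powr (- Complex \<sigma> u))"
        by simp
      also have "Re (of_nat n powr (- Complex \<sigma> u)) = real n powr (- \<sigma>) * cos (u * ln (real n))"
        using False by (simp add: powr_def Re_exp Ln_of_nat mult_ac)
      finally show ?thesis by simp
    qed
    have "Re (?h n) = 3 * Re (mangoldt n * of_nat n powr (- Complex \<sigma> 0))
        + 4 * Re (mangoldt n * of_nat n powr (- Complex \<sigma> t))
        + Re (mangoldt n * of_nat n powr (- Complex \<sigma> (2 * t)))"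
      by (simp add: complex_of_real_def)
    also have "\<dots> = mangoldt n * real n powr (- \<sigma>) * (3 + 4 * cos \<theta> + cos (2 * \<theta>))"
      unfolding tm \<theta>_def by (simp add: algebra_simps)
    also have "3 + 4 * cos \<theta> + cos (2 * \<theta>) = 2 * (1 + cos \<theta>)\<^sup>2"
      unfolding cos_double_cos by (simp add: power2_eq_square algebra_simps)
    finally show ?thesis by (simp add: mangoldt_nonneg)
  qed auto
  show ?thesis
    using sums_le[OF nonneg sums_zero sums_Re[OF sm]] by simp
qed

section \<open>The zeta function under the Riemann hypothesis\<close>

text \<open>This is \<open>(s - 1) * \<zeta>(s)\<close> on \<open>Re s > 0\<close>, by the
  telescoping recursion without shifted values. The series makes the value 1 at the former pole and
  the growth in \<open>Im s\<close> directly visible.\<close>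

definition reg_zeta :: "complex \<Rightarrow> complex" where
  "reg_zeta s = 1 + (\<Sum>n. dterm (Suc 0) n s)"

definition reg_log_deriv :: "complex \<Rightarrow> complex" where
  "reg_log_deriv s = - (deriv reg_zeta s / reg_zeta s)"

lemma reg_zeta_holomorphic: "reg_zeta holomorphic_on {s. Re s > 0}"
proof -
  have "(\<lambda>s. 1 + (\<Sum>n. dterm (Suc 0) n s)) holomorphic_on {s. Re s > 0}"
    using dterm_suminf_holomorphic[of "Suc 0"] by (intro holomorphic_intros) simp
  then show ?thesis by (simp add: reg_zeta_def[abs_def])
qed

lemma reg_zeta_eq:
  assumes "Re s > 0" "s \<noteq> 1"
  shows "reg_zeta s = (s - 1) * riemann_zeta s"
proof -
  let ?U = "{s. Re s > 0} - {1}"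
  have "reg_zeta s - (s - 1) * riemann_zeta s = 0"
  proof (rule analytic_continuation_open[of "{s. Re s > 1}" ?U "\<lambda>s. reg_zeta s - (s - 1) * riemann_zeta s" "\<lambda>_. 0"])
    show "{s. Re s > 1} \<noteq> {}" by (auto intro!: exI[of _ 2])
    show "open ?U" by (intro open_Diff open_halfspace_Re_gt) auto
    show "connected ?U"
      by (intro connected_open_delete open_halfspace_Re_gt convex_connected convex_halfspace_Re_gt) auto
    have "riemann_zeta holomorphic_on ?U"
      using is_zeta_riemann_zeta by (auto simp: is_zeta_def intro: holomorphic_on_subset)
    then show "(\<lambda>s. reg_zeta s - (s - 1) * riemann_zeta s) holomorphic_on ?U"
      by (intro holomorphic_intros holomorphic_on_subset[OF reg_zeta_holomorphic]) auto
    fix z :: complex assume z: "z \<in> {s. Re s > 1}"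
    then have "riemann_zeta z = dirichlet_zeta z"
      using is_zeta_riemann_zeta by (simp add: is_zeta_def dirichlet_zeta_def)
    then show "reg_zeta z - (z - 1) * riemann_zeta z = 0"
      using dirichlet_zeta_recursion[of z 0] z by (simp add: reg_zeta_def)
  qed (use assms in \<open>auto simp: open_halfspace_Re_gt\<close>)
  then show ?thesis by simp
qed

lemma reg_zeta_1: "reg_zeta 1 = 1"
proof -
  have "dterm (Suc 0) n 1 = 0" for n by (simp add: dterm_def del: of_nat_Suc)
  then show ?thesis by (simp add: reg_zeta_def)
qed

text \<open>The Taylor remainder carries a factor of modulus \<open>norm (1 - s) * norm s\<close>,
  hence the square of the height, and decays at least like \<open>n powr (- 3 / 2)\<close>. The
  range of \<open>Re s\<close> contains the discs of radius 3/2 about \<open>2 + i t\<close> used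
  later.\<close>

lemma reg_zeta_bound:
  obtains K :: real where "K \<ge> 1"
    "\<And>s. 1 / 2 \<le> Re s \<Longrightarrow> Re s \<le> 4 \<Longrightarrow> norm (reg_zeta s) \<le> K * (\<bar>Im s\<bar> + 4) ^ 2"
proof -
  let ?f = "\<lambda>n. real (Suc n) powr (- 3 / 2)"
  have sm: "summable ?f" by (rule summable_Suc_powr) simp
  define K where "K = 1 + suminf ?f"
  have pos: "suminf ?f \<ge> 0" by (rule suminf_nonneg[OF sm]) simp
  show ?thesis
  proof (rule that[of K])
    show "K \<ge> 1" using pos by (simp add: K_def)
    fix s assume s: "1 / 2 \<le> Re s" "Re s \<le> 4"
    define N where "N = \<bar>Im s\<bar> + 4"
    have N: "norm s \<le> N" "norm (1 - s) \<le> N"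
      using cmod_le[of s] cmod_le[of "1 - s"] s by (auto simp: N_def)
    have N1: "N \<ge> 1" by (simp add: N_def)
    have le: "norm (dterm (Suc 0) n s) \<le> N ^ 2 * ?f n" for n
    proof -
      have "norm (dterm (Suc 0) n s) \<le> norm (\<Prod>j<Suc (Suc 0). (1 - s - of_nat j)) * real (Suc n) powr (- Re s - real (Suc 0))"
        by (rule dterm_bound) (use s in auto)
      also have "norm (\<Prod>j<Suc (Suc 0). (1 - s - of_nat j)) = norm (1 - s) * norm s"
        by (simp add: norm_mult)
      also have "norm (1 - s) * norm s * real (Suc n) powr (- Re s - real (Suc 0)) \<le> (N * N) * ?f n"
        using N N1 s by (intro mult_mono powr_mono) auto
      finally show ?thesis by (simp add: power2_eq_square)
    qed
    have "norm (\<Sum>n. dterm (Suc 0) n s) \<le> (\<Sum>n. N ^ 2 * ?f n)"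
      by (rule norm_suminf_le[OF le]) (intro summable_mult sm)
    also have "\<dots> = N ^ 2 * suminf ?f" by (rule suminf_mult[OF sm])
    finally have "norm (reg_zeta s) \<le> 1 + N ^ 2 * suminf ?f"
      unfolding reg_zeta_def by (metis add_left_mono norm_one norm_triangle_le)
    also have "\<dots> \<le> N ^ 2 + N ^ 2 * suminf ?f"
      using N1 by (intro add_right_mono) (simp add: one_le_power)
    finally show "norm (reg_zeta s) \<le> K * (\<bar>Im s\<bar> + 4) ^ 2"
      by (simp add: K_def N_def algebra_simps)
  qed
qed

lemma reg_log_deriv_eq:
  assumes s: "Re s > 0" "s \<noteq> 1" and nz: "riemann_zeta s \<noteq> 0"
  shows "reg_log_deriv s = - (deriv riemann_zeta s / riemann_zeta s) - 1 / (s - 1)"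
proof -
  have "riemann_zeta holomorphic_on - {1}"
    using is_zeta_riemann_zeta by (simp add: is_zeta_def)
  then have dz: "(riemann_zeta has_field_derivative deriv riemann_zeta s) (at s)"
    using s by (intro holomorphic_derivI[of _ "- {1}"]) auto
  have "((\<lambda>z. (z - 1) * riemann_zeta z) has_field_derivative riemann_zeta s + (s - 1) * deriv riemann_zeta s) (at s)"
    by (auto intro!: derivative_eq_intros dz)
  then have "(reg_zeta has_field_derivative riemann_zeta s + (s - 1) * deriv riemann_zeta s) (at s)"
    by (rule has_field_derivative_transform_within_open[where S = "{s. Re s > 0} - {1}"])
       (use s reg_zeta_eq in \<open>auto intro!: open_Diff open_halfspace_Re_gt\<close>)
  then have "deriv reg_zeta s = riemann_zeta s + (s - 1) * deriv riemann_zeta s" by (rule DERIV_imp_deriv)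
  then show ?thesis
    using s nz by (simp add: reg_log_deriv_def reg_zeta_eq add_divide_distrib)
qed

lemma dseries_mangoldt_reg:
  assumes s: "Re s > 1"
  shows "dseries mangoldt s = reg_log_deriv s + 1 / (s - 1)"
proof -
  have "s \<noteq> 1" using s by auto
  then show ?thesis
    using s reg_log_deriv_eq[of s] dseries_mangoldt_eq[OF s] zeta_nonzero_gt_1[OF s] by simp
qed

text \<open>\<open>riemann_hypothesis\<close> speaks of the open strip only, so this line needs the
  classical 3-4-1 argument. Multiplied by \<open>\<sigma>\<close>, the nonnegative combination at
  \<open>1 + \<sigma>\<close> tends to \<open>3 * (1 - m0) - 4 * m1 - m2\<close>, where
  \<open>m0\<close>, \<open>m1\<close>, \<open>m2\<close> are the orders of \<open>reg_zeta\<close>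
  at 1, \<open>1 + i t\<close> and \<open>1 + 2 i t\<close>; a zero means \<open>m1 \<ge> 1\<close>
  and makes the limit negative.\<close>

lemma zeta_nonzero_Re_1:
  assumes t: "t \<noteq> 0"
  shows "riemann_zeta (Complex 1 t) \<noteq> 0"
proof
  assume zero: "riemann_zeta (Complex 1 t) = 0"
  let ?S = "{s. Re s > 0}"
  define lim where "lim = (\<lambda>u. \<lambda>m::nat. ((\<lambda>\<sigma>. of_real \<sigma> * deriv reg_zeta (Complex 1 u + of_real \<sigma>)
      / reg_zeta (Complex 1 u + of_real \<sigma>)) \<longlongrightarrow> of_nat m) (at_right (0::real)))"
  have order: "\<exists>m. (reg_zeta (Complex 1 u) = 0 \<longrightarrow> m \<ge> 1) \<and> lim u m" for u
  proof -
    have "open ?S" "connected ?S" "Complex 1 u \<in> ?S" "1 \<in> ?S" "reg_zeta 1 \<noteq> 0"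
      by (auto simp: open_halfspace_Re_gt convex_halfspace_Re_gt convex_connected reg_zeta_1)
    from log_deriv_order_limit[OF reg_zeta_holomorphic this] show ?thesis
      unfolding lim_def by metis
  qed
  obtain m0 m1 m2 where m: "lim 0 m0" "lim t m1" "lim (2 * t) m2" "m1 \<ge> 1"
    using order[of 0] order[of t] order[of "2 * t"] zero reg_zeta_eq[of "Complex 1 t"] t
    by (auto simp: complex_eq_iff)
  \<comment> \<open>The factor \<open>\<sigma>\<close> turns the pole part
    \<open>1 / (s - 1)\<close> into 1 for \<open>u = 0\<close> and into something that tends to 0
    for other \<open>u\<close>; the rest tends to minus the order.\<close>
  define D where "D = (\<lambda>u \<sigma>. of_real \<sigma> * dseries mangoldt (Complex (1 + \<sigma>) u))"
  have Dlim: "((\<lambda>\<sigma>. D u \<sigma>) \<longlongrightarrow> p - of_nat m) (at_right (0::real))"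
    if "lim u m" and p: "((\<lambda>\<sigma>. of_real \<sigma> / (Complex \<sigma> u)) \<longlongrightarrow> p) (at_right (0::real))" for u m p
  proof -
    have "((\<lambda>\<sigma>. of_real \<sigma> / (Complex \<sigma> u) - of_real \<sigma> * deriv reg_zeta (Complex 1 u + of_real \<sigma>)
      / reg_zeta (Complex 1 u + of_real \<sigma>)) \<longlongrightarrow> p - of_nat m) (at_right (0::real))"
      using that(1) unfolding lim_def by (intro tendsto_diff p)
    moreover have "\<forall>\<^sub>F \<sigma> in at_right (0::real). of_real \<sigma> / (Complex \<sigma> u) - of_real \<sigma> * deriv reg_zeta (Complex 1 u + of_real \<sigma>)
      / reg_zeta (Complex 1 u + of_real \<sigma>) = D u \<sigma>"
      using eventually_at_right_less[of "0::real"]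
    proof eventually_elim
      case (elim \<sigma>)
      have 1: "Complex (1 + \<sigma>) u - 1 = Complex \<sigma> u" by (simp add: complex_eq_iff)
      have 2: "Complex 1 u + of_real \<sigma> = Complex (1 + \<sigma>) u" by (simp add: complex_eq_iff)
      have "D u \<sigma> = of_real \<sigma> * (reg_log_deriv (Complex (1 + \<sigma>) u) + 1 / Complex \<sigma> u)"
        using elim dseries_mangoldt_reg[of "Complex (1 + \<sigma>) u"] unfolding D_def 1 by simp
      then show ?case unfolding 2 reg_log_deriv_def by (simp add: right_diff_distrib)
    qed
    ultimately show ?thesis by (rule Lim_transform_eventually)
  qed
  have l0: "((\<lambda>\<sigma>. D 0 \<sigma>) \<longlongrightarrow> 1 - of_nat m0) (at_right (0::real))"
  proof (rule Dlim[OF m(1)])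
    have "\<forall>\<^sub>F \<sigma> in at_right (0::real). 1 = of_real \<sigma> / (Complex \<sigma> 0)"
      using eventually_at_right_less[of "0::real"]
      by eventually_elim (simp add: complex_of_real_def complex_eq_iff)
    then show "((\<lambda>\<sigma>. of_real \<sigma> / (Complex \<sigma> 0)) \<longlongrightarrow> 1) (at_right (0::real))"
      by (rule Lim_transform_eventually[OF tendsto_const])
  qed
  have lu: "((\<lambda>\<sigma>. of_real \<sigma> / (Complex \<sigma> u)) \<longlongrightarrow> 0) (at_right (0::real))" if "u \<noteq> 0" for u
  proof -
    have "((\<lambda>\<sigma>. of_real \<sigma> / (of_real \<sigma> + \<i> * of_real u)) \<longlongrightarrow> of_real 0 / (of_real 0 + \<i> * of_real u)) (at_right (0::real))"
      using that by (intro tendsto_intros) auto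
    then show ?thesis by (simp add: Complex_eq)
  qed
  have l1: "((\<lambda>\<sigma>. D t \<sigma>) \<longlongrightarrow> 0 - of_nat m1) (at_right (0::real))"
    by (rule Dlim[OF m(2) lu]) (use t in simp)
  have l2: "((\<lambda>\<sigma>. D (2 * t) \<sigma>) \<longlongrightarrow> 0 - of_nat m2) (at_right (0::real))"
    by (rule Dlim[OF m(3) lu]) (use t in simp)
  have "((\<lambda>\<sigma>. Re (3 * D 0 \<sigma> + 4 * D t \<sigma> + D (2 * t) \<sigma>)) \<longlongrightarrow>
      Re (3 * (1 - of_nat m0) + 4 * (0 - of_nat m1) + (0 - of_nat m2))) (at_right (0::real))"
    by (intro tendsto_intros l0 l1 l2)
  moreover have "\<forall>\<^sub>F \<sigma> in at_right (0::real). Re (3 * D 0 \<sigma> + 4 * D t \<sigma> + D (2 * t) \<sigma>) \<ge> 0"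
    using eventually_at_right_less[of "0::real"]
  proof eventually_elim
    case (elim \<sigma>)
    have "0 \<le> \<sigma> * Re (3 * dseries mangoldt (of_real (1 + \<sigma>)) + 4 * dseries mangoldt (Complex (1 + \<sigma>) t)
       + dseries mangoldt (Complex (1 + \<sigma>) (2 * t)))"
      using elim by (intro mult_nonneg_nonneg mangoldt_341) auto
    also have "\<dots> = Re (of_real \<sigma> * (3 * dseries mangoldt (of_real (1 + \<sigma>)) + 4 * dseries mangoldt (Complex (1 + \<sigma>) t)
       + dseries mangoldt (Complex (1 + \<sigma>) (2 * t))))"
      by simp
    also have "of_real \<sigma> * (3 * dseries mangoldt (of_real (1 + \<sigma>)) + 4 * dseries mangoldt (Complex (1 + \<sigma>) t)
       + dseries mangoldt (Complex (1 + \<sigma>) (2 * t))) = 3 * D 0 \<sigma> + 4 * D t \<sigma> + D (2 * t) \<sigma>"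
      unfolding D_def complex_of_real_def[of "1 + \<sigma>"] by (simp only: algebra_simps)
    finally show ?case .
  qed
  ultimately have "Re (3 * (1 - of_nat m0) + 4 * (0 - of_nat m1) + (0 - of_nat m2)) \<ge> 0"
    by (rule tendsto_lowerbound) auto
  then show False using m(4) by simp
qed

lemma reg_zeta_nonzero:
  assumes RH: riemann_hypothesis and s: "Re s > 1 / 2"
  shows "reg_zeta s \<noteq> 0"
proof (cases "s = 1")
  case False
  have "riemann_zeta s \<noteq> 0"
  proof -
    consider "Re s < 1" | "Re s = 1" | "Re s > 1" by linarith
    then show ?thesis
    proof cases
      case 1
      then show ?thesis using RH s unfolding riemann_hypothesis_def by force
    next
      case 2
      then have "s = Complex 1 (Im s)" "Im s \<noteq> 0" using False by (auto simp: complex_eq_iff)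
      then show ?thesis using zeta_nonzero_Re_1[of "Im s"] by metis
    next
      case 3
      then show ?thesis by (rule zeta_nonzero_gt_1)
    qed
  qed
  then show ?thesis using reg_zeta_eq[of s] s False by simp
qed (simp add: reg_zeta_1)

text \<open>Borel-Caratheodory for \<open>reg_zeta\<close> in the disc of radius 3/2 about
  \<open>2 + i t\<close>: it stays in \<open>Re s > 1 / 2\<close>, where there are no zeros, and the
  concentric disc of radius 5/4 reaches down to \<open>Re s = 3 / 4\<close>.\<close>

lemma reg_log_deriv_bound:
  assumes RH: riemann_hypothesis
  obtains C :: real where "C > 0"
    "\<And>s. 3 / 4 \<le> Re s \<Longrightarrow> Re s \<le> 2 \<Longrightarrow> norm (reg_log_deriv s) \<le> C * ln (\<bar>Im s\<bar> + 4)"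
proof -
  obtain K where K: "K \<ge> 1"
    "\<And>s. 1 / 2 \<le> Re s \<Longrightarrow> Re s \<le> 4 \<Longrightarrow> norm (reg_zeta s) \<le> K * (\<bar>Im s\<bar> + 4) ^ 2"
    using reg_zeta_bound by blast
  show ?thesis
  \<comment> \<open>176 is \<open>4 * (3/2 + 5/4) / (3/2 - 5/4) ^ 2\<close>. The bracket bounds
    \<open>M / ln (\<bar>t\<bar> + 4)\<close> for the \<open>M\<close> below, by
    \<open>ln (\<bar>t\<bar> + 6) \<le> 2 * ln (\<bar>t\<bar> + 4)\<close> and
    \<open>1 \<le> ln (\<bar>t\<bar> + 4)\<close>.\<close>
  proof (rule that[of "176 * (ln (4 * K) + 5)"])
    have lnK: "ln (4 * K) \<ge> 0" using K by simp
    then show "176 * (ln (4 * K) + 5) > 0" by simp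
    fix s assume s: "3 / 4 \<le> Re s" "Re s \<le> 2"
    define t where "t = Im s"
    define c where "c = Complex 2 t"
    \<comment> \<open>The 4 is the inverse of the lower bound at \<open>c\<close>,
      \<open>\<bar>t\<bar> + 6\<close> allows for a change of height by at most 2 within the disc,
      and the final 1 makes the inequality strict.\<close>
    define M where "M = ln (4 * K * (\<bar>t\<bar> + 6) ^ 2) + 1"
    have inb: "1 / 2 < Re w \<and> Re w \<le> 4 \<and> \<bar>Im w\<bar> \<le> \<bar>t\<bar> + 2" if "w \<in> ball c (3 / 2)" for w
      using that abs_Re_le_cmod[of "c - w"] abs_Im_le_cmod[of "c - w"] by (auto simp: c_def dist_norm)
    have c1: "norm (reg_zeta c) \<ge> 1 / 4"
    proof -
      have "c \<noteq> 1" "Re c = 2" by (auto simp: c_def complex_eq_iff)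
      have "1 * (1 / 4) \<le> norm (c - 1) * norm (riemann_zeta c)"
        using norm_zeta_2_ge[of c] complex_Re_le_cmod[of "c - 1"] \<open>Re c = 2\<close> by (intro mult_mono) auto
      then show ?thesis using reg_zeta_eq[of c] \<open>c \<noteq> 1\<close> \<open>Re c = 2\<close> by (simp add: norm_mult)
    qed
    then have c0: "norm (reg_zeta c) > 0" by linarith
    have "norm (deriv reg_zeta s / reg_zeta s) \<le> 4 * M * (3 / 2 + 5 / 4) / (3 / 2 - 5 / 4) ^ 2"
    proof (rule borel_caratheodory_log_deriv[where c = c])
      show "reg_zeta holomorphic_on ball c (3 / 2)"
        using inb by (intro holomorphic_on_subset[OF reg_zeta_holomorphic]) force
      show "reg_zeta z \<noteq> 0" if "z \<in> ball c (3 / 2)" for z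
        using reg_zeta_nonzero[OF RH] inb[OF that] by blast
      show "ln (norm (reg_zeta z) / norm (reg_zeta c)) < M" if z: "z \<in> ball c (3 / 2)" for z
      proof -
        have nz: "reg_zeta z \<noteq> 0" using reg_zeta_nonzero[OF RH] inb[OF z] by blast
        have "norm (reg_zeta z) \<le> K * (\<bar>Im z\<bar> + 4) ^ 2" using K(2)[of z] inb[OF z] by simp
        also have "\<dots> \<le> K * (\<bar>t\<bar> + 6) ^ 2"
          using inb[OF z] K(1) by (intro mult_left_mono power_mono) auto
        finally have "norm (reg_zeta z) / norm (reg_zeta c) \<le> K * (\<bar>t\<bar> + 6) ^ 2 / (1 / 4)"
          using c1 K(1) by (intro frac_le) auto
        then have "ln (norm (reg_zeta z) / norm (reg_zeta c)) \<le> ln (4 * K * (\<bar>t\<bar> + 6) ^ 2)"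
          using nz c0 by (intro ln_mono divide_pos_pos) auto
        then show ?thesis by (simp add: M_def)
      qed
      have "norm (s - c) = \<bar>Re s - 2\<bar>"
        by (simp add: c_def t_def cmod_def)
      then show "norm (s - c) \<le> 5 / 4" using s by simp
    qed auto
    also have "\<dots> = 176 * M" by (simp add: power2_eq_square)
    also have "\<dots> \<le> 176 * ((ln (4 * K) + 5) * ln (\<bar>t\<bar> + 4))"
    proof -
      have e: "exp 1 \<le> (4::real)" using e_less_272 by simp
      have l1: "ln (\<bar>t\<bar> + 4) \<ge> 1"
        using e by (subst ln_ge_iff) auto
      have "ln (\<bar>t\<bar> + 6) \<le> ln ((\<bar>t\<bar> + 4) ^ 2)"
        by (intro ln_mono) (auto simp: power2_eq_square algebra_simps)
      also have "\<dots> = 2 * ln (\<bar>t\<bar> + 4)" by (subst ln_realpow) auto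
      finally have l2: "ln (\<bar>t\<bar> + 6) \<le> 2 * ln (\<bar>t\<bar> + 4)" .
      have "M = ln (4 * K) + 2 * ln (\<bar>t\<bar> + 6) + 1"
        using K(1) by (simp add: M_def ln_mult ln_realpow)
      also have "\<dots> \<le> ln (4 * K) * ln (\<bar>t\<bar> + 4) + 4 * ln (\<bar>t\<bar> + 4) + ln (\<bar>t\<bar> + 4)"
        using l1 l2 mult_left_mono[OF l1 lnK] by linarith
      finally show ?thesis by (simp add: algebra_simps)
    qed
    finally show "norm (reg_log_deriv s) \<le> 176 * (ln (4 * K) + 5) * ln (\<bar>Im s\<bar> + 4)"
      unfolding reg_log_deriv_def t_def norm_minus_cancel by (simp only: mult.assoc)
  qed
qed

section \<open>Reflection in the real axis\<close>

lemma has_field_derivative_cnj_cnj: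
  assumes "(f has_field_derivative d) (at z)"
  shows "((\<lambda>w. cnj (f (cnj w))) has_field_derivative cnj d) (at (cnj z))"
proof -
  have "filterlim cnj (at 0) (at (0::complex))"
  proof (rule filterlim_atI)
    have "(cnj \<longlongrightarrow> cnj 0) (at 0)" by (intro tendsto_intros)
    then show "(cnj \<longlongrightarrow> 0) (at 0)" by simp
    show "\<forall>\<^sub>F x in at 0. cnj x \<noteq> 0" by (auto simp: eventually_at_filter)
  qed
  then have "((\<lambda>h. cnj ((f (z + cnj h) - f z) / cnj h)) \<longlongrightarrow> cnj d) (at 0)"
    using assms unfolding DERIV_def by (intro tendsto_cnj) (rule filterlim_compose)
  then show ?thesis unfolding DERIV_def by simp
qed

lemma reg_zeta_cnj:
  assumes "Re s > 0"
  shows "reg_zeta (cnj s) = cnj (reg_zeta s)"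
proof -
  let ?f = "\<lambda>s. cnj (reg_zeta (cnj s)) - reg_zeta s"
  have "?f s = 0"
  proof (rule analytic_continuation_open[of "{s. Re s > 1}" "{s. Re s > 0}" ?f "\<lambda>_. 0"])
    show "{s. Re s > 1} \<noteq> {}" by (auto intro!: exI[of _ 2])
    show "connected {s. Re s > 0}" by (intro convex_connected convex_halfspace_Re_gt)
    have "(\<lambda>s. cnj (reg_zeta (cnj s))) holomorphic_on {s. Re s > 0}"
      unfolding holomorphic_on_open[OF open_halfspace_Re_gt]
    proof
      fix z :: complex assume "z \<in> {s. Re s > 0}"
      then have "(reg_zeta has_field_derivative deriv reg_zeta (cnj z)) (at (cnj z))"
        by (intro holomorphic_derivI[OF reg_zeta_holomorphic open_halfspace_Re_gt]) auto
      from has_field_derivative_cnj_cnj[OF this]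
      show "\<exists>f'. ((\<lambda>s. cnj (reg_zeta (cnj s))) has_field_derivative f') (at z)" by auto
    qed
    then show "?f holomorphic_on {s. Re s > 0}"
      by (intro holomorphic_intros reg_zeta_holomorphic)
    fix z :: complex assume z: "z \<in> {s. Re s > 1}"
    have "(\<lambda>n. cnj (of_nat n powr (- cnj z))) sums cnj (dseries (\<lambda>_. 1) (cnj z))"
      using dseries_sums[OF log_bounded_1, of "cnj z"] z by (subst sums_cnj) auto
    moreover have "cnj (of_nat n powr (- cnj z)) = of_nat n powr (- z)" for n
      by (subst cnj_powr) auto
    ultimately have "dseries (\<lambda>_. 1) z = cnj (dseries (\<lambda>_. 1) (cnj z))"
      using dseries_sums[OF log_bounded_1, of z] z by (simp add: sums_iff)
    moreover have "z \<noteq> 1" "cnj z \<noteq> 1" using z by auto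
    ultimately show "?f z = 0"
      using z by (simp add: reg_zeta_eq riemann_zeta_dseries)
  qed (use assms in \<open>auto simp: open_halfspace_Re_gt\<close>)
  then show ?thesis by (metis complex_cnj_cnj eq_iff_diff_eq_0)
qed

text \<open>The resonator weight is spread over both half lines. This symmetry makes the real part
  even in the height, so that large values at negative \<open>t\<close> are mirror images of those
  at positive \<open>t\<close>.\<close>

lemma reg_log_deriv_cnj:
  assumes s: "Re s > 0"
  shows "reg_log_deriv (cnj s) = cnj (reg_log_deriv s)"
proof -
  have "(reg_zeta has_field_derivative deriv reg_zeta s) (at s)"
    by (rule holomorphic_derivI[OF reg_zeta_holomorphic open_halfspace_Re_gt]) (use s in auto)
  from has_field_derivative_cnj_cnj[OF this]
  have "(reg_zeta has_field_derivative cnj (deriv reg_zeta s)) (at (cnj s))"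
    by (rule has_field_derivative_transform_within_open[OF _ open_halfspace_Re_gt[of 0]])
       (use s in \<open>auto simp: reg_zeta_cnj[symmetric]\<close>)
  then have "deriv reg_zeta (cnj s) = cnj (deriv reg_zeta s)" by (rule DERIV_imp_deriv)
  then show ?thesis using reg_zeta_cnj[OF s] by (simp add: reg_log_deriv_def)
qed

section \<open>Chebyshev's and Mertens' estimates\<close>

lemma prod_primes_dvd:
  fixes x :: nat
  assumes "finite P" "\<And>p. p \<in> P \<Longrightarrow> prime p \<and> p dvd x"
  shows "\<Prod>P dvd x"
  using assms
proof (induction P rule: finite_induct)
  case (insert p P)
  have "coprime p (\<Prod>P)"
    using insert by (intro prod_coprime_right) (metis insertCI primes_coprime)
  then show ?case using insert by (simp add: divides_mult)
qed simp

definition theta :: "nat \<Rightarrow> real" where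
  "theta n = (\<Sum>p | prime p \<and> p \<le> n. ln (real p))"

lemma finite_primes_le [simp]: "finite {p::nat. prime p \<and> p \<le> n}"
  by (rule finite_subset[of _ "{..n}"]) auto

lemma primes_le_1: "{p::nat. prime p \<and> p \<le> Suc 0} = {}"
  by (auto dest!: prime_gt_1_nat)

lemma theta_mono: "m \<le> n \<Longrightarrow> theta m \<le> theta n"
  unfolding theta_def by (rule sum_mono2) (auto intro!: ln_ge_zero dest: prime_gt_0_nat)

text \<open>Chebyshev's argument: every prime \<open>p\<close> with \<open>n < p \<le> 2 * n\<close>
  divides the central binomial coefficient, which is at most \<open>4 ^ n\<close>.\<close>

lemma theta_double: "theta (2 * n) \<le> theta n + 2 * real n * ln 2"
proof -
  let ?P = "{p. prime p \<and> n < p \<and> p \<le> 2 * n}"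
  have fin: "finite ?P" by (rule finite_subset[of _ "{..2*n}"]) auto
  have fact: "fact (2 * n) = (2 * n choose n) * fact n * (fact n :: nat)"
    using binomial_fact_lemma[of n "2 * n"] by (simp add: mult_ac)
  have "\<Prod>?P dvd (2 * n choose n)"
  proof (rule prod_primes_dvd[OF fin])
    fix p assume p: "p \<in> ?P"
    then have "p dvd fact (2 * n)" "\<not> p dvd fact n"
      by (auto simp: prime_dvd_fact_iff)
    then show "prime p \<and> p dvd (2 * n choose n)"
      using p unfolding fact by (auto simp: prime_dvd_mult_iff)
  qed
  then have "\<Prod>?P \<le> (2 * n choose n)"
    by (rule dvd_imp_le) simp
  also have "\<dots> \<le> 2 ^ (2 * n)" by (rule binomial_le_pow2)
  finally have le: "real (\<Prod>?P) \<le> 2 ^ (2 * n)"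
    by (metis of_nat_le_iff of_nat_numeral of_nat_power)
  have "theta (2 * n) = theta n + (\<Sum>p\<in>?P. ln (real p))"
    unfolding theta_def by (subst sum.union_disjoint[symmetric]) (auto intro!: sum.cong fin)
  also have "(\<Sum>p\<in>?P. ln (real p)) = ln (real (\<Prod>?P))"
    
    by (subst of_nat_prod, subst ln_prod) (auto simp: fin prime_gt_0_nat)
  also have "\<dots> \<le> ln (2 ^ (2 * n))"
    using le by (subst ln_le_cancel_iff) (auto intro!: prod_pos dest: prime_gt_0_nat)
  also have "\<dots> = 2 * real n * ln 2" by (simp add: ln_realpow)
  finally show ?thesis by simp
qed

lemma theta_le: "theta n \<le> 4 * ln 2 * real n"
proof (induction n rule: less_induct)
  case (less n)
  consider "n = 0" | "n = 1" | m where "n = 2 * m" "m \<ge> 1" | m where "n = 2 * m + 1" "m \<ge> 1"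
  proof (cases "even n")
    case True
    then obtain m where "n = 2 * m" by (elim evenE)
    then show ?thesis using that by (cases "m = 0") auto
  next
    case False
    then obtain m where "n = 2 * m + 1" by (elim oddE)
    then show ?thesis using that by (cases "m = 0") auto
  qed
  then show ?case
  proof cases
    case 1
    have "{p. prime p \<and> p \<le> (0::nat)} = {}" by auto
    then show ?thesis using 1 by (simp add: theta_def)
  next
    case 2
    then show ?thesis by (simp add: theta_def primes_le_1)
  next
    case 3
    have "theta n \<le> theta m + 2 * real m * ln 2" using theta_double[of m] 3 by simp
    also have "theta m \<le> 4 * ln 2 * real m" using less[of m] 3 by simp
    also have "4 * ln 2 * real m + 2 * real m * ln 2 = ln 2 * (6 * real m)"
      by (simp add: algebra_simps)
    also have "\<dots> \<le> ln 2 * (8 * real m)" by (intro mult_left_mono) auto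
    finally show ?thesis using 3 by (simp add: algebra_simps)
  next
    case 4
    have "theta n \<le> theta (2 * (m + 1))" using 4 by (intro theta_mono) auto
    also have "\<dots> \<le> theta (m + 1) + 2 * real (m + 1) * ln 2" by (rule theta_double)
    also have "theta (m + 1) \<le> 4 * ln 2 * real (m + 1)" using less[of "m + 1"] 4 by simp
    also have "4 * ln 2 * real (m + 1) + 2 * real (m + 1) * ln 2 = ln 2 * (6 * real m + 6)"
      by (simp add: algebra_simps)
    \<comment> \<open>The constant is twice what doubling alone needs; the surplus pays for rounding
      an odd \<open>n\<close> up and suffices from \<open>m = 1\<close> on.\<close>
    also have "\<dots> \<le> ln 2 * (8 * real m + 4)" using 4 by (intro mult_left_mono) auto
    finally show ?thesis using 4 by (simp add: algebra_simps)
  qed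
qed

text \<open>Legendre's formula: \<open>ln m\<close> is spread over the divisors of \<open>m\<close>,
  and \<open>d\<close> has \<open>n div d\<close> multiples up to \<open>n\<close>.\<close>

lemma ln_fact_mangoldt:
  "ln (fact n :: real) = (\<Sum>d=1..n. mangoldt d * real (n div d))"
proof -
  have "ln (fact n :: real) = (\<Sum>m=1..n. ln (real m))"
    by (subst fact_prod, subst of_nat_prod, subst ln_prod) auto
  also have "\<dots> = (\<Sum>m=1..n. \<Sum>d | d dvd m. mangoldt d)"
    by (intro sum.cong refl) (simp add: mangoldt_sum)
  also have "\<dots> = (\<Sum>m=1..n. \<Sum>d=1..n. if d dvd m then mangoldt d else 0)"
  proof (rule sum.cong[OF refl])
    fix m assume m: "m \<in> {1..n}"
    have "{d. d dvd m} = {d \<in> {1..n}. d dvd m}"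
      using m by (auto dest: dvd_imp_le simp: Suc_le_eq intro!: Nat.gr0I)
    then show "(\<Sum>d | d dvd m. mangoldt d) = (\<Sum>d=1..n. if d dvd m then mangoldt d else (0::real))"
      using sum.inter_filter[of "{1..n}" "mangoldt :: nat \<Rightarrow> real" "\<lambda>d. d dvd m"] by simp
  qed
  also have "\<dots> = (\<Sum>d=1..n. \<Sum>m=1..n. if d dvd m then mangoldt d else 0)"
    by (rule sum.swap)
  also have "\<dots> = (\<Sum>d=1..n. mangoldt d * real (n div d))"
  proof (intro sum.cong refl)
    fix d assume d: "d \<in> {1..n}"
    have "{m \<in> {1..n}. d dvd m} = (\<lambda>k. d * k) ` {1..n div d}"
      using d by (force simp: image_iff less_eq_div_iff_mult_less_eq mult_ac)
    moreover have "inj_on (\<lambda>k. d * k) {1..n div d}" using d by (auto simp: inj_on_def)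
    ultimately have "card {m \<in> {1..n}. d dvd m} = n div d" by (simp add: card_image)
    then show "(\<Sum>m=1..n. if d dvd m then mangoldt d else 0) = mangoldt d * real (n div d)"
      by (simp add: sum.inter_filter[symmetric])
  qed
  finally show ?thesis .
qed

section \<open>Mertens' first theorem and partial summation\<close>

definition mertens :: "nat \<Rightarrow> real" where
  "mertens n = (\<Sum>p | prime p \<and> p \<le> n. ln (real p) / real p)"

text \<open>In Legendre's formula only the primes are kept, with
  \<open>n div p \<ge> n / p - 1\<close>; the rounding adds up to \<open>theta n\<close>, which is
  \<open>O(n)\<close> by Chebyshev.\<close>

lemma mertens_upper:
  assumes "n \<ge> 1"
  shows "mertens n \<le> ln (real n) + 4 * ln 2"
proof -
  have "real n * mertens n - theta n = (\<Sum>p | prime p \<and> p \<le> n. ln (real p) * (real n / real p - 1))"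
    by (simp add: mertens_def theta_def sum_distrib_left sum_subtractf algebra_simps)
  also have "\<dots> \<le> (\<Sum>p | prime p \<and> p \<le> n. mangoldt p * real (n div p))"
  proof (intro sum_mono)
    fix p assume p: "p \<in> {p. prime p \<and> p \<le> n}"
    then have "p > 0" using prime_gt_0_nat by auto
    then have "real n / real p - 1 \<le> real (n div p)"
      using floor_divide_of_nat_eq[of n p, where ?'a = real]
      by linarith
    then show "ln (real p) * (real n / real p - 1) \<le> mangoldt p * real (n div p)"
      using p \<open>p > 0\<close> by (simp add: mult_left_mono)
  qed
  also have "\<dots> \<le> (\<Sum>d=1..n. mangoldt d * real (n div d))"
    by (rule sum_mono2) (auto simp: mangoldt_nonneg Suc_le_eq dest: prime_gt_0_nat)
  also have "\<dots> = ln (fact n)" by (rule ln_fact_mangoldt[symmetric])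
  also have "\<dots> \<le> ln (real n ^ n)"
    using fact_le_power[where n = n and ?'a = real] assms
    by (subst ln_le_cancel_iff) (auto simp flip: of_nat_power)
  also have "\<dots> = real n * ln (real n)" using assms by (simp add: ln_realpow)
  finally have "real n * mertens n \<le> real n * (ln (real n) + 4 * ln 2)"
    using theta_le[of n] by (simp add: algebra_simps)
  then show ?thesis using assms by (simp add: mult_le_cancel_left)
qed

lemma ln_le_2_sqrt: "x > 0 \<Longrightarrow> ln x \<le> 2 * sqrt (x::real)"
  using ln_le_minus_one[of "sqrt x"] by (simp add: ln_sqrt)

lemma mangoldt_prime_powers_bound:
  obtains K :: real where "\<And>n. (\<Sum>d=1..n. mangoldt d / real d) \<le> mertens n + K"
proof -
  \<comment> \<open>Majorant for the powers \<open>p ^ k\<close> with \<open>k \<ge> 2\<close>: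
    their geometric sum is at most \<open>2 / p\<^sup>2\<close>, and
    \<open>ln p \<le> 2 * sqrt p\<close>.\<close>
  let ?f = "\<lambda>m::nat. 4 * real m powr (-3/2)"
  have sm: "summable ?f" by (intro summable_mult) (simp add: summable_real_powr_iff)
  have "(\<Sum>d=1..n. mangoldt d / real d) \<le> mertens n + suminf ?f" for n
  proof -
    let ?P = "{p. prime p \<and> p \<le> n}"
    let ?R = "{d \<in> {1..n}. primepow d \<and> \<not> prime d}"
    have "(\<Sum>d=1..n. mangoldt d / real d) = (\<Sum>d\<in>?P \<union> ?R. mangoldt d / real d)"
      by (rule sum.mono_neutral_right)
         (auto simp: mangoldt_def Suc_le_eq dest: prime_gt_0_nat)
    also have "\<dots> = mertens n + (\<Sum>d\<in>?R. mangoldt d / real d)"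
      by (subst sum.union_disjoint) (auto simp: mertens_def)
    also have "(\<Sum>d\<in>?R. mangoldt d / real d) \<le>
        (\<Sum>d\<in>(\<lambda>(p,k). p ^ k) ` (?P \<times> {2..n}). mangoldt d / real d)"
    proof (rule sum_mono2)
      show "?R \<subseteq> (\<lambda>(p,k). p ^ k) ` (?P \<times> {2..n})"
      proof
        fix d assume d: "d \<in> ?R"
        then obtain p k where pk: "prime p" "k > 0" "d = p ^ k" by (auto simp: primepow_def)
        have "k \<noteq> 1" using pk d by auto
        have "p \<le> n" using pk d by (metis (no_types, lifting) atLeastAtMost_iff le_trans mem_Collect_eq
              power_increasing power_one_right prime_ge_1_nat Suc_leI One_nat_def)
        have "k < p ^ k" using prime_gt_1_nat[OF pk(1)] by (intro power_gt_expt) auto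
        then show "d \<in> (\<lambda>(p,k). p ^ k) ` (?P \<times> {2..n})"
          using pk d \<open>k \<noteq> 1\<close> \<open>p \<le> n\<close> by (intro image_eqI[of _ _ "(p, k)"]) auto
      qed
    qed (auto simp: mangoldt_nonneg)
    also have "\<dots> \<le> (\<Sum>(p,k)\<in>?P \<times> {2..n}. mangoldt (p ^ k) / real (p ^ k))"
      using sum_image_le[of "?P \<times> {2..n}" "\<lambda>d. mangoldt d / real d" "\<lambda>(p,k). p ^ k"]
      by (auto simp: mangoldt_nonneg case_prod_unfold)
    also have "\<dots> = (\<Sum>p\<in>?P. \<Sum>k=2..n. ln (real p) * (1 / real p) ^ k)"
      by (subst sum.cartesian_product[symmetric]) (auto intro!: sum.cong simp: power_divide)
    also have "\<dots> \<le> (\<Sum>p\<in>?P. ?f p)"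
    proof (intro sum_mono)
      fix p assume p: "p \<in> ?P"
      then have p2: "real p \<ge> 2" using prime_ge_2_nat by auto
      have "(\<Sum>k=2..n. (1 / real p) ^ k) \<le> 2 / real p ^ 2"
      proof (cases "n \<ge> 2")
        case True
        have "(\<Sum>k=2..n. (1 / real p) ^ k) \<le> (1 / real p) ^ 2 / (1 - 1 / real p)"
          using True p2 by (subst sum_gp) (auto intro!: divide_right_mono simp: field_simps)
        also have "\<dots> \<le> (1 / real p) ^ 2 / (1/2)"
          using p2 by (intro divide_left_mono) (auto simp: field_simps)
        finally show ?thesis by (simp add: power_divide)
      qed auto
      then have "(\<Sum>k=2..n. ln (real p) * (1 / real p) ^ k) \<le> ln (real p) * (2 / real p ^ 2)"
        using p2 by (subst sum_distrib_left[symmetric]) (intro mult_left_mono, auto)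
      also have "\<dots> \<le> (2 * sqrt (real p)) * (2 / real p ^ 2)"
        using p2 by (intro mult_right_mono ln_le_2_sqrt) auto
      also have "\<dots> = 4 * (real p powr (1/2) * real p powr (-2))"
        using p2 by (simp add: powr_half_sqrt powr_minus field_simps)
      also have "\<dots> = ?f p" by (simp flip: powr_add)
      finally show "(\<Sum>k=2..n. ln (real p) * (1 / real p) ^ k) \<le> ?f p" .
    qed
    also have "\<dots> \<le> suminf ?f" by (rule sum_le_suminf[OF sm]) auto
    finally show ?thesis by simp
  qed
  then show ?thesis by (rule that)
qed

text \<open>\<open>n ^ n / fact n\<close> is a single term of the exponential series at
  \<open>n\<close>.\<close>

lemma ln_fact_ge: "ln (fact n) \<ge> real n * ln (real n) - real n"
proof (cases "n = 0")
  case False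
  have "real n ^ n / fact n \<le> exp (real n)"
    using sum_le_suminf[OF summable_exp_generic[of "real n"], of "{n}"]
    by (simp add: exp_def divide_inverse mult_ac)
  then have "real n ^ n \<le> exp (real n) * fact n" by (simp add: field_simps)
  then have "ln (real n ^ n) \<le> ln (exp (real n) * fact n)"
    using False by (subst ln_le_cancel_iff) auto
  then show ?thesis using False by (simp add: ln_realpow ln_mult)
qed simp

lemma mertens_estimate: "\<exists>C\<ge>0. \<forall>n\<ge>1. \<bar>mertens n - ln (real n)\<bar> \<le> C"
proof -
  obtain K where K: "\<And>n. (\<Sum>d=1..n. mangoldt d / real d) \<le> mertens n + K"
    using mangoldt_prime_powers_bound by blast
  have low: "ln (real n) - 1 - K \<le> mertens n" if n: "n \<ge> 1" for n
  proof -
    have "real n * ln (real n) - real n \<le> ln (fact n)" by (rule ln_fact_ge)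
    also have "\<dots> \<le> (\<Sum>d=1..n. mangoldt d * (real n / real d))"
      unfolding ln_fact_mangoldt
      by (intro sum_mono mult_left_mono mangoldt_nonneg of_nat_div_le_of_nat)
    also have "\<dots> = real n * (\<Sum>d=1..n. mangoldt d / real d)"
      by (simp add: sum_distrib_left mult_ac)
    also have "\<dots> \<le> real n * (mertens n + K)" by (intro mult_left_mono K) auto
    finally have "real n * (ln (real n) - 1 - K) \<le> real n * mertens n"
      by (simp add: algebra_simps)
    then show ?thesis using n by (simp add: mult_le_cancel_left)
  qed
  show ?thesis
  proof (intro exI[of _ "\<bar>1 + K\<bar> + 4 * ln 2"] conjI allI impI)
    fix n :: nat assume "n \<ge> 1"
    then show "\<bar>mertens n - ln (real n)\<bar> \<le> \<bar>1 + K\<bar> + 4 * ln 2"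
      using low[of n] mertens_upper[of n] ln_gt_zero[of 2] by linarith
  qed simp
qed

text \<open>Partial summation of Mertens' estimate against \<open>p powr a\<close>. One constant
  \<open>C\<close> must serve all \<open>a\<close> at once, because the lemma is applied with
  \<open>a = A / ln (ln T)\<close>, which tends to 0.\<close>

lemma sum_prime_powr_lower:
  obtains C :: real where "C \<ge> 0"
    "\<And>n a. n \<ge> 1 \<Longrightarrow> a > 0 \<Longrightarrow>
       (\<Sum>p | prime p \<and> p \<le> n. ln (real p) * real p powr (a - 1)) \<ge>
         (real n powr a - 1) / a - C * real n powr a"
proof -
  obtain C where C: "C \<ge> 0" "\<And>n. n \<ge> 1 \<Longrightarrow> \<bar>mertens n - ln (real n)\<bar> \<le> C"
    using mertens_estimate by blast
  \<comment> \<open>The boundary term of the partial summation stays in the induction hypothesis.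
    Shifted by \<open>C\<close>, its coefficient is never positive, so errors do not pile up as the
    weight grows.\<close>
  have main: "(\<Sum>p | prime p \<and> p \<le> n. ln (real p) * real p powr (a - 1)) \<ge>
         (real n powr a - 1) / a + (mertens n - ln (real n) - C) * real n powr a"
    if n: "n \<ge> 1" and a: "a > 0" for n a
    using n
  proof (induction n rule: nat_induct_at_least)
    case base
    show ?case using C by (simp add: mertens_def primes_le_1)
  next
    case (Suc n)
    define S where "S = (\<lambda>n. \<Sum>p | prime p \<and> p \<le> n. ln (real p) * real p powr (a - 1))"
    define w where "w = (\<lambda>n. real n powr a)"
    define e where "e = (\<lambda>n. mertens n - ln (real n))"
    have eq: "{p. prime p \<and> p \<le> Suc n} =
        (if prime (Suc n) then insert (Suc n) {p. prime p \<and> p \<le> n} else {p. prime p \<and> p \<le> n})"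
      by (auto simp: le_Suc_eq)
    have S: "S (Suc n) = S n + (mertens (Suc n) - mertens n) * w (Suc n)"
      unfolding S_def mertens_def eq w_def
      by (auto simp: powr_diff simp del: of_nat_Suc)
    \<comment> \<open>\<open>1 + y \<le> exp y\<close> bounds the increment of \<open>w / a\<close>
      by \<open>w (Suc n)\<close> times that of \<open>ln\<close>, a discrete form of the derivative
      of \<open>x powr a / a\<close>.\<close>
    have "1 + (- (a * (ln (real (Suc n)) - ln (real n)))) \<le> exp (- (a * (ln (real (Suc n)) - ln (real n))))"
      by (rule exp_ge_add_one_self)
    also have "exp (- (a * (ln (real (Suc n)) - ln (real n)))) = w n / w (Suc n)"
      using Suc by (simp add: w_def powr_def exp_diff[symmetric] algebra_simps del: of_nat_Suc)
    finally have "w (Suc n) * (1 - a * (ln (real (Suc n)) - ln (real n))) \<le> w n"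
      using Suc by (simp add: w_def field_simps del: of_nat_Suc)
    then have "(w (Suc n) - w n) / a \<le> w (Suc n) * (ln (real (Suc n)) - ln (real n))"
      using a by (simp add: field_simps del: of_nat_Suc)
    moreover have "(C - e n) * (w (Suc n) - w n) \<ge> 0"
      using C(2)[of n] Suc a by (intro mult_nonneg_nonneg) (auto simp: e_def w_def intro!: powr_mono2)
    moreover have "S n \<ge> (w n - 1) / a + (e n - C) * w n"
      using Suc.IH by (simp add: S_def w_def e_def)
    ultimately have "S (Suc n) \<ge> (w (Suc n) - 1) / a + (e (Suc n) - C) * w (Suc n)"
      unfolding S e_def by (simp add: algebra_simps diff_divide_distrib)
    then show ?case by (simp add: S_def w_def e_def)
  qed
  show ?thesis
  proof (rule that[of "2 * C"])
    fix n :: nat and a :: real assume na: "n \<ge> 1" "a > 0"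
    have "(mertens n - ln (real n) - C) * real n powr a \<ge> (- 2 * C) * real n powr a"
      using C(2)[OF na(1)] by (intro mult_right_mono) auto
    then show "(\<Sum>p | prime p \<and> p \<le> n. ln (real p) * real p powr (a - 1)) \<ge>
         (real n powr a - 1) / a - 2 * C * real n powr a"
      using main[OF na] by simp
  qed (use C in auto)
qed

section \<open>Divisors of the resonator modulus\<close>

definition resonator :: "nat \<Rightarrow> nat \<Rightarrow> nat" where
  "resonator Y E = (\<Prod>p | prime p \<and> p \<le> Y. p ^ E)"

lemma resonator_pos: "resonator Y E > 0"
  unfolding resonator_def by (intro prod_pos) (auto dest: prime_gt_0_nat)

lemma resonator_factor:
  assumes "prime p" "p \<le> Y"
  obtains r where "resonator Y E = p ^ E * r" "\<not> p dvd r"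
proof (rule that)
  let ?P = "{q. prime q \<and> q \<le> Y}"
  show "resonator Y E = p ^ E * (\<Prod>q\<in>?P - {p}. q ^ E)"
    unfolding resonator_def using assms by (subst prod.remove[of _ p]) auto
  show "\<not> p dvd (\<Prod>q\<in>?P - {p}. q ^ E)"
  proof
    assume "p dvd (\<Prod>q\<in>?P - {p}. q ^ E)"
    then obtain q where q: "q \<in> ?P - {p}" "p dvd q ^ E"
      using assms by (subst (asm) prime_dvd_prod_iff) auto
    then have "p dvd q" using assms prime_dvd_power by blast
    then show False using primes_dvd_imp_eq[of p q] q assms by auto
  qed
qed

lemma resonator_le:
  assumes "Y \<ge> 1"
  shows "ln (real (resonator Y E)) \<le> real E * real Y * ln (real Y)"
proof -
  let ?P = "{p::nat. prime p \<and> p \<le> Y}"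
  have "?P \<subseteq> {1..Y}" by (auto simp: Suc_le_eq prime_gt_0_nat)
  then have card: "card ?P \<le> Y" using card_mono[of "{1..Y}" ?P] by simp
  have "ln (real (resonator Y E)) = (\<Sum>p\<in>?P. real E * ln (real p))"
    unfolding resonator_def
    by (subst of_nat_prod, subst ln_prod) (auto simp: prime_gt_0_nat ln_realpow intro!: sum.cong)
  also have "\<dots> \<le> (\<Sum>p\<in>?P. real E * ln (real Y))"
    by (intro sum_mono mult_left_mono) (auto simp: prime_gt_0_nat intro!: ln_mono)
  also have "\<dots> = real (card ?P) * (real E * ln (real Y))" by simp
  also have "\<dots> \<le> real Y * (real E * ln (real Y))"
    using card assms by (intro mult_right_mono) auto
  finally show ?thesis by (simp add: mult_ac)
qed

lemma card_divisors_le: "n > 0 \<Longrightarrow> card {m. m dvd n} \<le> (n::nat)"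
proof -
  assume "n > 0"
  then have "{m. m dvd n} \<subseteq> {1..n}" by (auto intro: dvd_imp_le dvd_pos_nat simp: Suc_le_eq)
  then show ?thesis using card_mono[of "{1..n}" "{m. m dvd n}"] by simp
qed

text \<open>
  The divisors \<open>m\<close> for which \<open>p m\<close> is no divisor are those divisible by the full power
  \<open>p ^ E\<close>; replacing that power by a smaller one gives \<open>E + 1\<close> divisors for each of them.
\<close>

lemma card_divisors_shift:
  fixes p r E :: nat
  assumes p: "prime p" and r: "\<not> p dvd r" "r > 0"
  defines "Q \<equiv> p ^ E * r"
  shows "real (card {m. p * m dvd Q}) \<ge> real E / real (E + 1) * real (card {m. m dvd Q})"
proof -
  let ?D = "{m. m dvd Q}" and ?T = "{k. k dvd r}"
  have Q: "Q > 0" using p r by (simp add: Q_def prime_gt_0_nat)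
  have fin: "finite ?D" "finite ?T" using Q r by auto
  have sub: "?D - {m. p * m dvd Q} \<subseteq> (\<lambda>k. p ^ E * k) ` ?T"
  proof
    fix m assume "m \<in> ?D - {m. p * m dvd Q}"
    then have m: "m dvd Q" "\<not> p * m dvd Q" by auto
    then have "m \<noteq> 0" using Q by auto
    define e where "e = multiplicity p m"
    obtain k where k: "m = p ^ e * k" "\<not> p dvd k"
      using multiplicity_decompose'[of m p] \<open>m \<noteq> 0\<close> p unfolding e_def
      by (metis not_prime_unit)
    have "coprime (p ^ E) k" "coprime (p ^ e) r"
      using prime_imp_coprime[OF p k(2)] prime_imp_coprime[OF p r(1)] by simp_all
    have "k dvd p ^ E * r" using m k by (metis Q_def dvd_mult_right)
    then have kr: "k dvd r" using \<open>coprime (p ^ E) k\<close>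
      by (metis coprime_commute coprime_dvd_mult_right_iff)
    have "p ^ e dvd p ^ E * r" using m k by (metis Q_def dvd_mult_left)
    then have "p ^ e dvd p ^ E" using \<open>coprime (p ^ e) r\<close>
      by (metis coprime_dvd_mult_left_iff)
    then have "e \<le> E" using p by (metis dvd_power_iff_le prime_ge_2_nat)
    moreover have "\<not> e < E"
    proof
      assume "e < E"
      then have "p ^ Suc e dvd p ^ E" by (intro le_imp_power_dvd) auto
      then have "p ^ Suc e * k dvd Q" unfolding Q_def using kr by (rule mult_dvd_mono)
      then show False using m k by (simp add: mult_ac)
    qed
    ultimately show "m \<in> (\<lambda>k. p ^ E * k) ` ?T" using k kr by auto
  qed
  have inj: "inj_on (\<lambda>(i, k). p ^ i * k) ({..E} \<times> ?T)"
  proof (rule inj_onI, clarify)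
    fix i k i' k' assume *: "k dvd r" "k' dvd r" "p ^ i * k = p ^ i' * k'"
    have nd: "\<not> p dvd k" "\<not> p dvd k'" using * r by (auto dest: dvd_trans)
    have "i = multiplicity p (p ^ i * k)" "i' = multiplicity p (p ^ i' * k')"
      using nd p by (auto simp: multiplicity_decomposeI)
    then have "i = i'" using * by simp
    then show "i = i' \<and> k = k'" using * p by auto
  qed
  have img: "(\<lambda>(i, k). p ^ i * k) ` ({..E} \<times> ?T) \<subseteq> ?D"
    unfolding Q_def by (auto intro!: mult_dvd_mono le_imp_power_dvd)
  have le: "(E + 1) * card ?T \<le> card ?D"
    using card_mono[OF fin(1) img] card_image[OF inj] by (simp add: card_cartesian_product)
  have "card (?D - {m. p * m dvd Q}) \<le> card ?T"
    by (rule order.trans[OF card_mono[OF _ sub] card_image_le]) (use fin in auto)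
  then have "card ?D - card {m. p * m dvd Q} \<le> card ?T"
    by (subst (asm) card_Diff_subset)
       (use fin in \<open>auto intro: finite_subset[of _ ?D] dest: dvd_mult_right\<close>)
  then have "card ?D \<le> card ?T + card {m. p * m dvd Q}" by simp
  then have "(E + 1) * card ?D \<le> (E + 1) * (card ?T + card {m. p * m dvd Q})"
    by (rule mult_le_mono2)
  then have "E * card ?D \<le> (E + 1) * card {m. p * m dvd Q}"
    using le by (simp add: algebra_simps)
  then have "real E * real (card ?D) \<le> real (E + 1) * real (card {m. p * m dvd Q})"
    by (metis of_nat_le_iff of_nat_mult)
  then show ?thesis by (simp add: field_simps)
qed

section \<open>Gaussian integrals and shifts of vertical lines\<close>

definition gaussian :: "real \<Rightarrow> real \<Rightarrow> real" where
  "gaussian X t = exp (- (t\<^sup>2 / (2 * X\<^sup>2)))"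

text \<open>The characteristic function of the standard normal distribution after the substitution
  \<open>t = X * x\<close>.\<close>

lemma gaussian_fourier:
  assumes X: "X > 0"
  shows "has_bochner_integral lborel (\<lambda>t. exp (\<i> * of_real (\<theta> * t)) * of_real (gaussian X t))
           (of_real (X * sqrt (2 * pi) * exp (- ((X * \<theta>)\<^sup>2 / 2))) :: complex)"
proof -
  have fin: "finite_measure std_normal_distribution"
    using prob_space_normal_density[of 1 0] by (simp add: prob_space.finite_measure)
  have int0: "integrable std_normal_distribution (\<lambda>x. iexp (X * \<theta> * x))"
    by (rule finite_measure.integrable_const_bound[OF fin, of _ 1]) auto
  have eq0: "(CLINT x|std_normal_distribution. iexp (X * \<theta> * x)) = of_real (exp (- ((X * \<theta>)\<^sup>2 / 2)))"
    using fun_cong[OF char_std_normal_distribution, of "X * \<theta>"] by (simp add: char_def)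
  have "has_bochner_integral std_normal_distribution (\<lambda>x. iexp (X * \<theta> * x)) (of_real (exp (- ((X * \<theta>)\<^sup>2 / 2))))"
    using int0 eq0 by (simp add: has_bochner_integral_iff)
  then have "has_bochner_integral lborel (\<lambda>x. std_normal_density x *\<^sub>R iexp (X * \<theta> * x)) (of_real (exp (- ((X * \<theta>)\<^sup>2 / 2))))"
    by (simp add: has_bochner_integral_iff integrable_density integral_density)
  then have "has_bochner_integral lborel (\<lambda>x. of_real (sqrt (2 * pi)) * (std_normal_density x *\<^sub>R iexp (X * \<theta> * x)))
      (of_real (sqrt (2 * pi)) * of_real (exp (- ((X * \<theta>)\<^sup>2 / 2))))"
    by (rule has_bochner_integral_mult_right)
  then have "has_bochner_integral lborel (\<lambda>x. exp (\<i> * of_real (\<theta> * (0 + X * x))) * of_real (gaussian X (0 + X * x)))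
      (of_real (sqrt (2 * pi)) * of_real (exp (- ((X * \<theta>)\<^sup>2 / 2))) :: complex)"
    using X by (simp add: std_normal_density_def gaussian_def scaleR_conv_of_real power_mult_distrib mult_ac)
  then show ?thesis
    using lborel_has_bochner_integral_real_affine_iff[of X
        "\<lambda>t. exp (\<i> * of_real (\<theta> * t)) * of_real (gaussian X t)" _ 0] X
    by (simp add: scaleR_conv_of_real field_simps)
qed

lemma gaussian_integral:
  assumes "X > 0"
  shows "has_bochner_integral lborel (gaussian X) (X * sqrt (2 * pi))"
proof -
  have "has_bochner_integral lborel (\<lambda>t. of_real (gaussian X t) :: complex) (of_real (X * sqrt (2 * pi)))"
    using gaussian_fourier[OF assms, of 0] by simp
  then show ?thesis
    using has_bochner_integral_Re[of lborel "\<lambda>t. of_real (gaussian X t) :: complex"] by fastforce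
qed

text \<open>The value is independent of \<open>a\<close>, as it should be for an entire integrand.
  Completing the square reduces the line to the Fourier transform above, at frequency
  \<open>\<theta>\<close>.\<close>

lemma gaussian_vertical_integral:
  assumes X: "X > 0"
  shows "has_bochner_integral lborel
     (\<lambda>t. exp (Complex a t * of_real c + (Complex a t)\<^sup>2 / (2 * of_real X ^ 2)))
     (of_real (X * sqrt (2 * pi) * exp (- ((X * c)\<^sup>2 / 2))) :: complex)"
proof -
  define \<theta> where "\<theta> = c + a / X\<^sup>2"
  define P where "P = c * a + a\<^sup>2 / (2 * X\<^sup>2)"
  define k where "k = exp P"
  have "has_bochner_integral lborel (\<lambda>t. of_real k * (exp (\<i> * of_real (\<theta> * t)) * of_real (gaussian X t)))
      (of_real k * of_real (X * sqrt (2 * pi) * exp (- ((X * \<theta>)\<^sup>2 / 2))) :: complex)"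
    by (rule has_bochner_integral_mult_right[OF gaussian_fourier[OF X]])
  moreover have "of_real k * (exp (\<i> * of_real (\<theta> * t)) * of_real (gaussian X t)) =
      exp (Complex a t * of_real c + (Complex a t)\<^sup>2 / (2 * of_real X ^ 2))" for t
  proof -
    have "of_real k * (exp (\<i> * of_real (\<theta> * t)) * of_real (gaussian X t)) =
        exp (of_real P + \<i> * of_real (\<theta> * t) + of_real (- (t\<^sup>2 / (2 * X\<^sup>2))))"
      by (simp only: k_def gaussian_def exp_of_real[symmetric] exp_add mult.assoc)
    also have "of_real P + \<i> * of_real (\<theta> * t) + of_real (- (t\<^sup>2 / (2 * X\<^sup>2))) =
        Complex a t * of_real c + (Complex a t)\<^sup>2 / (2 * of_real X ^ 2)"
    proof -
      have "(2 * of_real X ^ 2 :: complex) = of_real (2 * X\<^sup>2)" by simp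
      then show ?thesis using X
        by (simp add: complex_eq_iff P_def \<theta>_def power2_eq_square field_simps del: of_real_mult of_real_power)
    qed
    finally show ?thesis .
  qed
  moreover have "k * (X * sqrt (2 * pi) * exp (- ((X * \<theta>)\<^sup>2 / 2))) = X * sqrt (2 * pi) * exp (- ((X * c)\<^sup>2 / 2))"
  proof -
    have "c * a + a\<^sup>2 / (2 * X\<^sup>2) - (X * \<theta>)\<^sup>2 / 2 = - ((X * c)\<^sup>2 / 2)"
      using X by (simp add: \<theta>_def power2_eq_square field_simps)
    then have "k * exp (- ((X * \<theta>)\<^sup>2 / 2)) = exp (- ((X * c)\<^sup>2 / 2))"
      by (simp add: k_def P_def exp_add[symmetric])
    then show ?thesis by (metis mult.assoc mult.left_commute)
  qed
  ultimately show ?thesis by (simp only: of_real_mult[symmetric])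
qed

text \<open>A primitive \<open>F\<close> on the convex set \<open>S\<close> turns both truncated
  integrals into differences of values of \<open>F\<close>. The mean value inequality bounds their
  discrepancy, which comes from the two horizontal sides, by
  \<open>2 * (b - a) * B n\<close>.\<close>

lemma vertical_line_shift:
  fixes f :: "complex \<Rightarrow> complex"
  assumes hol: "f holomorphic_on S" and S: "open S" "convex S" and ab: "a \<le> b"
    and strip: "\<And>s. a \<le> Re s \<Longrightarrow> Re s \<le> b \<Longrightarrow> s \<in> S"
    and bound: "\<And>s. a \<le> Re s \<Longrightarrow> Re s \<le> b \<Longrightarrow> norm (f s) \<le> B \<bar>Im s\<bar>"
    and B: "(B \<longlongrightarrow> 0) at_top"
    and int: "integrable lborel (\<lambda>t. f (Complex a t))" "integrable lborel (\<lambda>t. f (Complex b t))"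
  shows "(LBINT t. f (Complex a t)) = (LBINT t. f (Complex b t))"
proof -
  obtain F where "\<And>z. z \<in> S \<Longrightarrow> (F has_field_derivative f z) (at z within S)"
    using holomorphic_convex_primitive'[OF S(2,1) hol] by blast
  then have F: "(F has_field_derivative f z) (at z)" if "z \<in> S" for z
    using that at_within_open[OF that S(1)] by metis
  define J where "J = (\<lambda>c n. LBINT t. indicator {- real n..real n} t *\<^sub>R f (Complex c t))"
  have FTC: "\<i> * J c n = F (Complex c (real n)) - F (Complex c (- real n))" if c: "a \<le> c" "c \<le> b" for c n
  proof -
    have inS: "Complex c t \<in> S" for t using strip[of "Complex c t"] c by simp
    have vd: "((\<lambda>t. Complex c t) has_vector_derivative \<i>) (at t within T)" for t T
      unfolding Complex_eq by (auto intro!: derivative_eq_intros)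
    have cont: "continuous_on T (\<lambda>t. f (Complex c t))" for T
      using holomorphic_on_imp_continuous_on[OF hol] inS
      by (intro continuous_on_compose2[of S f T "\<lambda>t. Complex c t"])
         (auto simp: Complex_eq intro!: continuous_intros)
    have "(LBINT t. indicator {- real n..real n} t *\<^sub>R (\<i> * f (Complex c t))) =
        F (Complex c (real n)) - F (Complex c (- real n))"
    proof (rule integral_FTC_Icc)
      fix t
      have "((F \<circ> (\<lambda>t. Complex c t)) has_vector_derivative \<i> * f (Complex c t)) (at t within {- real n..real n})"
        by (rule field_vector_diff_chain_within[OF vd])
           (use F[OF inS] in \<open>auto intro: has_field_derivative_at_within\<close>)
      then show "((\<lambda>t. F (Complex c t)) has_vector_derivative \<i> * f (Complex c t)) (at t within {- real n..real n})"
        by (simp add: o_def)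
    qed (auto intro!: continuous_intros cont)
    then show ?thesis by (simp add: J_def mult.left_commute flip: integral_mult_right_zero)
  qed
  have lim: "(\<lambda>n. J c n) \<longlonglongrightarrow> (LBINT t. f (Complex c t))"
    if c: "integrable lborel (\<lambda>t. f (Complex c t))" for c
    unfolding J_def
  proof (rule integral_dominated_convergence[where w = "\<lambda>t. norm (f (Complex c t))"])
    show "AE t in lborel. (\<lambda>n. indicator {- real n..real n} t *\<^sub>R f (Complex c t)) \<longlonglongrightarrow> f (Complex c t)"
    proof (intro AE_I2 tendsto_eventually)
      fix t :: real
      obtain N :: nat where "\<bar>t\<bar> \<le> real N" using real_arch_simple by blast
      then show "\<forall>\<^sub>F n in sequentially. indicator {- real n..real n} t *\<^sub>R f (Complex c t) = f (Complex c t)"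
        by (intro eventually_mono[OF eventually_ge_at_top[of N]]) (auto simp: indicator_def)
    qed
  qed (use c in \<open>auto simp: indicator_def\<close>)
  have side: "norm (F (Complex b v) - F (Complex a v)) \<le> B \<bar>v\<bar> * (b - a)" for v
  proof -
    have seg: "a \<le> Re z \<and> Re z \<le> b \<and> Im z = v" if z: "z \<in> closed_segment (Complex a v) (Complex b v)" for z
    proof -
      obtain u where u: "0 \<le> u" "u \<le> 1" "z = (1 - u) *\<^sub>R Complex a v + u *\<^sub>R Complex b v"
        using z unfolding in_segment by blast
      have "Re z = a + u * (b - a)" "Im z = v" unfolding u(3) by (simp_all add: algebra_simps)
      moreover have "0 \<le> u * (b - a)" "u * (b - a) \<le> b - a"
        using u ab by (auto intro: mult_left_le_one_le)
      ultimately show ?thesis by simp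
    qed
    have "norm (F (Complex b v) - F (Complex a v)) \<le> B \<bar>v\<bar> * norm (Complex b v - Complex a v)"
    proof (rule field_differentiable_bound[of "closed_segment (Complex a v) (Complex b v)"])
      fix z assume "z \<in> closed_segment (Complex a v) (Complex b v)"
      note z = seg[OF this]
      show "(F has_field_derivative f z) (at z within closed_segment (Complex a v) (Complex b v))"
        using F strip z by (auto intro: has_field_derivative_at_within)
      show "norm (f z) \<le> B \<bar>v\<bar>" using bound[of z] z by simp
    qed auto
    also have "norm (Complex b v - Complex a v) = b - a" using ab by (simp add: cmod_def)
    finally show ?thesis .
  qed
  have "norm (J b n - J a n) \<le> 2 * (b - a) * B (real n)" for n
  proof -
    have "norm (J b n - J a n) = norm (\<i> * J b n - \<i> * J a n)"
      by (simp flip: right_diff_distrib add: norm_mult)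
    also have "\<dots> = norm ((F (Complex b (real n)) - F (Complex a (real n)))
        - (F (Complex b (- real n)) - F (Complex a (- real n))))"
      unfolding FTC[of a n, OF order_refl ab] FTC[of b n, OF ab order_refl] by (simp add: algebra_simps)
    also have "\<dots> \<le> B \<bar>real n\<bar> * (b - a) + B \<bar>- real n\<bar> * (b - a)"
      by (rule order.trans[OF norm_triangle_ineq4 add_mono[OF side side]])
    finally show ?thesis by (simp add: algebra_simps)
  qed
  moreover have "(\<lambda>n. 2 * (b - a) * B (real n)) \<longlonglongrightarrow> 2 * (b - a) * 0"
    by (intro tendsto_intros filterlim_compose[OF B filterlim_real_sequentially])
  ultimately have "(\<lambda>n. J b n - J a n) \<longlonglongrightarrow> 0"
    by (intro Lim_null_comparison[of "\<lambda>n. J b n - J a n"]) (auto intro: always_eventually)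
  moreover have "(\<lambda>n. J b n - J a n) \<longlonglongrightarrow> (LBINT t. f (Complex b t)) - (LBINT t. f (Complex a t))"
    by (intro tendsto_diff lim int)
  ultimately show ?thesis using LIMSEQ_unique by fastforce
qed

section \<open>The resonator\<close>

text \<open>
  On the imaginary axis this is \<open>\<bar>\<Sum>m\<in>D. m powr (\<i> * t)\<bar>\<^sup>2\<close> times a Gaussian weight; as an entire
  function of \<open>w\<close> it can be moved to other vertical lines.
\<close>

definition res_kernel :: "nat set \<Rightarrow> real \<Rightarrow> complex \<Rightarrow> complex" where
  "res_kernel D X w = (\<Sum>m\<in>D. \<Sum>n\<in>D. exp (w * of_real (ln (real m) - ln (real n)) + w\<^sup>2 / (2 * of_real X ^ 2)))"

definition res_weight :: "nat set \<Rightarrow> real \<Rightarrow> real \<Rightarrow> real" where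
  "res_weight D X t = (norm (\<Sum>m\<in>D. exp (\<i> * of_real (t * ln (real m)))))\<^sup>2 * gaussian X t"

lemma res_kernel_holomorphic: "X \<noteq> 0 \<Longrightarrow> res_kernel D X holomorphic_on S"
  unfolding res_kernel_def by (intro holomorphic_intros) auto

lemma gaussian_nonneg [simp]: "gaussian X t \<ge> 0" by (simp add: gaussian_def)

lemma res_weight_nonneg [simp]: "res_weight D X t \<ge> 0" by (simp add: res_weight_def)

lemma res_weight_le: "res_weight D X t \<le> (real (card D))\<^sup>2 * gaussian X t"
proof -
  have "norm (\<Sum>m\<in>D. exp (\<i> * of_real (t * ln (real m)))) \<le> (\<Sum>m\<in>D. norm (exp (\<i> * of_real (t * ln (real m)))))"
    by (rule norm_sum)
  also have "\<dots> = real (card D)" by simp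
  finally show ?thesis
    unfolding res_weight_def by (intro mult_right_mono power_mono) auto
qed

lemma res_kernel_imag: "res_kernel D X (Complex 0 t) = of_real (res_weight D X t)"
proof -
  let ?e = "\<lambda>m. exp (\<i> * of_real (t * ln (real m)))"
  have "of_real (res_weight D X t) = (\<Sum>m\<in>D. ?e m) * cnj (\<Sum>n\<in>D. ?e n) * of_real (gaussian X t)"
    by (simp only: res_weight_def of_real_mult complex_norm_square)
  also have "\<dots> = (\<Sum>m\<in>D. \<Sum>n\<in>D. ?e m * cnj (?e n) * of_real (gaussian X t))"
    by (subst cnj_sum, subst sum_product) (simp only: sum_distrib_right)
  also have "\<dots> = res_kernel D X (Complex 0 t)"
    unfolding res_kernel_def
  proof (intro sum.cong refl)
    fix m n
    have "?e m * cnj (?e n) * of_real (gaussian X t) =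
      exp (\<i> * of_real (t * ln (real m)) + - (\<i> * of_real (t * ln (real n))) + of_real (- (t\<^sup>2 / (2 * X\<^sup>2))))"
      unfolding exp_add gaussian_def exp_of_real exp_cnj[symmetric] by (simp add: exp_cnj)
    also have "\<i> * of_real (t * ln (real m)) + - (\<i> * of_real (t * ln (real n))) + of_real (- (t\<^sup>2 / (2 * X\<^sup>2))) =
      Complex 0 t * of_real (ln (real m) - ln (real n)) + (Complex 0 t)\<^sup>2 / (2 * of_real X ^ 2)"
      by (simp add: Complex_eq algebra_simps)
    finally show "?e m * cnj (?e n) * of_real (gaussian X t) =
      exp (Complex 0 t * of_real (ln (real m) - ln (real n)) + (Complex 0 t)\<^sup>2 / (2 * of_real X ^ 2))" .
  qed
  finally show ?thesis by simp
qed

text \<open>For \<open>c = ln k\<close> the exponential is \<open>k powr (- w)\<close>, a single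
  term of a Dirichlet series. The value is nonnegative, which later allows discarding terms.\<close>

lemma res_kernel_twisted_integral:
  assumes X: "X > 0"
  shows "has_bochner_integral lborel (\<lambda>t. exp (- (Complex a t * of_real c)) * res_kernel D X (Complex a t))
    (of_real (X * sqrt (2 * pi) * (\<Sum>m\<in>D. \<Sum>n\<in>D. exp (- ((X * (ln (real m) - ln (real n) - c))\<^sup>2 / 2)))))"
proof -
  have "has_bochner_integral lborel
     (\<lambda>t. \<Sum>m\<in>D. \<Sum>n\<in>D. exp (Complex a t * of_real (ln (real m) - ln (real n) - c) + (Complex a t)\<^sup>2 / (2 * of_real X ^ 2)))
     (\<Sum>m\<in>D. \<Sum>n\<in>D. of_real (X * sqrt (2 * pi) * exp (- ((X * (ln (real m) - ln (real n) - c))\<^sup>2 / 2))))"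
    by (intro has_bochner_integral_sum gaussian_vertical_integral X)
  then show ?thesis
    by (simp add: res_kernel_def sum_distrib_left exp_add[symmetric] algebra_simps)
qed

lemma res_weight_integral:
  assumes X: "X > 0"
  shows "has_bochner_integral lborel (res_weight D X)
    (X * sqrt (2 * pi) * (\<Sum>m\<in>D. \<Sum>n\<in>D. exp (- ((X * (ln (real m) - ln (real n)))\<^sup>2 / 2))))"
  using has_bochner_integral_Re[OF res_kernel_twisted_integral[OF X, of 0 0 D]]
  by (simp add: res_kernel_imag)

text \<open>From \<open>ln y \<le> y - 1\<close> at \<open>y = a / b\<close>. The gap makes distinct
  divisors almost orthogonal under a Gaussian much wider than \<open>Q\<close>.\<close>

lemma ln_ratio_separated:
  fixes m n Q :: nat
  assumes "0 < m" "m \<le> Q" "0 < n" "n \<le> Q" "m \<noteq> n"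
  shows "\<bar>ln (real m) - ln (real n)\<bar> \<ge> 1 / real Q"
proof -
  have *: "ln (real b) - ln (real a) \<ge> 1 / real Q" if ab: "0 < a" "a < b" "b \<le> Q" for a b :: nat
  proof -
    have "ln (real a / real b) \<le> real a / real b - 1" using ab by (intro ln_le_minus_one) auto
    moreover have "1 / real b \<le> (real b - real a) / real b"
      using ab by (intro divide_right_mono) auto
    moreover have "(real b - real a) / real b = 1 - real a / real b"
      using ab by (simp add: diff_divide_distrib)
    moreover have "1 / real Q \<le> 1 / real b" using ab by (intro divide_left_mono) auto
    moreover have "ln (real a / real b) = ln (real a) - ln (real b)" using ab by (simp add: ln_div)
    ultimately show ?thesis by linarith
  qed
  show ?thesis
    using *[of m n] *[of n m] assms by (cases "m < n") (auto simp: abs_if)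
qed

text \<open>Diagonal pairs contribute \<open>card D\<close>; all others are suppressed by the gap
  \<open>1 / Q\<close>.\<close>

lemma res_weight_integral_le:
  assumes X: "X > 0" and D: "D \<subseteq> {1..Q}"
  shows "(LBINT t. res_weight D X t) \<le>
    X * sqrt (2 * pi) * (real (card D) + (real (card D))\<^sup>2 * exp (- ((X / real Q)\<^sup>2 / 2)))"
proof -
  have fin: "finite D" using D finite_subset by blast
  have "(\<Sum>m\<in>D. \<Sum>n\<in>D. exp (- ((X * (ln (real m) - ln (real n)))\<^sup>2 / 2))) \<le>
      (\<Sum>m\<in>D. \<Sum>n\<in>D. (if n = m then 1 else 0) + exp (- ((X / real Q)\<^sup>2 / 2)))"
  proof (intro sum_mono)
    fix m n assume mn: "m \<in> D" "n \<in> D"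
    show "exp (- ((X * (ln (real m) - ln (real n)))\<^sup>2 / 2)) \<le> (if n = m then 1 else 0) + exp (- ((X / real Q)\<^sup>2 / 2))"
    proof (cases "n = m")
      case False
      have "1 / real Q \<le> \<bar>ln (real m) - ln (real n)\<bar>"
        using mn D False by (intro ln_ratio_separated) auto
      then have "X * (1 / real Q) \<le> X * \<bar>ln (real m) - ln (real n)\<bar>"
        using X by (intro mult_left_mono) auto
      then have "(X / real Q)\<^sup>2 \<le> (X * \<bar>ln (real m) - ln (real n)\<bar>)\<^sup>2"
        using X by (intro power_mono) auto
      then show ?thesis using False by (simp add: power_mult_distrib)
    qed simp
  qed
  also have "\<dots> = real (card D) + (real (card D))\<^sup>2 * exp (- ((X / real Q)\<^sup>2 / 2))"
    using fin by (simp add: sum.distrib power2_eq_square algebra_simps)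
  finally show ?thesis
    using res_weight_integral[OF X, of D] X by (auto simp: has_bochner_integral_iff intro!: mult_left_mono)
qed

text \<open>On \<open>Re w = a\<close> a pair contributes \<open>(m / n) powr a\<close>, at most
  \<open>Q\<^sup>2\<close>, and the square of \<open>a\<close> in the exponent at most
  \<open>exp 2\<close>. These losses enter the pole term and the decay bounds, not the main
  term.\<close>

lemma res_kernel_norm_le:
  assumes X: "X \<ge> 1" and D: "D \<subseteq> {1..Q}" and a: "0 \<le> a" "a \<le> 2"
  shows "norm (res_kernel D X (Complex a t)) \<le> (real (card D))\<^sup>2 * (exp 2 * (real Q)\<^sup>2) * gaussian X t"
proof -
  have "norm (res_kernel D X (Complex a t)) \<le>
      (\<Sum>m\<in>D. \<Sum>n\<in>D. norm (exp (Complex a t * of_real (ln (real m) - ln (real n)) + (Complex a t)\<^sup>2 / (2 * of_real X ^ 2))))"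
    unfolding res_kernel_def by (intro sum_norm_le norm_sum)
  also have "\<dots> \<le> (\<Sum>m\<in>D. \<Sum>n\<in>D. exp 2 * (real Q)\<^sup>2 * gaussian X t)"
  proof (intro sum_mono)
    fix m n assume mn: "m \<in> D" "n \<in> D"
    then have mn': "1 \<le> m" "m \<le> Q" "1 \<le> n" using D by auto
    have re: "Re (Complex a t * of_real (ln (real m) - ln (real n)) + (Complex a t)\<^sup>2 / (2 * of_real X ^ 2)) =
        a * (ln (real m) - ln (real n)) + (a\<^sup>2 / (2 * X\<^sup>2) - t\<^sup>2 / (2 * X\<^sup>2))"
    proof -
      have "(2 * of_real X ^ 2 :: complex) = of_real (2 * X\<^sup>2)" by simp
      then show ?thesis
        by (simp add: power2_eq_square diff_divide_distrib del: of_real_mult of_real_power)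
    qed
    have "a * (ln (real m) - ln (real n)) \<le> 2 * ln (real Q)"
    proof -
      have "ln (real m) - ln (real n) \<le> ln (real Q)" "0 \<le> ln (real Q)"
        using mn' by (auto intro: ln_mono order.trans[of _ "ln (real m)"] simp: le_diff_eq add_increasing2)
      then have "a * (ln (real m) - ln (real n)) \<le> a * ln (real Q)" "a * ln (real Q) \<le> 2 * ln (real Q)"
        using a by (auto intro: mult_left_mono mult_right_mono)
      then show ?thesis by linarith
    qed
    moreover have "a\<^sup>2 / (2 * X\<^sup>2) \<le> 2"
    proof -
      have "a\<^sup>2 / (2 * X\<^sup>2) \<le> 2\<^sup>2 / (2 * 1\<^sup>2)"
        using a X by (intro frac_le mult_left_mono power_mono) auto
      then show ?thesis by simp
    qed
    ultimately have "norm (exp (Complex a t * of_real (ln (real m) - ln (real n)) + (Complex a t)\<^sup>2 / (2 * of_real X ^ 2)))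
        \<le> exp (2 * ln (real Q) + (2 - t\<^sup>2 / (2 * X\<^sup>2)))"
      unfolding norm_exp_eq_Re re by simp
    also have "\<dots> = exp 2 * (real Q)\<^sup>2 * gaussian X t"
    proof -
      have eq: "(real Q)\<^sup>2 = exp (2 * ln (real Q))" using mn' by (simp add: exp_double)
      show ?thesis unfolding eq gaussian_def exp_add[symmetric] by (simp add: algebra_simps)
    qed
    finally show "norm (exp (Complex a t * of_real (ln (real m) - ln (real n)) + (Complex a t)\<^sup>2 / (2 * of_real X ^ 2)))
        \<le> exp 2 * (real Q)\<^sup>2 * gaussian X t" .
  qed
  also have "\<dots> = (real (card D))\<^sup>2 * (exp 2 * (real Q)\<^sup>2) * gaussian X t"
    by (simp only: sum_constant power2_eq_square mult.assoc)
  finally show ?thesis .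
qed

section \<open>The twisted first moment\<close>

text \<open>Half of the Gaussian exponent is given up to absorb the linear factor:
  \<open>\<bar>t\<bar> \<le> X\<^sup>2 + u\<close> with
  \<open>u = t\<^sup>2 / (4 * X\<^sup>2)\<close>, and \<open>1 + u \<le> exp u\<close>.\<close>

lemma gaussian_absorb_linear:
  assumes X: "X > 0"
  shows "(\<bar>t\<bar> + 4) * gaussian X t \<le> (X\<^sup>2 + 4) * gaussian (sqrt 2 * X) t"
proof -
  define u where "u = t\<^sup>2 / (4 * X\<^sup>2)"
  have u: "u \<ge> 0" by (simp add: u_def)
  have "0 \<le> (\<bar>t\<bar> / (2 * X) - X)\<^sup>2" by simp
  also have "\<dots> = u - \<bar>t\<bar> + X\<^sup>2"
    using X by (simp add: u_def power2_diff power_divide power_mult_distrib)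
  finally have "\<bar>t\<bar> + 4 \<le> (X\<^sup>2 + 4) + u" by simp
  also have "\<dots> \<le> (X\<^sup>2 + 4) * (1 + u)"
    using u mult_right_mono[of 1 "X\<^sup>2 + 4" u] by (simp add: algebra_simps)
  also have "\<dots> \<le> (X\<^sup>2 + 4) * exp u" by (intro mult_left_mono exp_ge_add_one_self) auto
  finally have "(\<bar>t\<bar> + 4) * gaussian X t \<le> (X\<^sup>2 + 4) * exp u * gaussian X t"
    by (rule mult_right_mono) simp
  also have "\<dots> = (X\<^sup>2 + 4) * (exp u * gaussian X t)" by simp
  also have "exp u * gaussian X t = gaussian (sqrt 2 * X) t"
  proof -
    have "u + - (t\<^sup>2 / (2 * X\<^sup>2)) = - (t\<^sup>2 / (2 * (sqrt 2 * X)\<^sup>2))"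
      using X by (simp add: u_def power_mult_distrib field_simps)
    then show ?thesis unfolding gaussian_def exp_add[symmetric] by simp
  qed
  finally show ?thesis .
qed

lemma gaussian_tendsto_0: "X > 0 \<Longrightarrow> (gaussian X \<longlongrightarrow> 0) at_top"
  unfolding gaussian_def[abs_def] by real_asymp

text \<open>Split at \<open>\<bar>t\<bar> = sqrt X\<close>: inside, the integrand is at most 1;
  outside, the pole factor is at most \<open>1 / sqrt X\<close>. This saves a factor of order
  \<open>sqrt X\<close> over the full mass of the Gaussian.\<close>

lemma gaussian_pole_integral:
  assumes X: "X \<ge> 1"
  shows "integrable lborel (\<lambda>t. norm (1 / Complex 1 t) * gaussian X t)"
    and "(LBINT t. norm (1 / Complex 1 t) * gaussian X t) \<le> 5 * sqrt X"
proof -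
  let ?g = "\<lambda>t. indicator {- sqrt X..sqrt X} t + gaussian X t / sqrt X"
  have gint: "has_bochner_integral lborel (gaussian X) (X * sqrt (2 * pi))"
    by (rule gaussian_integral) (use X in simp)
  have "has_bochner_integral lborel (indicator {- sqrt X..sqrt X}) (measure lborel {- sqrt X..sqrt X})"
    by (rule has_bochner_integral_real_indicator) (auto simp: emeasure_lborel_Icc_eq)
  moreover have "measure lborel {- sqrt X..sqrt X} = 2 * sqrt X" using X by simp
  ultimately have g: "has_bochner_integral lborel ?g (2 * sqrt X + X * sqrt (2 * pi) / sqrt X)"
    by (intro has_bochner_integral_add has_bochner_integral_divide gint) auto
  have le: "norm (1 / Complex 1 t) * gaussian X t \<le> ?g t" for t
  proof -
    have n1: "norm (Complex 1 t) \<ge> 1" using complex_Re_le_cmod[of "Complex 1 t"] by simp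
    have n2: "norm (Complex 1 t) \<ge> \<bar>t\<bar>" using abs_Im_le_cmod[of "Complex 1 t"] by simp
    have g1: "gaussian X t \<le> 1" by (simp add: gaussian_def)
    show ?thesis
    proof (cases "\<bar>t\<bar> \<le> sqrt X")
      case True
      have "norm (1 / Complex 1 t) * gaussian X t \<le> 1 * 1"
        using n1 g1 by (intro mult_mono) (auto simp: norm_divide divide_le_eq)
      also have "\<dots> \<le> ?g t" using True X by (auto simp: indicator_def)
      finally show ?thesis .
    next
      case False
      have n1': "0 < norm (Complex 1 t) * sqrt X"
        using n1 X by (intro mult_pos_pos real_sqrt_gt_zero) linarith+
      have "norm (1 / Complex 1 t) \<le> 1 / sqrt X"
        unfolding norm_divide norm_one using n2 False n1' X by (intro divide_left_mono) auto
      then have "norm (1 / Complex 1 t) * gaussian X t \<le> 1 / sqrt X * gaussian X t"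
        by (rule mult_right_mono) simp
      also have "\<dots> \<le> ?g t" by simp
      finally show ?thesis .
    qed
  qed
  have meas: "(\<lambda>t. norm (1 / Complex 1 t) * gaussian X t) \<in> borel_measurable lborel"
  proof -
    have "continuous_on UNIV (\<lambda>t. norm (1 / Complex 1 t) * gaussian X t)"
      unfolding Complex_eq gaussian_def using X
      by (intro continuous_intros) (auto simp: complex_eq_iff)
    then show ?thesis by (simp add: borel_measurable_continuous_onI)
  qed
  show int: "integrable lborel (\<lambda>t. norm (1 / Complex 1 t) * gaussian X t)"
  proof (rule Bochner_Integration.integrable_bound)
    show "integrable lborel ?g" using g by (simp add: has_bochner_integral_iff)
    have "norm (norm (1 / Complex 1 t) * gaussian X t) \<le> norm (?g t)" for t
    proof -
      have "norm (norm (1 / Complex 1 t) * gaussian X t) = norm (1 / Complex 1 t) * gaussian X t" by simp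
      also have "\<dots> \<le> norm (?g t)" using le[of t] by (metis order.trans real_norm_def abs_ge_self)
      finally show ?thesis .
    qed
    then show "AE t in lborel. norm (norm (1 / Complex 1 t) * gaussian X t) \<le> norm (?g t)" by simp
  qed (rule meas)
  have "(LBINT t. norm (1 / Complex 1 t) * gaussian X t) \<le> (LBINT t. ?g t)"
    using g by (intro integral_mono int le) (simp add: has_bochner_integral_iff)
  also have "\<dots> = 2 * sqrt X + X * sqrt (2 * pi) / sqrt X" using g by (simp add: has_bochner_integral_iff)
  also have "X * sqrt (2 * pi) / sqrt X = sqrt X * sqrt (2 * pi)"
    using X by (simp add: field_simps)
  also have "sqrt X * sqrt (2 * pi) \<le> sqrt X * 3"
  proof (intro mult_left_mono)
    have "2 * pi \<le> 3\<^sup>2" using pi_approx by simp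
    then show "sqrt (2 * pi) \<le> 3" by (intro real_le_lsqrt) auto
  qed (use X in auto)
  finally show "(LBINT t. norm (1 / Complex 1 t) * gaussian X t) \<le> 5 * sqrt X" by simp
qed

lemma reg_log_deriv_holomorphic:
  assumes riemann_hypothesis
  shows "reg_log_deriv holomorphic_on {s. Re s > 1 / 2}"
proof -
  have "reg_zeta holomorphic_on {s. Re s > 1 / 2}"
    by (rule holomorphic_on_subset[OF reg_zeta_holomorphic]) auto
  then have "(\<lambda>s. - (deriv reg_zeta s / reg_zeta s)) holomorphic_on {s. Re s > 1 / 2}"
    using reg_zeta_nonzero[OF assms] by (intro holomorphic_intros holomorphic_deriv open_halfspace_Re_gt) auto
  then show ?thesis by (simp add: reg_log_deriv_def[abs_def])
qed

lemma continuous_on_Complex [continuous_intros]: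
  assumes "continuous_on T f" "continuous_on T g"
  shows "continuous_on T (\<lambda>t. Complex (f t) (g t))"
  unfolding Complex_eq by (intro continuous_intros assms)

lemma res_kernel_measurable: "X > 0 \<Longrightarrow> (\<lambda>t. res_kernel D X (Complex a t)) \<in> borel_measurable borel"
  unfolding res_kernel_def by (intro borel_measurable_continuous_onI continuous_intros) auto

text \<open>On \<open>Re s = 2\<close> the series converges absolutely and may be integrated term by
  term. With \<open>w = s - \<sigma>\<close>, \<open>k powr (- s)\<close> splits into
  \<open>k powr (- \<sigma>)\<close> and \<open>k powr (- w)\<close>: hence the coefficients belong
  to \<open>\<sigma>\<close> although the integral is taken on \<open>Re s = 2\<close>.\<close>

lemma dseries_mangoldt_res_integral:
  assumes X: "X > 0"
  shows "integrable lborel (\<lambda>t. dseries mangoldt (Complex 2 t) * res_kernel D X (Complex (2 - \<sigma>) t))"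
    and "(\<lambda>k. mangoldt k * real k powr (- \<sigma>) * (X * sqrt (2 * pi) *
            (\<Sum>m\<in>D. \<Sum>n\<in>D. exp (- ((X * (ln (real m) - ln (real n) - ln (real k)))\<^sup>2 / 2)))))
      sums Re (LBINT t. dseries mangoldt (Complex 2 t) * res_kernel D X (Complex (2 - \<sigma>) t))"
proof -
  define R where "R = (\<lambda>t. res_kernel D X (Complex (2 - \<sigma>) t))"
  define f where "f = (\<lambda>k t. mangoldt k * of_nat k powr (- Complex 2 t) * R t)"
  define I where "I = (\<lambda>k. mangoldt k * real k powr (- \<sigma>) * (X * sqrt (2 * pi) *
            (\<Sum>m\<in>D. \<Sum>n\<in>D. exp (- ((X * (ln (real m) - ln (real n) - ln (real k)))\<^sup>2 / 2)))))"
  have hb: "has_bochner_integral lborel (f k) (of_real (I k))" for k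
  proof (cases "k = 0")
    case False
    have "f k t = of_real (mangoldt k * real k powr (- \<sigma>)) *
        (exp (- (Complex (2 - \<sigma>) t * of_real (ln (real k)))) * R t)" for t
    proof -
      have "of_nat k powr (- Complex 2 t) = exp (- Complex 2 t * of_real (ln (real k)))"
        using False by (simp add: powr_def Ln_of_nat)
      also have "- Complex 2 t * of_real (ln (real k)) =
          of_real (- \<sigma> * ln (real k)) + - (Complex (2 - \<sigma>) t * of_real (ln (real k)))"
        by (simp add: complex_eq_iff algebra_simps)
      also have "exp \<dots> = of_real (real k powr (- \<sigma>)) * exp (- (Complex (2 - \<sigma>) t * of_real (ln (real k))))"
        unfolding exp_add exp_of_real using False by (simp add: powr_def)
      finally show ?thesis by (simp add: f_def mult_ac)
    qed
    then have feq: "f k = (\<lambda>t. of_real (mangoldt k * real k powr (- \<sigma>)) *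
        (exp (- (Complex (2 - \<sigma>) t * of_real (ln (real k)))) * R t))" by blast
    have "has_bochner_integral lborel (f k) (of_real (mangoldt k * real k powr (- \<sigma>)) *
        of_real (X * sqrt (2 * pi) * (\<Sum>m\<in>D. \<Sum>n\<in>D. exp (- ((X * (ln (real m) - ln (real n) - ln (real k)))\<^sup>2 / 2)))))"
      unfolding feq R_def using X
      by (intro has_bochner_integral_mult_right res_kernel_twisted_integral) auto
    then show ?thesis unfolding I_def of_real_mult[symmetric] .
  qed (simp add: f_def I_def has_bochner_integral_zero)
  have fnorm: "norm (f k t) = mangoldt k * real k powr (- 2) * norm (R t)" for k t
    by (simp add: f_def norm_mult norm_nat_powr')
  have sm: "summable (\<lambda>k. mangoldt k * real k powr (- 2))"
    using dseries_abs_summable[OF log_bounded_mangoldt, of 2] by (simp add: norm_mult norm_nat_powr')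
  have suminf: "(\<Sum>k. f k t) = dseries mangoldt (Complex 2 t) * R t" for t
    using sums_mult2[OF dseries_sums[OF log_bounded_mangoldt, of "Complex 2 t"], of "R t"]
    by (simp add: f_def sums_iff)
  have prem: "\<And>k. integrable lborel (f k)" "AE t in lborel. summable (\<lambda>k. norm (f k t))"
    "summable (\<lambda>k. LBINT t. norm (f k t))"
    using hb sm by (auto simp: fnorm has_bochner_integral_iff intro!: summable_mult2)
  show "integrable lborel (\<lambda>t. dseries mangoldt (Complex 2 t) * res_kernel D X (Complex (2 - \<sigma>) t))"
    using integrable_suminf[OF prem] unfolding suminf R_def .
  have "(\<lambda>k. of_real (I k)) sums (LBINT t. dseries mangoldt (Complex 2 t) * R t)"
    using sums_integral[OF prem] hb unfolding suminf by (simp add: has_bochner_integral_iff)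
  from sums_Re[OF this] show "(\<lambda>k. mangoldt k * real k powr (- \<sigma>) * (X * sqrt (2 * pi) *
            (\<Sum>m\<in>D. \<Sum>n\<in>D. exp (- ((X * (ln (real m) - ln (real n) - ln (real k)))\<^sup>2 / 2)))))
      sums Re (LBINT t. dseries mangoldt (Complex 2 t) * res_kernel D X (Complex (2 - \<sigma>) t))"
    unfolding I_def R_def by simp
qed

text \<open>Only the pairs with \<open>m = p * n\<close> are kept; their exponent vanishes, and each
  counts 1.\<close>

lemma card_shift_le_gaussian_sum:
  assumes D: "finite D" "\<And>n. n \<in> D \<Longrightarrow> n > 0" and p: "p > 0"
  shows "real (card {n \<in> D. p * n \<in> D}) \<le>
    (\<Sum>m\<in>D. \<Sum>n\<in>D. exp (- ((X * (ln (real m) - ln (real n) - ln (real p)))\<^sup>2 / 2)))"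
proof -
  have "real (card {n \<in> D. p * n \<in> D}) = (\<Sum>n\<in>D. if p * n \<in> D then 1 else 0)"
    using D by (simp add: sum.inter_filter[symmetric])
  also have "\<dots> = (\<Sum>n\<in>D. \<Sum>m\<in>D. if m = p * n then 1 else 0)"
    using D by (intro sum.cong) (auto simp: sum.delta)
  also have "\<dots> = (\<Sum>m\<in>D. \<Sum>n\<in>D. if m = p * n then 1 else 0)" by (rule sum.swap)
  also have "\<dots> \<le> (\<Sum>m\<in>D. \<Sum>n\<in>D. exp (- ((X * (ln (real m) - ln (real n) - ln (real p)))\<^sup>2 / 2)))"
    using D p by (intro sum_mono) (auto simp: ln_mult)
  finally show ?thesis .
qed

text \<open>Lower bound for the moment. Removing the pole before the line is moved spares a residue
  at 1; the removed part returns on \<open>Re s = 2\<close> as the error with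
  \<open>sqrt X\<close>.\<close>

lemma reg_log_deriv_res_integral:
  fixes D :: "nat set"
  assumes RH: riemann_hypothesis and C: "C > 0"
    "\<And>s. 3 / 4 \<le> Re s \<Longrightarrow> Re s \<le> 2 \<Longrightarrow> norm (reg_log_deriv s) \<le> C * ln (\<bar>Im s\<bar> + 4)"
    and \<sigma>: "3 / 4 \<le> \<sigma>" "\<sigma> \<le> 2" and X: "X \<ge> 1" and D: "D \<subseteq> {1..Q}"
  shows "integrable lborel (\<lambda>t. reg_log_deriv (Complex \<sigma> t) * of_real (res_weight D X t))"
    and "Re (LBINT t. reg_log_deriv (Complex \<sigma> t) * of_real (res_weight D X t)) \<ge>
      X * sqrt (2 * pi) * (\<Sum>p | prime p \<and> p \<le> Y. ln (real p) * real p powr (- \<sigma>) * real (card {n \<in> D. p * n \<in> D}))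
      - 5 * exp 2 * (real (card D))\<^sup>2 * (real Q)\<^sup>2 * sqrt X"
proof -
  define f where "f = (\<lambda>s. reg_log_deriv s * res_kernel D X (s - of_real \<sigma>))"
  define K where "K = (real (card D))\<^sup>2 * (exp 2 * (real Q)\<^sup>2)"
  \<comment> \<open>One majorant for the whole strip gives both the decay of the horizontal sides
    and integrability on the vertical lines.\<close>
  define B where "B = (\<lambda>t. C * K * (X\<^sup>2 + 4) * gaussian (sqrt 2 * X) t)"
  have X0: "X > 0" using X by simp
  have K: "K \<ge> 0" by (simp add: K_def)
  have finD: "finite D" using D finite_subset by blast
  have sub: "Complex c t - of_real \<sigma> = Complex (c - \<sigma>) t" for c t by (simp add: complex_eq_iff)
  have S: "open {s. Re s > 1 / 2}" "convex {s. Re s > 1 / 2}"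
    by (rule open_halfspace_Re_gt convex_halfspace_Re_gt)+
  have "(res_kernel D X \<circ> (\<lambda>s. s - of_real \<sigma>)) holomorphic_on {s. Re s > 1 / 2}"
    by (rule holomorphic_on_compose[OF _ res_kernel_holomorphic]) (use X0 in \<open>auto intro!: holomorphic_intros\<close>)
  then have fhol: "f holomorphic_on {s. Re s > 1 / 2}"
    unfolding f_def o_def by (intro holomorphic_intros reg_log_deriv_holomorphic RH)
  have bound: "norm (f s) \<le> B \<bar>Im s\<bar>" if s: "\<sigma> \<le> Re s" "Re s \<le> 2" for s
  proof -
    define t where "t = Im s"
    have eq: "s - of_real \<sigma> = Complex (Re s - \<sigma>) t" by (simp add: t_def complex_eq_iff)
    have "norm (reg_log_deriv s) \<le> C * ln (\<bar>t\<bar> + 4)" unfolding t_def using s \<sigma> by (intro C) auto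
    also have "\<dots> \<le> C * (\<bar>t\<bar> + 4)" using C(1) ln_le_minus_one[of "\<bar>t\<bar> + 4"] by (intro mult_left_mono) linarith+
    finally have "norm (f s) \<le> C * (\<bar>t\<bar> + 4) * (K * gaussian X t)"
      unfolding f_def norm_mult eq K_def using s \<sigma> C(1)
      by (intro mult_mono res_kernel_norm_le X D) auto
    also have "\<dots> = C * K * ((\<bar>t\<bar> + 4) * gaussian X t)" by simp
    also have "\<dots> \<le> C * K * ((X\<^sup>2 + 4) * gaussian (sqrt 2 * X) t)"
      using C(1) K by (intro mult_left_mono gaussian_absorb_linear X0) auto
    finally show ?thesis by (simp add: B_def t_def gaussian_def)
  qed
  have Bint: "integrable lborel B"
    unfolding B_def using gaussian_integral[of "sqrt 2 * X"] X0 by (auto simp: has_bochner_integral_iff)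
  have fint: "integrable lborel (\<lambda>t. f (Complex c t))" if c: "\<sigma> \<le> c" "c \<le> 2" for c
  proof (rule Bochner_Integration.integrable_bound[OF Bint])
    have "continuous_on UNIV (\<lambda>t. f (Complex c t))"
      by (rule continuous_on_compose2[OF holomorphic_on_imp_continuous_on[OF fhol]])
         (use c \<sigma> in \<open>auto intro!: continuous_intros\<close>)
    then show "(\<lambda>t. f (Complex c t)) \<in> borel_measurable lborel" by (simp add: borel_measurable_continuous_onI)
    have "norm (f (Complex c t)) \<le> norm (B t)" for t
    proof -
      have "norm (f (Complex c t)) \<le> B \<bar>t\<bar>" using bound[of "Complex c t"] c by simp
      also have "B \<bar>t\<bar> = B t" by (simp add: B_def gaussian_def)
      finally show ?thesis by simp
    qed
    then show "AE t in lborel. norm (f (Complex c t)) \<le> norm (B t)" by simp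
  qed
  have fs: "f (Complex \<sigma> t) = reg_log_deriv (Complex \<sigma> t) * of_real (res_weight D X t)" for t
    by (simp add: f_def sub res_kernel_imag)
  show "integrable lborel (\<lambda>t. reg_log_deriv (Complex \<sigma> t) * of_real (res_weight D X t))"
    using fint[of \<sigma>] \<sigma> unfolding fs by simp
  have "(LBINT t. f (Complex \<sigma> t)) = (LBINT t. f (Complex 2 t))"
  proof (rule vertical_line_shift[OF fhol S \<sigma>(2)])
    have "((\<lambda>t. C * K * (X\<^sup>2 + 4) * gaussian (sqrt 2 * X) t) \<longlongrightarrow> C * K * (X\<^sup>2 + 4) * 0) at_top"
      by (intro tendsto_intros gaussian_tendsto_0) (use X0 in simp)
    then show "(B \<longlongrightarrow> 0) at_top" by (simp add: B_def)
  qed (use \<sigma> bound fint in auto)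
  also have "\<dots> = (LBINT t. dseries mangoldt (Complex 2 t) * res_kernel D X (Complex (2 - \<sigma>) t)
      - 1 / Complex 1 t * res_kernel D X (Complex (2 - \<sigma>) t))"
  proof (rule Bochner_Integration.integral_cong[OF refl])
    fix t
    have "Complex 2 t - 1 = Complex 1 t" by (simp add: complex_eq_iff)
    then show "f (Complex 2 t) = dseries mangoldt (Complex 2 t) * res_kernel D X (Complex (2 - \<sigma>) t)
      - 1 / Complex 1 t * res_kernel D X (Complex (2 - \<sigma>) t)"
      using dseries_mangoldt_reg[of "Complex 2 t"] by (simp add: f_def sub ring_distribs)
  qed
  finally have shift: "(LBINT t. f (Complex \<sigma> t)) = \<dots>" .
  have le: "norm (1 / Complex 1 t * res_kernel D X (Complex (2 - \<sigma>) t)) \<le> K * (norm (1 / Complex 1 t) * gaussian X t)" for t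
  proof -
    have "norm (res_kernel D X (Complex (2 - \<sigma>) t)) \<le> K * gaussian X t"
      unfolding K_def by (rule res_kernel_norm_le[OF X D]) (use \<sigma> in auto)
    then have "norm (1 / Complex 1 t) * norm (res_kernel D X (Complex (2 - \<sigma>) t)) \<le>
        norm (1 / Complex 1 t) * (K * gaussian X t)"
      by (rule mult_left_mono) simp
    then show ?thesis by (simp only: norm_mult mult_ac)
  qed
  have Pint: "integrable lborel (\<lambda>t. 1 / Complex 1 t * res_kernel D X (Complex (2 - \<sigma>) t))"
  proof (rule Bochner_Integration.integrable_bound)
    show "integrable lborel (\<lambda>t. K * (norm (1 / Complex 1 t) * gaussian X t))"
      by (intro integrable_mult_right gaussian_pole_integral X)
    show "AE t in lborel. norm (1 / Complex 1 t * res_kernel D X (Complex (2 - \<sigma>) t)) \<le>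
        norm (K * (norm (1 / Complex 1 t) * gaussian X t))"
      using le by (intro AE_I2) (metis order.trans real_norm_def abs_ge_self)
    have "continuous_on UNIV (\<lambda>t. 1 / Complex 1 t)"
      by (intro continuous_intros) (auto simp: complex_eq_iff)
    then have "(\<lambda>t. 1 / Complex 1 t) \<in> borel_measurable borel" by (rule borel_measurable_continuous_onI)
    then have "(\<lambda>t. 1 / Complex 1 t * res_kernel D X (Complex (2 - \<sigma>) t)) \<in> borel_measurable borel"
      by (intro borel_measurable_times res_kernel_measurable X0)
    then show "(\<lambda>t. 1 / Complex 1 t * res_kernel D X (Complex (2 - \<sigma>) t)) \<in> borel_measurable lborel"
      by simp
  qed
  have "norm (LBINT t. 1 / Complex 1 t * res_kernel D X (Complex (2 - \<sigma>) t)) \<le>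
      (LBINT t. norm (1 / Complex 1 t * res_kernel D X (Complex (2 - \<sigma>) t)))"
    by (rule Bochner_Integration.integral_norm_bound)
  also have "\<dots> \<le> (LBINT t. K * (norm (1 / Complex 1 t) * gaussian X t))"
    by (intro integral_mono le integrable_norm Pint integrable_mult_right gaussian_pole_integral X)
  also have "\<dots> \<le> K * (5 * sqrt X)"
    using K gaussian_pole_integral(2)[OF X] by (simp add: mult_left_mono)
  finally have pole: "Re (LBINT t. 1 / Complex 1 t * res_kernel D X (Complex (2 - \<sigma>) t)) \<le> K * (5 * sqrt X)"
    using complex_Re_le_cmod order.trans by blast
  define I where "I = (\<lambda>k. mangoldt k * real k powr (- \<sigma>) * (X * sqrt (2 * pi) *
            (\<Sum>m\<in>D. \<Sum>n\<in>D. exp (- ((X * (ln (real m) - ln (real n) - ln (real k)))\<^sup>2 / 2)))))"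
  have Isums: "I sums Re (LBINT t. dseries mangoldt (Complex 2 t) * res_kernel D X (Complex (2 - \<sigma>) t))"
    unfolding I_def by (rule dseries_mangoldt_res_integral(2)[OF X0])
  have "X * sqrt (2 * pi) * (\<Sum>p | prime p \<and> p \<le> Y. ln (real p) * real p powr (- \<sigma>) * real (card {n \<in> D. p * n \<in> D}))
      = (\<Sum>p | prime p \<and> p \<le> Y. mangoldt p * real p powr (- \<sigma>) * (X * sqrt (2 * pi) * real (card {n \<in> D. p * n \<in> D})))"
    unfolding sum_distrib_left by (intro sum.cong) auto
  also have "\<dots> \<le> (\<Sum>p | prime p \<and> p \<le> Y. I p)"
    unfolding I_def using X0 finD D
    by (intro sum_mono mult_left_mono card_shift_le_gaussian_sum mult_nonneg_nonneg mangoldt_nonneg)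
       (auto simp: prime_gt_0_nat dest: subsetD)
  also have "\<dots> \<le> suminf I"
    using Isums X0 by (intro sum_le_suminf) (auto simp: sums_iff I_def mangoldt_nonneg intro!: mult_nonneg_nonneg sum_nonneg finite_subset[of _ "{..Y}"])
  finally have main: "X * sqrt (2 * pi) * (\<Sum>p | prime p \<and> p \<le> Y. ln (real p) * real p powr (- \<sigma>) * real (card {n \<in> D. p * n \<in> D})) \<le>
      Re (LBINT t. dseries mangoldt (Complex 2 t) * res_kernel D X (Complex (2 - \<sigma>) t))"
    using Isums by (simp add: sums_iff)
  have "Re (LBINT t. f (Complex \<sigma> t)) = Re (LBINT t. dseries mangoldt (Complex 2 t) * res_kernel D X (Complex (2 - \<sigma>) t))
      - Re (LBINT t. 1 / Complex 1 t * res_kernel D X (Complex (2 - \<sigma>) t))"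
    unfolding shift
    by (subst Bochner_Integration.integral_diff)
       (use Pint dseries_mangoldt_res_integral(1)[OF X0, of D \<sigma>] in auto)
  then show "Re (LBINT t. reg_log_deriv (Complex \<sigma> t) * of_real (res_weight D X t)) \<ge>
      X * sqrt (2 * pi) * (\<Sum>p | prime p \<and> p \<le> Y. ln (real p) * real p powr (- \<sigma>) * real (card {n \<in> D. p * n \<in> D}))
      - 5 * exp 2 * (real (card D))\<^sup>2 * (real Q)\<^sup>2 * sqrt X"
    using main pole unfolding fs K_def by (simp add: mult_ac)
qed

text \<open>Upper bound for the same moment. Outside \<open>\<Omega>\<close> and its mirror image
  the real part is below \<open>M\<close>, except possibly near 0 and beyond \<open>T\<close>; there
  and on \<open>\<Omega>\<close> only the trivial bound is available. Comparison with the lower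
  bound then forces \<open>\<Omega>\<close> to be long.\<close>

lemma res_large_values:
  fixes D :: "nat set"
  assumes RH: riemann_hypothesis and C: "C > 0"
    "\<And>s. 3 / 4 \<le> Re s \<Longrightarrow> Re s \<le> 2 \<Longrightarrow> norm (reg_log_deriv s) \<le> C * ln (\<bar>Im s\<bar> + 4)"
    and \<sigma>: "3 / 4 \<le> \<sigma>" "\<sigma> \<le> 2" and X: "X \<ge> 1" and D: "D \<subseteq> {1..Q}"
    and T: "0 \<le> T0" "T0 \<le> T" and M: "M \<ge> 0"
  defines "\<Omega> \<equiv> {t \<in> {T0..T}. Re (reg_log_deriv (Complex \<sigma> t)) \<ge> M}"
  shows "closed \<Omega>"
    and "Re (LBINT t. reg_log_deriv (Complex \<sigma> t) * of_real (res_weight D X t)) \<le>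
      2 * C * ln (T + 4) * (real (card D))\<^sup>2 * measure lborel \<Omega> + M * (LBINT t. res_weight D X t)
      + 2 * C * ln (T + 4) * (real (card D))\<^sup>2 * T0
      + C * (real (card D))\<^sup>2 * (X\<^sup>2 + 4) * exp (- (T\<^sup>2 / (8 * X\<^sup>2))) * (2 * X * sqrt (2 * pi))"
proof -
  define g where "g = (\<lambda>t. Re (reg_log_deriv (Complex \<sigma> t)))"
  define W where "W = res_weight D X"
  define d where "d = (real (card D))\<^sup>2"
  define b where "b = C * ln (T + 4) * d"
  define c where "c = C * d * (X\<^sup>2 + 4) * exp (- (T\<^sup>2 / (8 * X\<^sup>2)))"
  \<comment> \<open>The pieces are for \<open>\<Omega>\<close> and its mirror image, for typical
    points, for heights up to \<open>T0\<close> and for the tail. Since \<open>M \<ge> 0\<close>,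
    each is nonnegative everywhere, so at every point it is enough that one piece suffices.\<close>
  let ?R = "\<lambda>t. b * (indicator \<Omega> t + indicator (uminus ` \<Omega>) t) + M * W t + b * indicator {- T0..T0} t
     + c * gaussian (2 * X) t"
  have mem\<Omega>: "t \<in> \<Omega> \<longleftrightarrow> T0 \<le> t \<and> t \<le> T \<and> M \<le> g t" for t
    by (auto simp: \<Omega>_def g_def)
  have d0: "d \<ge> 0" by (simp add: d_def)
  have b0: "b \<ge> 0" unfolding b_def using C d0 T by (intro mult_nonneg_nonneg ln_ge_zero) auto
  have c0: "c \<ge> 0" unfolding c_def using C d0 by (intro mult_nonneg_nonneg) auto
  have cont: "continuous_on UNIV g"
  proof -
    have "continuous_on UNIV (\<lambda>t. reg_log_deriv (Complex \<sigma> t))"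
      by (rule continuous_on_compose2[OF holomorphic_on_imp_continuous_on[OF reg_log_deriv_holomorphic[OF RH]]])
         (use \<sigma> in \<open>auto intro!: continuous_intros\<close>)
    then show ?thesis unfolding g_def by (intro continuous_intros)
  qed
  show cl: "closed \<Omega>"
  proof -
    have "closed ({T0..T} \<inter> {t. M \<le> g t})"
      by (intro closed_Int closed_Collect_le cont continuous_intros)
    also have "{T0..T} \<inter> {t. M \<le> g t} = \<Omega>" by (auto simp: \<Omega>_def g_def)
    finally show ?thesis .
  qed
  have cl': "closed (uminus ` \<Omega>)" using cl by (simp add: closed_negations)
  have bdd: "\<Omega> \<subseteq> {T0..T}" by (auto simp: \<Omega>_def)
  have em: "emeasure lborel \<Omega> < \<infinity>"
    using emeasure_mono[OF bdd, of lborel] by (simp add: emeasure_lborel_Icc_eq T order.strict_trans1)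
  have em': "emeasure lborel (uminus ` \<Omega>) = emeasure lborel \<Omega>"
  proof -
    have "emeasure lborel \<Omega> = emeasure (distr lborel borel uminus) \<Omega>"
      using lborel_distr_uminus by simp
    also have "\<dots> = emeasure lborel (uminus -` \<Omega> \<inter> space lborel)"
      using cl by (intro emeasure_distr) auto
    also have "uminus -` \<Omega> \<inter> space lborel = uminus ` \<Omega>"
      by (force simp: image_iff)
    finally show ?thesis by simp
  qed
  have gsym: "g (- t) = g t" for t
  proof -
    have "Complex \<sigma> (- t) = cnj (Complex \<sigma> t)" by (simp add: complex_eq_iff)
    then show ?thesis using \<sigma> by (simp add: g_def reg_log_deriv_cnj)
  qed
  have gle: "\<bar>g t\<bar> \<le> C * ln (\<bar>t\<bar> + 4)" for t
    using C(2)[of "Complex \<sigma> t"] \<sigma> abs_Re_le_cmod[of "reg_log_deriv (Complex \<sigma> t)"] by (simp add: g_def)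
  have W0: "W t \<ge> 0" for t by (simp add: W_def)
  have Wle: "W t \<le> d * gaussian X t" for t unfolding W_def d_def by (rule res_weight_le)
  have le: "g t * W t \<le> ?R t" for t
  proof (cases "\<bar>t\<bar> \<le> T")
    case True
    have "g t * W t \<le> C * ln (T + 4) * (d * gaussian X t)"
    proof -
      have "g t \<le> C * ln (\<bar>t\<bar> + 4)" using gle[of t] by linarith
      also have "\<dots> \<le> C * ln (T + 4)" using True C by (intro mult_left_mono ln_mono) auto
      finally show ?thesis using W0 Wle C T by (intro mult_mono mult_nonneg_nonneg ln_ge_zero) auto
    qed
    also have "\<dots> \<le> b"
      using C T d0 mult_left_le[of "gaussian X t" "C * ln (T + 4) * d"]
      by (simp add: b_def gaussian_def mult.assoc)
    finally have gb: "g t * W t \<le> b" .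
    have nn: "0 \<le> M * W t" "0 \<le> c * gaussian (2 * X) t" using M W0 c0 by auto
    consider "\<bar>t\<bar> \<le> T0" | "t \<in> \<Omega>" | "- t \<in> \<Omega>" | "g t < M"
    proof -
      have "\<bar>t\<bar> \<le> T0 \<or> t \<in> \<Omega> \<or> - t \<in> \<Omega> \<or> g t < M"
        using True unfolding mem\<Omega> gsym by (cases "t \<ge> 0") auto
      then show ?thesis using that by blast
    qed
    then show ?thesis
    proof cases
      case 1
      then have "b * indicator {- T0..T0} t = b" by (auto simp: indicator_def)
      moreover have "0 \<le> b * (indicator \<Omega> t + indicator (uminus ` \<Omega>) t)" using b0 by simp
      ultimately show ?thesis using gb nn by linarith
    next
      case 2
      then have "b * (indicator \<Omega> t + indicator (uminus ` \<Omega>) t) \<ge> b" using b0 by (simp add: algebra_simps)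
      moreover have "0 \<le> b * indicator {- T0..T0} t" using b0 by simp
      ultimately show ?thesis using gb nn by linarith
    next
      case 3
      then have "t \<in> uminus ` \<Omega>" by force
      then have "b * (indicator \<Omega> t + indicator (uminus ` \<Omega>) t) \<ge> b" using b0 by (simp add: algebra_simps)
      moreover have "0 \<le> b * indicator {- T0..T0} t" using b0 by simp
      ultimately show ?thesis using gb nn by linarith
    next
      case 4
      then have "g t * W t \<le> M * W t" using W0 by (intro mult_right_mono) auto
      moreover have "0 \<le> b * (indicator \<Omega> t + indicator (uminus ` \<Omega>) t)" "0 \<le> b * indicator {- T0..T0} t"
        using b0 by simp_all
      ultimately show ?thesis using nn by linarith
    qed
  next
    case False
    have "g t \<le> C * (\<bar>t\<bar> + 4)"
    proof -
      have "g t \<le> C * ln (\<bar>t\<bar> + 4)" using gle[of t] by linarith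
      also have "\<dots> \<le> C * (\<bar>t\<bar> + 4)"
        using C(1) ln_le_minus_one[of "\<bar>t\<bar> + 4"] by (intro mult_left_mono) linarith+
      finally show ?thesis .
    qed
    then have "g t * W t \<le> C * (\<bar>t\<bar> + 4) * (d * gaussian X t)"
      using W0 Wle C by (intro mult_mono) auto
    also have "\<dots> = C * d * ((\<bar>t\<bar> + 4) * gaussian X t)" by simp
    also have "\<dots> \<le> C * d * ((X\<^sup>2 + 4) * gaussian (sqrt 2 * X) t)"
      using C d0 X by (intro mult_left_mono gaussian_absorb_linear) auto
    \<comment> \<open>The exponent \<open>t\<^sup>2 / (4 * X\<^sup>2)\<close> is halved: one half is
      bounded by its value at \<open>T\<close>, the other keeps the tail integrable.\<close>
    also have "gaussian (sqrt 2 * X) t \<le> exp (- (T\<^sup>2 / (8 * X\<^sup>2))) * gaussian (2 * X) t"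
    proof -
      have "T\<^sup>2 \<le> t\<^sup>2" using False T by (metis abs_le_square_iff abs_of_nonneg linear order.trans)
      then have "T\<^sup>2 / (8 * X\<^sup>2) \<le> t\<^sup>2 / (8 * X\<^sup>2)" by (rule divide_right_mono) simp
      then show ?thesis
        unfolding gaussian_def exp_add[symmetric] by (simp add: power_mult_distrib)
    qed
    finally have "g t * W t \<le> c * gaussian (2 * X) t"
      using C d0 by (simp add: c_def mult.assoc mult_left_mono)
    moreover have "0 \<le> b * (indicator \<Omega> t + indicator (uminus ` \<Omega>) t)" "0 \<le> b * indicator {- T0..T0} t" "0 \<le> M * W t"
      using b0 M W0 by simp_all
    ultimately show ?thesis by linarith
  qed
  have int\<Omega>: "has_bochner_integral lborel (indicator \<Omega>) (measure lborel \<Omega>)"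
    using cl em by (intro has_bochner_integral_real_indicator) auto
  have int\<Omega>': "has_bochner_integral lborel (indicator (uminus ` \<Omega>)) (measure lborel \<Omega>)"
    using has_bochner_integral_real_indicator[of "uminus ` \<Omega>" lborel] cl' em em' by (simp add: measure_def)
  have intT0: "has_bochner_integral lborel (indicator {- T0..T0}) (2 * T0)"
    using has_bochner_integral_real_indicator[of "{- T0..T0}" lborel] T by (simp add: emeasure_lborel_Icc_eq)
  have intW: "has_bochner_integral lborel W (LBINT t. W t)"
    using res_weight_integral[of X D] X by (simp add: W_def has_bochner_integral_iff)
  have intG: "has_bochner_integral lborel (gaussian (2 * X)) (2 * X * sqrt (2 * pi))"
    using gaussian_integral[of "2 * X"] X by simp
  have intR: "has_bochner_integral lborel ?R (b * (measure lborel \<Omega> + measure lborel \<Omega>) + M * (LBINT t. W t) + b * (2 * T0)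
     + c * (2 * X * sqrt (2 * pi)))"
    by (intro has_bochner_integral_add has_bochner_integral_mult_right int\<Omega> int\<Omega>' intT0 intW intG)
  have int0: "integrable lborel (\<lambda>t. reg_log_deriv (Complex \<sigma> t) * of_real (res_weight D X t))"
    by (rule reg_log_deriv_res_integral(1)[OF RH C \<sigma> X D])
  have eqg: "Re (reg_log_deriv (Complex \<sigma> t) * of_real (res_weight D X t)) = g t * W t" for t
    by (simp add: g_def W_def)
  have intg: "integrable lborel (\<lambda>t. g t * W t)"
    using integrable_Re[OF int0] unfolding eqg .
  have "Re (LBINT t. reg_log_deriv (Complex \<sigma> t) * of_real (res_weight D X t)) = (LBINT t. g t * W t)"
    using integral_Re[OF int0] unfolding eqg by simp
  also have "\<dots> \<le> (LBINT t. ?R t)"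
    using intR by (intro integral_mono intg le) (simp add: has_bochner_integral_iff)
  also have "\<dots> = b * (measure lborel \<Omega> + measure lborel \<Omega>) + M * (LBINT t. W t) + b * (2 * T0) + c * (2 * X * sqrt (2 * pi))"
    using intR by (simp add: has_bochner_integral_iff)
  finally show "Re (LBINT t. reg_log_deriv (Complex \<sigma> t) * of_real (res_weight D X t)) \<le>
      2 * C * ln (T + 4) * (real (card D))\<^sup>2 * measure lborel \<Omega> + M * (LBINT t. res_weight D X t)
      + 2 * C * ln (T + 4) * (real (card D))\<^sup>2 * T0
      + C * (real (card D))\<^sup>2 * (X\<^sup>2 + 4) * exp (- (T\<^sup>2 / (8 * X\<^sup>2))) * (2 * X * sqrt (2 * pi))"
    by (simp add: b_def c_def d_def W_def algebra_simps)
qed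

section \<open>Choice of parameters and proof of the theorem\<close>

definition res_primes :: "real \<Rightarrow> nat" where
  "res_primes T = nat \<lfloor>ln T / ln (ln T) ^ 3\<rfloor>"

definition res_exponent :: "real \<Rightarrow> nat" where
  "res_exponent T = nat \<lceil>ln (ln T)\<rceil>"

text \<open>The fourth power in the lower bound absorbs the rounding; compared with the cube it
  changes only the constant in front of the \<open>ln (ln (ln T))\<close> loss.\<close>

lemma res_primes_bounds:
  "\<forall>\<^sub>F T in at_top. res_primes T \<ge> 1 \<and> ln T / ln (ln T) ^ 4 \<le> real (res_primes T)
     \<and> real (res_primes T) \<le> ln T / ln (ln T) ^ 3 \<and> real (res_primes T) \<le> ln T"
proof -
  have "\<forall>\<^sub>F T in at_top. ln T / ln (ln T) ^ 4 \<ge> (1::real)" by real_asymp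
  moreover have "\<forall>\<^sub>F T in at_top. ln (ln T) \<ge> (2::real)" by real_asymp
  moreover have "\<forall>\<^sub>F T in at_top. ln T > (1::real)" by real_asymp
  ultimately show ?thesis
  proof eventually_elim
    case (elim T)
    define u where "u = ln (ln T)"
    have le2: "2 * (ln T / u ^ 4) \<le> ln T / u ^ 3"
    proof -
      have "2 * (ln T / u ^ 4) \<le> u * (ln T / u ^ 4)"
        using elim by (intro mult_right_mono) (auto simp: u_def)
      also have "\<dots> = ln T / u ^ 3" using elim by (simp add: u_def power4_eq_xxxx power3_eq_cube)
      finally show ?thesis .
    qed
    then have ge: "ln T / ln (ln T) ^ 3 - 1 \<ge> ln T / ln (ln T) ^ 4"
      using elim unfolding u_def by linarith
    have le: "ln T / ln (ln T) ^ 3 \<le> ln T"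
    proof -
      have "1 \<le> ln (ln T) ^ 3" using elim by (intro one_le_power) auto
      then have "ln T / ln (ln T) ^ 3 \<le> ln T / 1" using elim by (intro divide_left_mono) auto
      then show ?thesis by simp
    qed
    have "real (res_primes T) = of_int \<lfloor>ln T / ln (ln T) ^ 3\<rfloor>"
      unfolding res_primes_def using ge elim by (subst of_nat_nat) auto
    then have *: "real (res_primes T) \<le> ln T / ln (ln T) ^ 3" "ln T / ln (ln T) ^ 3 - 1 \<le> real (res_primes T)"
      by linarith+
    then have "real (res_primes T) \<ge> 1" using elim ge by linarith
    then show ?case using * ge le by simp
  qed
qed

lemma resonator_size:
  assumes "\<eta> > 0"
  shows "\<forall>\<^sub>F T in at_top. real (resonator (res_primes T) (res_exponent T)) \<le> T powr \<eta>"
proof -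
  have "\<forall>\<^sub>F T in at_top. (ln (ln T) + 1) * (ln T / ln (ln T) ^ 3) * ln (ln T) \<le> \<eta> * ln T"
    using assms by real_asymp
  moreover have "\<forall>\<^sub>F T in at_top. ln (ln T) > (0::real)" "\<forall>\<^sub>F T in at_top. T > (0::real)" by real_asymp+
  ultimately show ?thesis using res_primes_bounds
  proof eventually_elim
    case (elim T)
    let ?Y = "res_primes T" and ?E = "res_exponent T"
    have E: "real ?E \<le> ln (ln T) + 1"
      unfolding res_exponent_def using elim by (subst of_nat_nat) auto
    have "ln (real (resonator ?Y ?E)) \<le> real ?E * real ?Y * ln (real ?Y)"
      by (rule resonator_le) (use elim in simp)
    also have "\<dots> \<le> (ln (ln T) + 1) * (ln T / ln (ln T) ^ 3) * ln (ln T)"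
      using elim E by (intro mult_mono mult_nonneg_nonneg ln_mono) auto
    also have "\<dots> \<le> \<eta> * ln T" using elim by simp
    finally have "exp (ln (real (resonator ?Y ?E))) \<le> exp (\<eta> * ln T)" by simp
    then show ?case using elim resonator_pos[of ?Y ?E] by (simp add: powr_def)
  qed
qed

text \<open>The 3 will be spent one by one: 1 for the pole term between
  \<open>-\<zeta>'/\<zeta>\<close> and \<open>reg_log_deriv\<close>, 1 for the off-diagonal part of
  the mass of the weight, and 1 as the surplus that the large values must account for.\<close>

lemma res_prime_sum_lower:
  assumes A: "A > 0" and x: "x > 0"
  shows "\<forall>\<^sub>F T in at_top.
    real (res_exponent T) / real (res_exponent T + 1) *
      (\<Sum>p | prime p \<and> p \<le> res_primes T. ln (real p) * real p powr (- sigma_A A T))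
    \<ge> ln (ln T) / ln (ln (ln T)) * ((exp A - 1) / A * ln (ln (ln T)) - x) + 3"
proof -
  obtain C where C: "C \<ge> 0" "\<And>n a. n \<ge> 1 \<Longrightarrow> a > 0 \<Longrightarrow>
       (\<Sum>p | prime p \<and> p \<le> n. ln (real p) * real p powr (a - 1)) \<ge> (real n powr a - 1) / a - C * real n powr a"
    using sum_prime_powr_lower by blast
  define k where "k = (exp A - 1) / A"
  have k: "k > 0" using A by (simp add: k_def)
  \<comment> \<open>For \<open>u = ln (ln T)\<close> the losses are \<open>k\<close> from
    \<open>E / (E + 1) \<ge> 1 - 1 / u\<close>, \<open>4 * exp A * ln u\<close> from
    \<open>Y\<close> being smaller than \<open>ln T\<close>, and \<open>C * exp A\<close> from
    Mertens' estimate.\<close>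
  have e1: "\<forall>\<^sub>F u in at_top. x * (u / ln u) \<ge> k + 4 * exp A * ln u + C * exp A + (3::real)"
    using x by real_asymp
  have e2: "\<forall>\<^sub>F u in at_top. k * u - 4 * exp A * ln u - C * exp A \<ge> (0::real)"
    using k by real_asymp
  have e3: "\<forall>\<^sub>F u in at_top. u > (1::real) \<and> ln u > 0"
    by (intro eventually_conj) real_asymp+
  have lim: "filterlim (\<lambda>T::real. ln (ln T)) at_top at_top" by real_asymp
  have "\<forall>\<^sub>F T in at_top. ln T > (0::real)" by real_asymp
  then show ?thesis
    using res_primes_bounds filterlim_iff[THEN iffD1, OF lim, rule_format, OF e1]
      filterlim_iff[THEN iffD1, OF lim, rule_format, OF e2] filterlim_iff[THEN iffD1, OF lim, rule_format, OF e3]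
  proof eventually_elim
    case (elim T)
    define u where "u = ln (ln T)"
    define Y where "Y = res_primes T"
    define E where "E = res_exponent T"
    define S where "S = (\<Sum>p | prime p \<and> p \<le> Y. ln (real p) * real p powr (- sigma_A A T))"
    note elim = elim[folded u_def Y_def]
    have Lu: "ln T = exp u" using elim by (simp add: u_def)
    have a: "A / u > 0" using A elim by simp
    have "- sigma_A A T = A / u - 1" by (simp add: sigma_A_def u_def)
    then have S: "S \<ge> (real Y powr (A / u) - 1) / (A / u) - C * real Y powr (A / u)"
      unfolding S_def using C(2)[of Y "A / u"] elim a by simp
    have up: "real Y powr (A / u) \<le> exp A"
    proof -
      have "real Y powr (A / u) \<le> exp u powr (A / u)"
        using elim a Lu by (intro powr_mono2) auto
      also have "\<dots> = exp A" using elim by (simp add: powr_def)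
      finally show ?thesis .
    qed
    have low: "real Y powr (A / u) \<ge> exp A * (1 - 4 * A * ln u / u)"
    proof -
      have "ln T / u ^ 4 = exp (u - 4 * ln u)"
        using elim by (simp add: Lu exp_diff exp_of_nat_mult[of 4 "ln u", simplified])
      then have "exp (u - 4 * ln u) powr (A / u) \<le> real Y powr (A / u)"
        using elim a by (intro powr_mono2) auto
      moreover have "exp (u - 4 * ln u) powr (A / u) = exp A * exp (- (4 * A * ln u / u))"
        using elim by (simp add: powr_def exp_add[symmetric] field_simps)
      moreover have "exp A * exp (- (4 * A * ln u / u)) \<ge> exp A * (1 - 4 * A * ln u / u)"
        using exp_ge_add_one_self[of "- (4 * A * ln u / u)"] by (intro mult_left_mono) auto
      ultimately show ?thesis by linarith
    qed
    have S0: "S \<ge> k * u - 4 * exp A * ln u - C * exp A"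
    proof -
      have "(exp A * (1 - 4 * A * ln u / u) - 1) / (A / u) \<le> (real Y powr (A / u) - 1) / (A / u)"
        using low a by (intro divide_right_mono) auto
      moreover have "(exp A * (1 - 4 * A * ln u / u) - 1) / (A / u) = k * u - 4 * exp A * ln u"
        using A elim by (simp add: k_def field_simps)
      moreover have "C * real Y powr (A / u) \<le> C * exp A" using up C(1) by (rule mult_left_mono)
      ultimately show ?thesis using S by linarith
    qed
    have Eu: "real E \<ge> u" unfolding E_def res_exponent_def u_def using elim by (simp add: u_def)
    have ratio: "real E / real (E + 1) \<ge> 1 - 1 / u"
    proof -
      have "1 / real (E + 1) \<le> 1 / u" using Eu elim by (intro divide_left_mono) auto
      moreover have "real E / real (E + 1) = 1 - 1 / real (E + 1)" by (simp add: field_simps)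
      ultimately show ?thesis by simp
    qed
    have "(1 - 1 / u) * (k * u - 4 * exp A * ln u - C * exp A) \<le> real E / real (E + 1) * S"
      using ratio S0 elim by (intro mult_mono) auto
    moreover have "(1 - 1 / u) * (k * u - 4 * exp A * ln u - C * exp A) =
        k * u - k - 4 * exp A * ln u - C * exp A + (4 * exp A * ln u + C * exp A) / u"
      using elim by (simp add: field_simps)
    moreover have "(4 * exp A * ln u + C * exp A) / u \<ge> 0"
      using elim C(1) by (intro divide_nonneg_nonneg add_nonneg_nonneg mult_nonneg_nonneg) auto
    moreover have "u / ln u * (k * ln u - x) = k * u - x * (u / ln u)"
      using elim by (simp add: field_simps)
    ultimately have "real E / real (E + 1) * S \<ge> u / ln u * (k * ln u - x) + 3"
      using elim by linarith
    then show ?case by (simp add: E_def S_def u_def k_def Y_def)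
  qed
qed

text \<open>The left side is \<open>T powr (1 - \<eta>)\<close> up to a logarithm. On the right
  every term but the last is at most \<open>T powr (1 - 2 * \<eta>)\<close> up to a logarithm, and
  the last decays faster than any power.\<close>

lemma final_balance:
  fixes C \<beta> \<delta> \<eta> :: real
  assumes "C > 0" "0 < \<eta>" "\<eta> \<le> 1 / 8" "2 * \<eta> \<le> \<delta>" "\<beta> \<le> 1 - 2 * \<eta>"
  shows "\<forall>\<^sub>F T in at_top. 2 * (T / ln T) / T powr \<eta> \<ge>
    2 * C * ln (T + 4) * T powr (1 - \<delta>) + 2 * C * ln (T + 4) * T powr \<beta>
    + 5 * exp 2 * (T powr \<eta>)\<^sup>2 * sqrt T + 6 * C * T * (T\<^sup>2 + 4) * exp (- ((ln T)\<^sup>2 / 8))"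
proof -
  have "\<forall>\<^sub>F T in at_top. 2 * (T / ln T) / T powr \<eta> \<ge>
     (4 * C * ln (T + 4) + 5 * exp 2) * T powr (1 - 2 * \<eta>) + 6 * C * T * (T\<^sup>2 + 4) * exp (- ((ln T)\<^sup>2 / 8))"
    using assms(1,2) by real_asymp
  moreover have "\<forall>\<^sub>F T in at_top. T \<ge> (1::real)" by real_asymp
  ultimately show ?thesis
  proof eventually_elim
    case (elim T)
    have l: "0 \<le> 2 * C * ln (T + 4)" using elim assms by (intro mult_nonneg_nonneg ln_ge_zero) auto
    have p: "T powr (1 - \<delta>) \<le> T powr (1 - 2 * \<eta>)" "T powr \<beta> \<le> T powr (1 - 2 * \<eta>)"
      using elim assms by (auto intro!: powr_mono)
    note mult_left_mono[OF p(1) l] mult_left_mono[OF p(2) l]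
    moreover have "5 * exp 2 * (T powr \<eta>)\<^sup>2 * sqrt T \<le> 5 * exp 2 * T powr (1 - 2 * \<eta>)"
    proof -
      have "(T powr \<eta>)\<^sup>2 * sqrt T = T powr \<eta> * T powr \<eta> * T powr (1 / 2)"
        using elim by (simp only: power2_eq_square powr_half_sqrt)
      also have "\<dots> = T powr (\<eta> + \<eta> + 1 / 2)" by (simp only: powr_add)
      \<comment> \<open>This is where \<open>\<eta> \<le> 1 / 8\<close> enters:
        \<open>2 * \<eta> + 1 / 2 \<le> 1 - 2 * \<eta>\<close>.\<close>
      also have "\<dots> \<le> T powr (1 - 2 * \<eta>)" using elim assms by (intro powr_mono) auto
      finally have "5 * exp 2 * ((T powr \<eta>)\<^sup>2 * sqrt T) \<le> 5 * exp 2 * T powr (1 - 2 * \<eta>)"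
        by (rule mult_left_mono) simp
      then show ?thesis by (simp only: mult.assoc)
    qed
    moreover have "(4 * C * ln (T + 4) + 5 * exp 2) * T powr (1 - 2 * \<eta>) =
        2 * C * ln (T + 4) * T powr (1 - 2 * \<eta>) + 2 * C * ln (T + 4) * T powr (1 - 2 * \<eta>)
        + 5 * exp 2 * T powr (1 - 2 * \<eta>)"
      by (simp add: algebra_simps)
    ultimately show ?case using elim(1) by linarith
  qed
qed

lemma card_shift_resonator:
  fixes p Y E :: nat
  assumes p: "prime p" "p \<le> Y"
  defines "D \<equiv> {m. m dvd resonator Y E}"
  shows "real (card {n \<in> D. p * n \<in> D}) \<ge> real E / real (E + 1) * real (card D)"
proof -
  obtain r where r: "resonator Y E = p ^ E * r" "\<not> p dvd r"
    using resonator_factor[OF p] by blast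
  have "r > 0" using resonator_pos[of Y E] r(1) by (intro Nat.gr0I) simp
  from card_divisors_shift[OF p(1) r(2) this, of E]
  have "real (card {m. p * m dvd resonator Y E}) \<ge> real E / real (E + 1) * real (card D)"
    unfolding D_def r(1) .
  moreover have "{n \<in> D. p * n \<in> D} = {m. p * m dvd resonator Y E}"
    by (auto simp: D_def dest: dvd_mult_right)
  ultimately show ?thesis by simp
qed

text \<open>Heights are at least 1, so \<open>1 / (s - 1)\<close> has modulus at most 1, and passing
  from \<open>reg_log_deriv\<close> to \<open>-\<zeta>'/\<zeta>\<close> costs 1. Closedness supplies
  the measurability for comparing measures.\<close>

lemma large_values_subset:
  assumes RH: riemann_hypothesis and T: "T powr \<beta> \<ge> 1" and \<sigma>: "3 / 4 \<le> sigma_A A T"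
  shows "{t \<in> {T powr \<beta>..T}. Re (reg_log_deriv (Complex (sigma_A A T) t)) \<ge>
      ln (ln T) / ln (ln (ln T)) * ((exp A - 1) / A * ln (ln (ln T)) - x) + 1} \<subseteq> large_set \<beta> A T x"
    and "closed (large_set \<beta> A T x)"
proof -
  define s where "s = Complex (sigma_A A T)"
  have eq: "- Re (deriv riemann_zeta (s t) / riemann_zeta (s t)) = Re (reg_log_deriv (s t)) + Re (1 / (s t - 1))"
    if t: "t \<ge> T powr \<beta>" for t
  proof -
    have ne: "s t \<noteq> 1" using t T by (auto simp: s_def complex_eq_iff)
    have "reg_zeta (s t) \<noteq> 0" using reg_zeta_nonzero[OF RH] \<sigma> by (simp add: s_def)
    then have "riemann_zeta (s t) \<noteq> 0" using reg_zeta_eq[of "s t"] ne \<sigma> by (auto simp: s_def)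
    then show ?thesis using reg_log_deriv_eq[of "s t"] ne \<sigma> by (simp add: s_def)
  qed
  show "{t \<in> {T powr \<beta>..T}. Re (reg_log_deriv (Complex (sigma_A A T) t)) \<ge>
      ln (ln T) / ln (ln (ln T)) * ((exp A - 1) / A * ln (ln (ln T)) - x) + 1} \<subseteq> large_set \<beta> A T x"
  proof (intro subsetI)
    fix t assume "t \<in> {t \<in> {T powr \<beta>..T}. Re (reg_log_deriv (Complex (sigma_A A T) t)) \<ge>
      ln (ln T) / ln (ln (ln T)) * ((exp A - 1) / A * ln (ln (ln T)) - x) + 1}"
    then have t: "t \<ge> T powr \<beta>" "t \<le> T" "Re (reg_log_deriv (s t)) \<ge>
      ln (ln T) / ln (ln (ln T)) * ((exp A - 1) / A * ln (ln (ln T)) - x) + 1" by (auto simp: s_def)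
    have "norm (s t - 1) \<ge> 1"
      using abs_Im_le_cmod[of "s t - 1"] t T by (simp add: s_def)
    then have "norm (1 / (s t - 1)) \<le> 1" by (simp add: norm_divide divide_le_eq)
    then have "Re (1 / (s t - 1)) \<ge> - 1" using abs_Re_le_cmod[of "1 / (s t - 1)"] by linarith
    then show "t \<in> large_set \<beta> A T x"
      unfolding large_set_def s_def[symmetric] using t eq[OF t(1)] by simp
  qed
  have c1: "continuous_on UNIV (\<lambda>t. reg_log_deriv (s t))"
    unfolding s_def
    by (rule continuous_on_compose2[OF holomorphic_on_imp_continuous_on[OF reg_log_deriv_holomorphic[OF RH]]])
       (use \<sigma> in \<open>auto intro!: continuous_intros\<close>)
  \<comment> \<open>The maximum with \<open>T powr \<beta>\<close> keeps the denominator away from 0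
    on the whole line and changes nothing on the interval.\<close>
  have c2: "continuous_on UNIV (\<lambda>t. 1 / Complex (sigma_A A T - 1) (max t (T powr \<beta>)))"
    by (intro continuous_intros) (use T in \<open>auto simp: complex_eq_iff max_def\<close>)
  have "closed ({T powr \<beta>..T} \<inter> {t. ln (ln T) / ln (ln (ln T)) * ((exp A - 1) / A * ln (ln (ln T)) - x)
      \<le> Re (reg_log_deriv (s t)) + Re (1 / Complex (sigma_A A T - 1) (max t (T powr \<beta>)))})"
    by (intro closed_Int closed_Collect_le closed_atLeastAtMost continuous_on_const continuous_on_add
        continuous_on_Re c1 c2)
  also have "{T powr \<beta>..T} \<inter> {t. ln (ln T) / ln (ln (ln T)) * ((exp A - 1) / A * ln (ln (ln T)) - x)
      \<le> Re (reg_log_deriv (s t)) + Re (1 / Complex (sigma_A A T - 1) (max t (T powr \<beta>)))} = large_set \<beta> A T x"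
  proof -
    have "s t - 1 = Complex (sigma_A A T - 1) t" for t by (simp add: s_def complex_eq_iff)
    then show ?thesis
      unfolding large_set_def s_def[symmetric] using eq by (auto simp: max_absorb1)
  qed
  finally show "closed (large_set \<beta> A T x)" .
qed

text \<open>Here \<open>T\<close> is fixed, and every asymptotic requirement is a hypothesis. The
  two bounds for the moment leave a surplus \<open>X * sqrt (2 * pi) * card D\<close>, to be covered
  by the error terms and the measure of \<open>\<Omega>\<close>, each weighted by
  \<open>(card D)\<^sup>2\<close>; by \<open>bal\<close> this forces the measure up to
  \<open>B\<close>.\<close>

lemma large_set_measure_ge:
  assumes RH: riemann_hypothesis and C: "C > 0"
    "\<And>s. 3 / 4 \<le> Re s \<Longrightarrow> Re s \<le> 2 \<Longrightarrow> norm (reg_log_deriv s) \<le> C * ln (\<bar>Im s\<bar> + 4)"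
    and T: "T \<ge> exp 1" "T powr \<beta> \<ge> 1" "T powr \<beta> \<le> T" and A: "A > 0"
    and \<sigma>: "3 / 4 \<le> sigma_A A T" "sigma_A A T \<le> 2"
    and M: "M = ln (ln T) / ln (ln (ln T)) * ((exp A - 1) / A * ln (ln (ln T)) - x) + 1" "0 \<le> M" "M \<le> T"
    and sum: "real E / real (E + 1) * (\<Sum>p | prime p \<and> p \<le> Y. ln (real p) * real p powr (- sigma_A A T)) \<ge> M + 2"
    and Q: "real (resonator Y E) \<le> T powr \<eta>" "T powr \<eta> \<le> T"
    and sep: "T * T * exp (- ((T / ln T / T powr \<eta>)\<^sup>2 / 2)) \<le> 1"
    and bal: "2 * (T / ln T) / T powr \<eta> \<ge> 2 * C * ln (T + 4) * B + 2 * C * ln (T + 4) * T powr \<beta>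
        + 5 * exp 2 * (T powr \<eta>)\<^sup>2 * sqrt T + 6 * C * T * (T\<^sup>2 + 4) * exp (- ((ln T)\<^sup>2 / 8))"
  shows "measure lebesgue (large_set \<beta> A T x) \<ge> B"
proof -
  define \<sigma> where "\<sigma> = sigma_A A T"
  define q where "q = T powr \<eta>"
  define Q where "Q = resonator Y E"
  define D where "D = {m. m dvd Q}"
  define d where "d = real (card D)"
  define L where "L = ln T"
  define X where "X = T / L"
  define r where "r = sqrt (2 * pi)"
  define \<Omega> where "\<Omega> = {t \<in> {T powr \<beta>..T}. Re (reg_log_deriv (Complex \<sigma> t)) \<ge> M}"
  define J where "J = Re (LBINT t. reg_log_deriv (Complex \<sigma> t) * of_real (res_weight D X t))"
  define e1 where "e1 = exp (- (L\<^sup>2 / 8))"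
  have T1: "T > 0" "L \<ge> 1"
  proof -
    show "T > 0" using T(1) exp_gt_zero[of "1::real"] by linarith
    then show "L \<ge> 1" using T(1) by (simp add: L_def ln_ge_iff)
  qed
  have XT: "X \<le> T" "X \<ge> 1"
  proof -
    show "X \<le> T" using T1 by (simp add: X_def divide_le_eq mult_le_cancel_left1)
    have "L \<le> T" using ln_le_minus_one[OF T1(1)] by (simp add: L_def)
    then show "X \<ge> 1" using T1 by (simp add: X_def)
  qed
  have r: "2 \<le> r" "r \<le> 3"
    unfolding r_def using pi_approx by (auto intro!: real_le_rsqrt real_le_lsqrt simp: power2_eq_square)
  have Q0: "Q > 0" by (simp add: Q_def resonator_pos)
  have D: "D \<subseteq> {1..Q}" using Q0 by (auto simp: D_def Suc_le_eq intro: dvd_imp_le Nat.gr0I)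
  have finD: "finite D" using D finite_subset by blast
  have q: "real Q \<le> q" "q \<le> T" "q > 0" using Q T1 by (auto simp: Q_def q_def)
  have "1 \<in> D" by (simp add: D_def)
  then have "card D > 0" using finD by (auto simp: card_gt_0_iff)
  moreover have "card D \<le> Q" unfolding D_def by (rule card_divisors_le[OF Q0])
  ultimately have d: "d \<ge> 1" "d \<le> q" using q(1) by (auto simp: d_def)
  define S where "S = (\<Sum>p | prime p \<and> p \<le> Y. ln (real p) * real p powr (- \<sigma>))"
  have J_ge: "J \<ge> X * r * (d * (M + 2)) - 5 * exp 2 * d\<^sup>2 * q\<^sup>2 * sqrt T"
  proof -
    have "d * (M + 2) \<le> d * (real E / real (E + 1) * S)"
      using sum d by (intro mult_left_mono) (auto simp: S_def \<sigma>_def)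
    also have "\<dots> = (\<Sum>p | prime p \<and> p \<le> Y. ln (real p) * real p powr (- \<sigma>) * (real E / real (E + 1) * d))"
      by (simp add: S_def sum_distrib_left sum_distrib_right mult_ac)
    also have "\<dots> \<le> (\<Sum>p | prime p \<and> p \<le> Y. ln (real p) * real p powr (- \<sigma>) * real (card {n \<in> D. p * n \<in> D}))"
    proof (intro sum_mono mult_left_mono)
      fix p assume p: "p \<in> {p. prime p \<and> p \<le> Y}"
      then show "real E / real (E + 1) * d \<le> real (card {n \<in> D. p * n \<in> D})"
        using card_shift_resonator[of p Y E] by (simp add: d_def D_def Q_def)
      show "0 \<le> ln (real p) * real p powr (- \<sigma>)"
        using p prime_ge_1_nat[of p] by (intro mult_nonneg_nonneg ln_ge_zero) auto
    qed
    finally have "X * r * (d * (M + 2)) \<le> X * r *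
        (\<Sum>p | prime p \<and> p \<le> Y. ln (real p) * real p powr (- \<sigma>) * real (card {n \<in> D. p * n \<in> D}))"
      using XT r by (intro mult_left_mono mult_nonneg_nonneg) auto
    moreover have "J \<ge> X * r *
        (\<Sum>p | prime p \<and> p \<le> Y. ln (real p) * real p powr (- \<sigma>) * real (card {n \<in> D. p * n \<in> D}))
        - 5 * exp 2 * d\<^sup>2 * (real Q)\<^sup>2 * sqrt X"
      unfolding J_def r_def d_def
      by (rule reg_log_deriv_res_integral(2)[OF RH C _ _ XT(2) D]) (use \<sigma> in \<open>simp_all add: \<sigma>_def\<close>)
    moreover have "5 * exp 2 * d\<^sup>2 * (real Q)\<^sup>2 * sqrt X \<le> 5 * exp 2 * d\<^sup>2 * q\<^sup>2 * sqrt T"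
      using q XT d by (intro mult_mono power_mono) auto
    ultimately show ?thesis by linarith
  qed
  have I_le: "M * (LBINT t. res_weight D X t) \<le> X * r * (d * (M + 1))"
  proof -
    have "(LBINT t. res_weight D X t) \<le> X * r * (d + d\<^sup>2 * exp (- ((X / real Q)\<^sup>2 / 2)))"
      unfolding r_def d_def by (rule res_weight_integral_le[OF _ D]) (use XT in simp)
    then have "M * (LBINT t. res_weight D X t) \<le> M * (X * r * (d + d\<^sup>2 * exp (- ((X / real Q)\<^sup>2 / 2))))"
      using M by (intro mult_left_mono) auto
    also have "\<dots> = X * r * (d * (M + M * d * exp (- ((X / real Q)\<^sup>2 / 2))))"
      by (simp add: power2_eq_square algebra_simps)
    \<comment> \<open>\<open>M\<close> and \<open>d\<close> are at most \<open>T\<close>, and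
      \<open>Q\<close> is at most \<open>q\<close>; \<open>sep\<close> is stated for these cruder
      quantities.\<close>
    also have "M * d * exp (- ((X / real Q)\<^sup>2 / 2)) \<le> T * T * exp (- ((X / q)\<^sup>2 / 2))"
    proof -
      have "X / q \<le> X / real Q" using q Q0 XT by (intro divide_left_mono mult_pos_pos) auto
      then have "(X / q)\<^sup>2 \<le> (X / real Q)\<^sup>2" using XT q by (intro power_mono) auto
      then show ?thesis using M d q T1 by (intro mult_mono mult_nonneg_nonneg) auto
    qed
    also have "\<dots> \<le> 1" using sep by (simp add: X_def q_def L_def)
    finally show ?thesis using XT r d by (simp add: mult_left_mono)
  qed
  note large = res_large_values[OF RH C _ _ XT(2) D _ T(3) M(2), of \<sigma>]
  have cl: "closed \<Omega>" unfolding \<Omega>_def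
    by (rule large(1)) (use \<sigma> in \<open>simp_all add: \<sigma>_def\<close>)
  have J_le: "J \<le> 2 * C * ln (T + 4) * d\<^sup>2 * measure lborel \<Omega> + M * (LBINT t. res_weight D X t)
      + 2 * C * ln (T + 4) * d\<^sup>2 * T powr \<beta> + d\<^sup>2 * (6 * C * T * (T\<^sup>2 + 4) * e1)"
  proof -
    \<comment> \<open>\<open>T / X = L\<close>, so the width of the Gaussian makes the tail smaller
      than any power of \<open>T\<close>.\<close>
    have ex: "exp (- (T\<^sup>2 / (8 * X\<^sup>2))) = e1"
      using T1 by (simp add: X_def power_divide e1_def)
    have "J \<le> 2 * C * ln (T + 4) * d\<^sup>2 * measure lborel \<Omega> + M * (LBINT t. res_weight D X t)
      + 2 * C * ln (T + 4) * d\<^sup>2 * T powr \<beta>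
      + C * d\<^sup>2 * (X\<^sup>2 + 4) * e1 * (2 * X * r)"
      unfolding J_def d_def \<Omega>_def r_def ex[symmetric]
      by (rule large(2)) (use \<sigma> in \<open>simp_all add: \<sigma>_def\<close>)
    moreover have "C * d\<^sup>2 * (X\<^sup>2 + 4) * e1 * (2 * X * r) \<le> C * d\<^sup>2 * (T\<^sup>2 + 4) * e1 * (2 * T * 3)"
      using XT r C T1 d by (intro mult_mono add_mono power_mono mult_nonneg_nonneg) (auto simp: e1_def)
    moreover have "C * d\<^sup>2 * (T\<^sup>2 + 4) * e1 * (2 * T * 3) = d\<^sup>2 * (6 * C * T * (T\<^sup>2 + 4) * e1)"
      by simp
    ultimately show ?thesis by linarith
  qed
  \<comment> \<open>The main terms \<open>d * (M + 2)\<close> and \<open>d * (M + 1)\<close> leave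
    one unit \<open>X * r * d\<close>, while every error is at most a multiple of
    \<open>d\<^sup>2\<close>. After division the left side is at least \<open>2 * X / q\<close>,
    since \<open>r \<ge> 2\<close> and \<open>d \<le> q\<close>.\<close>
  have "X * r * d \<le> d\<^sup>2 * (2 * C * ln (T + 4) * measure lborel \<Omega> + 2 * C * ln (T + 4) * T powr \<beta>
      + 5 * exp 2 * q\<^sup>2 * sqrt T + 6 * C * T * (T\<^sup>2 + 4) * e1)"
    using J_ge J_le I_le by (simp add: algebra_simps)
  then have "X * r / d \<le> 2 * C * ln (T + 4) * measure lborel \<Omega> + 2 * C * ln (T + 4) * T powr \<beta>
      + 5 * exp 2 * q\<^sup>2 * sqrt T + 6 * C * T * (T\<^sup>2 + 4) * e1"
    using d by (simp add: divide_le_eq power2_eq_square mult_ac)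
  moreover have "2 * X / q \<le> X * r / d"
    using XT r d q by (intro frac_le) (auto simp: mult_ac)
  ultimately have "2 * C * ln (T + 4) * B \<le> 2 * C * ln (T + 4) * measure lborel \<Omega>"
    using bal by (simp add: X_def L_def q_def e1_def)
  moreover have "2 * C * ln (T + 4) > 0" using C T1 by simp
  ultimately have "B \<le> measure lborel \<Omega>" by (simp add: mult_le_cancel_left_pos)
  also have "\<dots> = measure lebesgue \<Omega>" using cl by (simp add: measure_completion)
  also have "\<dots> \<le> measure lebesgue (large_set \<beta> A T x)"
  proof (rule measure_mono_fmeasurable)
    show "\<Omega> \<subseteq> large_set \<beta> A T x"
      unfolding \<Omega>_def \<sigma>_def M(1) by (rule large_values_subset(1)[OF RH T(2) \<sigma>(1)])
    show "\<Omega> \<in> sets lebesgue" using cl by simp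
    have "compact (large_set \<beta> A T x)"
      using large_values_subset(2)[OF RH T(2) \<sigma>(1)]
      by (auto simp: compact_eq_bounded_closed large_set_def intro: bounded_subset[of "{T powr \<beta>..T}"])
    then show "large_set \<beta> A T x \<in> lmeasurable" by (rule lmeasurable_compact)
  qed
  finally show ?thesis .
qed

theorem theorem2:
  fixes \<beta> A x :: real
  assumes RH: "riemann_hypothesis"
    and \<beta>: "0 < \<beta>" "\<beta> < 1"
    and A: "A > 0"
    and x: "x > 0"
  shows "\<exists>\<epsilon> :: real \<Rightarrow> real. \<epsilon> \<in> o[at_top](\<lambda>_. 1) \<and>
    (\<forall>\<^sub>F T in at_top.
       measure lebesgue (large_set \<beta> A T x) \<ge> T powr (1 - (1 - \<beta>) * exp (- x) + \<epsilon> T))"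
proof (intro exI[of _ "\<lambda>_. 0"] conjI)
  obtain C where C: "C > 0"
    "\<And>s. 3 / 4 \<le> Re s \<Longrightarrow> Re s \<le> 2 \<Longrightarrow> norm (reg_log_deriv s) \<le> C * ln (\<bar>Im s\<bar> + 4)"
    using reg_log_deriv_bound[OF RH] by blast
  \<comment> \<open>\<open>1 - \<delta>\<close> is the target exponent. As \<open>x > 0\<close>
    gives \<open>\<delta> < 1 - \<beta>\<close>, the choice \<open>2 * \<eta> \<le> \<delta>\<close>
    also makes the heights below \<open>T powr \<beta>\<close> negligible; the cap 1/8 comes from
    \<open>final_balance\<close>.\<close>
  define \<delta> where "\<delta> = (1 - \<beta>) * exp (- x)"
  define \<eta> where "\<eta> = min (\<delta> / 2) (1 / 8)"
  define k where "k = (exp A - 1) / A"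
  have k: "k > 0" using A by (simp add: k_def)
  have \<delta>: "\<delta> > 0" "\<delta> < 1 - \<beta>" using \<beta> x by (simp_all add: \<delta>_def)
  have \<eta>: "0 < \<eta>" "\<eta> \<le> 1 / 8" "2 * \<eta> \<le> \<delta>" "\<beta> \<le> 1 - 2 * \<eta>"
    using \<delta> by (auto simp: \<eta>_def)
  have e1: "\<forall>\<^sub>F T in at_top. T \<ge> (exp 1 :: real)" by (rule eventually_ge_at_top)
  have e3: "\<forall>\<^sub>F T in at_top. ln (ln T) \<ge> 4 * A" using A by real_asymp
  have e4: "\<forall>\<^sub>F T in at_top. ln (ln T) / ln (ln (ln T)) * (k * ln (ln (ln T)) - x) + 1 \<ge> (0::real)"
    using k x by real_asymp
  have e5: "\<forall>\<^sub>F T in at_top. ln (ln T) / ln (ln (ln T)) * (k * ln (ln (ln T)) - x) + 1 \<le> T"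
    using k x by real_asymp
  \<comment> \<open>The requirement is hardest for the largest admissible exponent 1/8, so checking
    that one suffices.\<close>
  have "\<forall>\<^sub>F T in at_top. T * T * exp (- ((T / ln T / T powr (1 / 8))\<^sup>2 / 2)) \<le> (1::real)"
    by real_asymp
  then have e6: "\<forall>\<^sub>F T in at_top. T * T * exp (- ((T / ln T / T powr \<eta>)\<^sup>2 / 2)) \<le> 1"
    using e1
  proof eventually_elim
    case (elim T)
    have T: "T \<ge> 1" "ln T \<ge> 0" using elim exp_ge_add_one_self[of "1::real"] by auto
    have "T / ln T / T powr (1 / 8) \<le> T / ln T / T powr \<eta>"
      using T \<eta> by (intro divide_left_mono powr_mono mult_pos_pos divide_nonneg_nonneg) auto
    then have "(T / ln T / T powr (1 / 8))\<^sup>2 \<le> (T / ln T / T powr \<eta>)\<^sup>2"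
      using T by (intro power_mono) auto
    then have "T * T * exp (- ((T / ln T / T powr \<eta>)\<^sup>2 / 2)) \<le> T * T * exp (- ((T / ln T / T powr (1 / 8))\<^sup>2 / 2))"
      using T by (intro mult_left_mono) auto
    then show ?case using elim by linarith
  qed
  have "\<forall>\<^sub>F T in at_top. measure lebesgue (large_set \<beta> A T x) \<ge> T powr (1 - \<delta>)"
    using e1 e3 e4 e5 e6 resonator_size[OF \<eta>(1)] res_prime_sum_lower[OF A x] final_balance[OF C(1) \<eta>]
  proof eventually_elim
    case (elim T)
    have T: "T \<ge> 1" using elim(1) exp_ge_add_one_self[of "1::real"] by linarith
    have "0 < ln (ln T)" using elim(2) A by linarith
    then have \<sigma>: "3 / 4 \<le> sigma_A A T" "sigma_A A T \<le> 2"
      using elim(2) A by (auto simp: sigma_A_def field_simps)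
    have "T powr \<beta> \<le> T powr 1" "T powr \<eta> \<le> T powr 1"
      using T \<beta> \<eta> by (intro powr_mono; simp)+
    then have pow: "T powr \<beta> \<ge> 1" "T powr \<beta> \<le> T" "T powr \<eta> \<le> T"
      using T \<beta> by (auto intro: ge_one_powr_ge_zero)
    show ?case
      by (rule large_set_measure_ge[OF RH C elim(1) pow(1,2) A \<sigma> refl _ _ _ elim(6) pow(3) elim(5) elim(8)])
         (use elim(3,4,7) in \<open>simp_all add: k_def\<close>)
  qed
  then show "\<forall>\<^sub>F T in at_top. measure lebesgue (large_set \<beta> A T x) \<ge> T powr (1 - (1 - \<beta>) * exp (- x) + 0)"
    by (simp add: \<delta>_def)
qed simp

end
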